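(* Let $N\ge3$. For every $w\in\mathcal W$, $$\|w\|_{\mathcal W}^2=\lim_{\varepsilon\to0}\Big(I_{1/\varepsilon}[w]+\Lambda_{1/\varepsilon}(w)\Big).$$
   Context: $B_r$ is the ball in $\mathbb{R}^N$ of radius $r$ centered at $0$. $H=H(B_1)$ is the completion of $C_0^\infty(B_1)$ under the norm $\|\phi\|_H^2=\int_{B_1}|\nabla\phi|^2dx-\big(\frac{N-2}{2}\big)^2\int_{B_1}\frac{\phi^2}{|x|^2}dx$, regarded as a space of functions on $B_1$. $\mathcal W$ is the space of functions $w$ on $\{|y|\ge1\}$ that is the isometric image of $H$ under the Kelvin transformation $u(x)=|y|^{N-2}w(y)$, $y=x/|x|^2$: $w\in\mathcal W$ iff the corresponding $u$ lies in $H$, and $$\|w\|_{\mathcal W}^2=\|u\|_H^2=\lim_{\varepsilon\to0}\Big(\int_{B_1\setminus B_\varepsilon}|\nabla u|^2dx-\Big(\frac{N-2}{2}\Big)^2\int_{B_1\setminus B_\varepsilon}\frac{u^2}{|x|^2}dx-\frac{N-2}{2}\,\varepsilon^{-1}\int_{\partial B_\varepsilon}u^2\,dS\Big).$$ Further, $$I_{1/\varepsilon}[w]=\int_{B_{1/\varepsilon}\setminus B_1}|\nabla w|^2dy-\Big(\frac{N-2}{2}\Big)^2\int_{B_{1/\varepsilon}\setminus B_1}\frac{w^2}{|y|^2}dy,\qquad \Lambda_{1/\varepsilon}(w)=\frac{N-2}{2}\,\varepsilon\int_{\partial B_{1/\varepsilon}}w^2\,dS .$$ *)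

theory Defs
  imports "HOL-Analysis.Analysis"
begin

section \<open>Smooth functions and test functions\<close>

primrec C_k_on :: "nat \<Rightarrow> 'a::euclidean_space set \<Rightarrow> ('a \<Rightarrow> real) \<Rightarrow> bool" where
  "C_k_on 0 S f \<longleftrightarrow> continuous_on S f"
| "C_k_on (Suc k) S f \<longleftrightarrow> (\<forall>x\<in>S. f differentiable (at x)) \<and>
     (\<forall>i\<in>Basis. C_k_on k S (\<lambda>x. frechet_derivative f (at x) i))"

definition smooth :: "('a::euclidean_space \<Rightarrow> real) \<Rightarrow> bool" where
  "smooth f \<longleftrightarrow> (\<forall>k. C_k_on k UNIV f)"

definition test_functions :: "'a::euclidean_space set \<Rightarrow> ('a \<Rightarrow> real) set" where
  "test_functions \<Omega> = {\<phi>. smooth \<phi> \<and> compact (closure {x. \<phi> x \<noteq> 0}) \<and> closure {x. \<phi> x \<noteq> 0} \<subseteq> \<Omega>}"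

definition grad :: "('a::euclidean_space \<Rightarrow> real) \<Rightarrow> 'a \<Rightarrow> 'a" where
  "grad f x = (\<Sum>i\<in>Basis. frechet_derivative f (at x) i *\<^sub>R i)"

section \<open>Weak gradients, surface measure and traces\<close>

definition L2_converges ::
    "'a measure \<Rightarrow> (nat \<Rightarrow> 'a \<Rightarrow> 'b::{real_normed_vector, second_countable_topology}) \<Rightarrow> ('a \<Rightarrow> 'b) \<Rightarrow> bool" where
  "L2_converges M f g \<longleftrightarrow> (\<forall>n. f n \<in> borel_measurable M) \<and> g \<in> borel_measurable M \<and>
     (\<lambda>n. \<integral>\<^sup>+ x. ennreal ((norm (f n x - g x))\<^sup>2) \<partial>M) \<longlonglongrightarrow> 0"

definition is_weak_gradient ::
    "'a::euclidean_space set \<Rightarrow> ('a \<Rightarrow> real) \<Rightarrow> ('a \<Rightarrow> 'a) \<Rightarrow> bool" where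
  "is_weak_gradient \<Omega> w G \<longleftrightarrow>
     (\<forall>K. compact K \<and> K \<subseteq> \<Omega> \<longrightarrow> w absolutely_integrable_on K \<and> G absolutely_integrable_on K) \<and>
     (\<forall>\<phi>\<in>test_functions \<Omega>.
        (LINT x:\<Omega>|lebesgue. w x *\<^sub>R grad \<phi> x) = - (LINT x:\<Omega>|lebesgue. \<phi> x *\<^sub>R G x))"

text \<open>A weak gradient is determined only up to null sets; an arbitrary representative is chosen.\<close>

definition weak_gradient :: "'a::euclidean_space set \<Rightarrow> ('a \<Rightarrow> real) \<Rightarrow> 'a \<Rightarrow> 'a" where
  "weak_gradient \<Omega> w = (SOME G. is_weak_gradient \<Omega> w G)"

text \<open>Surface measure on the sphere of radius \<open>r\<close> about the origin, as a measure on the whole space: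
  the mass of \<open>A\<close> is \<open>N / r\<close> times the Lebesgue measure of the part of the ball of radius \<open>r\<close> lying
  in the cone over \<open>A\<close>.\<close>

definition sphere_measure :: "real \<Rightarrow> 'a::euclidean_space measure" where
  "sphere_measure r =
     distr (scale_measure (ennreal (real DIM('a) / r)) (restrict_space lborel (ball 0 r)))
       borel (\<lambda>x. (r / norm x) *\<^sub>R x)"

text \<open>The trace on the outer boundary of the annulus \<open>1 < |y| < R\<close>: the continuous extension, from
  the \<open>H\<^sup>1\<close> norm of the annulus to the \<open>L\<^sup>2\<close> norm of the sphere, of restriction of
  functions smooth up to the boundary.\<close>

definition is_sphere_trace ::
    "real \<Rightarrow> ('a::euclidean_space \<Rightarrow> real) \<Rightarrow> ('a \<Rightarrow> real) \<Rightarrow> bool" where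
  "is_sphere_trace R w g \<longleftrightarrow>
     (\<exists>\<psi>. (\<forall>n. smooth (\<psi> n)) \<and>
        L2_converges (lebesgue_on (ball 0 R - cball 0 1)) \<psi> w \<and>
        L2_converges (lebesgue_on (ball 0 R - cball 0 1)) (\<lambda>n. grad (\<psi> n)) (weak_gradient (- cball 0 1) w) \<and>
        L2_converges (sphere_measure R) \<psi> g)"

definition sphere_trace :: "real \<Rightarrow> ('a::euclidean_space \<Rightarrow> real) \<Rightarrow> 'a \<Rightarrow> real" where
  "sphere_trace R w = (SOME g. is_sphere_trace R w g)"

section \<open>The space H\<close>

definition hardy_norm :: "('a::euclidean_space \<Rightarrow> real) \<Rightarrow> real" where
  "hardy_norm \<phi> = sqrt ((LINT x:ball 0 1|lebesgue. (norm (grad \<phi> x))\<^sup>2)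
     - ((real DIM('a) - 2) / 2)\<^sup>2 * (LINT x:ball 0 1|lebesgue. (\<phi> x)\<^sup>2 / (norm x)\<^sup>2))"

text \<open>The completion is realised as a space of functions on the unit ball through its continuous
  embedding into \<open>L\<^sup>2\<close> (Hardy inequality with remainder term): a function belongs to it when it is the
  \<open>L\<^sup>2\<close> limit of test functions that are Cauchy for the Hardy norm. Values
  outside the unit ball are irrelevant.\<close>

definition H_approx :: "(nat \<Rightarrow> 'a::euclidean_space \<Rightarrow> real) \<Rightarrow> ('a \<Rightarrow> real) \<Rightarrow> bool" where
  "H_approx \<phi> u \<longleftrightarrow> (\<forall>n. \<phi> n \<in> test_functions (ball 0 1)) \<and>
     (\<forall>e>0. \<exists>M. \<forall>m\<ge>M. \<forall>n\<ge>M. hardy_norm (\<lambda>x. \<phi> m x - \<phi> n x) < e) \<and>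
     L2_converges (lebesgue_on (ball 0 1)) \<phi> u"

definition H_space :: "('a::euclidean_space \<Rightarrow> real) set" where
  "H_space = {u. \<exists>\<phi>. H_approx \<phi> u}"

definition H_norm :: "('a::euclidean_space \<Rightarrow> real) \<Rightarrow> real" where
  "H_norm u = (THE L. \<exists>\<phi>. H_approx \<phi> u \<and> (\<lambda>n. hardy_norm (\<phi> n)) \<longlonglongrightarrow> L)"

section \<open>The space W\<close>

text \<open>Only the values of \<open>w\<close> for \<open>|y| > 1\<close> matter.\<close>

definition kelvin :: "('a::euclidean_space \<Rightarrow> real) \<Rightarrow> 'a \<Rightarrow> real" where
  "kelvin w x = (let y = x /\<^sub>R (norm x)\<^sup>2 in norm y ^ (DIM('a) - 2) * w y)"

definition W_space :: "('a::euclidean_space \<Rightarrow> real) set" where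
  "W_space = {w. kelvin w \<in> H_space}"

definition W_norm :: "('a::euclidean_space \<Rightarrow> real) \<Rightarrow> real" where
  "W_norm w = H_norm (kelvin w)"

definition I_energy :: "real \<Rightarrow> ('a::euclidean_space \<Rightarrow> real) \<Rightarrow> real" where
  "I_energy R w =
     (LINT y:ball 0 R - ball 0 1|lebesgue. (norm (weak_gradient (- cball 0 1) w y))\<^sup>2)
     - ((real DIM('a) - 2) / 2)\<^sup>2 * (LINT y:ball 0 R - ball 0 1|lebesgue. (w y)\<^sup>2 / (norm y)\<^sup>2)"

definition Lambda_energy :: "real \<Rightarrow> ('a::euclidean_space \<Rightarrow> real) \<Rightarrow> real" where
  "Lambda_energy R w =
     (real DIM('a) - 2) / 2 * (1 / R) * (LINT y|sphere_measure R. (sphere_trace R w y)\<^sup>2)"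

end

theory Submission
  imports Defs
begin

text \<open>
  Let \<open>N\<close> be the dimension, \<open>c = (N - 2) / 2\<close>, \<open>x* = x / |x|\<^sup>2\<close> the inversion, and
  \<open>A f = \<nabla>f + c f x*\<close>, called \<open>hardy_grad f\<close> below. Equivalently
  \<open>A f = |x|^(-c) \<nabla>(|x|^c f)\<close>: the field comes from the substitution that factors out the virtual ground
  state of the Hardy operator. Expanding the square gives
  \<open>|A f|\<^sup>2 = |\<nabla>f|\<^sup>2 - c\<^sup>2 f\<^sup>2 / |x|\<^sup>2 + c div (f\<^sup>2 x*)\<close>, and everything rests on integrating this
  identity over two domains.

  On the unit ball, for a test function \<open>\<phi>\<close>, the divergence integrates to zero, because \<open>N \<ge> 3\<close> removes the
  contribution of the origin. Hence the squared Hardy norm of \<open>\<phi>\<close> is the integral of \<open>|A \<phi>|\<^sup>2\<close>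
  (\<open>hardy_norm_eq\<close>). This energy is conformally invariant: for the Kelvin transform \<open>\<psi>\<close> of \<open>\<phi>\<close> the
  density \<open>|A \<psi>|\<^sup>2\<close> at \<open>y\<close> is \<open>|y|^(-2N)\<close> times \<open>|A \<phi>|\<^sup>2\<close> at \<open>y*\<close>
  (\<open>norm_hardy_grad_kelvin\<close>). That factor is exactly the Jacobian of the inversion, so the Hardy norm is also the \<open>L\<^sup>2\<close> norm of \<open>A \<psi>\<close> over
  \<open>|y| > 1\<close> (\<open>hardy_norm_kelvin\<close>). On the annulus \<open>1 < |y| < R\<close> the function \<open>\<psi>\<close> vanishes near the inner
  sphere, and the divergence contributes precisely the boundary term \<open>\<Lambda>\<close>; so \<open>I + \<Lambda>\<close> is the
  integral of \<open>|A \<psi>|\<^sup>2\<close> over the annulus.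

  Now let test functions \<open>\<phi>\<close> approximate the Kelvin transform of \<open>w\<close>, with Kelvin transforms \<open>\<psi>\<close>. The fields
  \<open>A \<psi>\<close> form a Cauchy sequence in \<open>L\<^sup>2\<close> of the exterior domain, while \<open>\<psi>\<close> tends to \<open>w\<close> in
  \<open>L\<^sup>2\<close> of each annulus. So \<open>\<nabla>\<psi>\<close> converges on annuli, the limit is a weak gradient of \<open>w\<close>, and the limit
  of \<open>A \<psi>\<close> is \<open>Z = \<nabla>w + c w y*\<close>. Since weak gradients are unique almost everywhere
  (\<open>weak_gradient_unique\<close>), \<open>Z\<close> depends on \<open>w\<close> alone. Therefore \<open>H_norm\<close> is well defined and its square is
  the integral of \<open>|Z|\<^sup>2\<close> over \<open>|y| > 1\<close> (\<open>H_approx_kelvin\<close>), and \<open>I + \<Lambda>\<close> for \<open>w\<close> is the integral of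
  \<open>|Z|\<^sup>2\<close> over the annulus (\<open>energy_annulus\<close>). The annuli exhaust the exterior domain, which proves the theorem.

  The boundary term requires control of traces. For a smooth \<open>\<psi>\<close>, whatever its values at \<open>|y| = 1\<close>, the
  integral of \<open>\<psi>\<^sup>2\<close> over the outer sphere is a volume integral, by the divergence theorem for
  \<open>(|y|\<^sup>2 - 1) \<psi>\<^sup>2 y\<close>. Applied to differences it yields the existence of the trace
  (\<open>trace_exists\<close>), and in the limit it expresses the integral of the squared trace by \<open>w\<close> and its weak gradient
  (\<open>trace_limit\<close>). Only radial fields occur, so the divergence theorem reduces to polar coordinates and the
  fundamental theorem of calculus on rays (\<open>radial_divergence\<close>).
\<close>

section \<open>Calculus of smooth functions\<close>

text \<open>The premise on congruence is the instance of the next lemma at level \<open>k\<close>; carrying it as a premise lets the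
same rule serve inside the induction that proves that lemma.\<close>

lemma C_k_on_SucI:
  assumes "open S" and "\<And>x. x \<in> S \<Longrightarrow> (f has_derivative f' x) (at x)"
    and "\<And>i. i \<in> Basis \<Longrightarrow> C_k_on k S (\<lambda>x. f' x i)"
    and cong: "\<And>g h. (\<And>x. x \<in> S \<Longrightarrow> g x = h x) \<Longrightarrow> C_k_on k S g \<Longrightarrow> C_k_on k S h"
  shows "C_k_on (Suc k) S f"
proof -
  have *: "frechet_derivative f (at x) = f' x" if "x \<in> S" for x
    using assms(2)[OF that] frechet_derivative_at by metis
  have "C_k_on k S (\<lambda>x. frechet_derivative f (at x) i)" if "i \<in> Basis" for i
    by (rule cong[OF _ assms(3)[OF that]]) (simp add: *)
  then show ?thesis
    using assms(2) by (auto simp: differentiable_def)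
qed

lemma C_k_on_cong:
  assumes "open S"
  shows "(\<And>x. x \<in> S \<Longrightarrow> f x = g x) \<Longrightarrow> C_k_on k S f \<Longrightarrow> C_k_on k S g"
proof (induction k arbitrary: f g)
  case 0
  then show ?case using continuous_on_cong[of S S f g] by simp
next
  case (Suc k)
  have d: "(g has_derivative frechet_derivative f (at x)) (at x)" if "x \<in> S" for x
    using has_derivative_transform_within_open[OF _ \<open>open S\<close> that Suc.prems(1)]
      Suc.prems(2) that by (auto simp: frechet_derivative_works)
  show ?case
    by (rule C_k_on_SucI[OF \<open>open S\<close> d _ Suc.IH]) (use Suc.prems in auto)
qed

lemma C_k_on_Suc_intro:
  assumes "open S" and "\<And>x. x \<in> S \<Longrightarrow> (f has_derivative f' x) (at x)"
    and "\<And>i. i \<in> Basis \<Longrightarrow> C_k_on k S (\<lambda>x. f' x i)"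
  shows "C_k_on (Suc k) S f"
  by (rule C_k_on_SucI[OF assms C_k_on_cong[OF \<open>open S\<close>]])

lemma C_k_on_SucD: "C_k_on (Suc k) S f \<Longrightarrow> C_k_on k S f"
proof (induction k arbitrary: f)
  case 0
  then have "\<forall>x\<in>S. f differentiable (at x)"
    by simp
  then have "continuous_on S f"
    by (intro continuous_at_imp_continuous_on ballI differentiable_imp_continuous_within) blast
  then show ?case
    by simp
next
  case (Suc k)
  have "\<forall>x\<in>S. f differentiable (at x)" "\<forall>i\<in>Basis. C_k_on (Suc k) S (\<lambda>x. frechet_derivative f (at x) i)"
    using Suc.prems C_k_on.simps(2)[of "Suc k" S f] by blast+
  then show ?case
    by (subst C_k_on.simps(2)) (blast intro: Suc.IH)
qed

lemma C_k_on_const: "open S \<Longrightarrow> C_k_on k S (\<lambda>x. a)"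
proof (induction k arbitrary: a)
  case (Suc k)
  show ?case
    by (rule C_k_on_Suc_intro[where f' = "\<lambda>_ _. 0", OF Suc.prems has_derivative_const Suc.IH[OF Suc.prems]])
qed auto

lemma C_k_on_add:
  "open S \<Longrightarrow> C_k_on k S f \<Longrightarrow> C_k_on k S g \<Longrightarrow> C_k_on k S (\<lambda>x. f x + g x)"
proof (induction k arbitrary: f g)
  case (Suc k)
  show ?case
    by (rule C_k_on_Suc_intro[where f' = "\<lambda>x h. frechet_derivative f (at x) h + frechet_derivative g (at x) h"])
       (use Suc.prems in \<open>auto intro!: has_derivative_add Suc.IH simp: frechet_derivative_works[symmetric]\<close>)
qed (auto intro: continuous_intros)

lemma C_k_on_mult:
  "open S \<Longrightarrow> C_k_on k S f \<Longrightarrow> C_k_on k S g \<Longrightarrow> C_k_on k S (\<lambda>x. f x * g x)"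
proof (induction k arbitrary: f g)
  case (Suc k)
  show ?case
  proof (rule C_k_on_Suc_intro[where f' = "\<lambda>x h. f x * frechet_derivative g (at x) h + frechet_derivative f (at x) h * g x"])
    show "((\<lambda>x. f x * g x) has_derivative (\<lambda>h. f x * frechet_derivative g (at x) h + frechet_derivative f (at x) h * g x)) (at x)"
      if "x \<in> S" for x
      using Suc.prems that by (intro has_derivative_mult) (auto simp: frechet_derivative_works[symmetric])
    show "C_k_on k S (\<lambda>x. f x * frechet_derivative g (at x) i + frechet_derivative f (at x) i * g x)"
      if "i \<in> Basis" for i
      using Suc.prems that C_k_on_SucD[OF Suc.prems(2)] C_k_on_SucD[OF Suc.prems(3)]
      by (intro C_k_on_add Suc.IH) auto
  qed fact
qed (auto intro: continuous_intros)

lemma C_k_on_Un: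
  "open S \<Longrightarrow> open T \<Longrightarrow> C_k_on k S f \<Longrightarrow> C_k_on k T f \<Longrightarrow> C_k_on k (S \<union> T) f"
  by (induction k arbitrary: f) (auto intro: continuous_on_open_Un)

text \<open>The Kelvin transform is differentiated away from the origin, hence smoothness on an open set is needed.\<close>

definition smooth_on :: "'a::euclidean_space set \<Rightarrow> ('a \<Rightarrow> real) \<Rightarrow> bool" where
  "smooth_on S f \<longleftrightarrow> (\<forall>k. C_k_on k S f)"

lemma smooth_iff_smooth_on: "smooth f \<longleftrightarrow> smooth_on UNIV f"
  by (simp add: smooth_def smooth_on_def)

lemma smooth_on_const: "open S \<Longrightarrow> smooth_on S (\<lambda>x. a)"
  by (simp add: smooth_on_def C_k_on_const)

lemma smooth_on_add: "open S \<Longrightarrow> smooth_on S f \<Longrightarrow> smooth_on S g \<Longrightarrow> smooth_on S (\<lambda>x. f x + g x)"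
  by (simp add: smooth_on_def C_k_on_add)

lemma smooth_on_mult: "open S \<Longrightarrow> smooth_on S f \<Longrightarrow> smooth_on S g \<Longrightarrow> smooth_on S (\<lambda>x. f x * g x)"
  by (simp add: smooth_on_def C_k_on_mult)

lemma smooth_on_diff: "open S \<Longrightarrow> smooth_on S f \<Longrightarrow> smooth_on S g \<Longrightarrow> smooth_on S (\<lambda>x. f x - g x)"
  using smooth_on_add[of S f "\<lambda>x. (-1) * g x"] smooth_on_mult[OF _ smooth_on_const, of S g "-1"] by auto

lemma smooth_on_prod:
  "open S \<Longrightarrow> (\<And>i. i \<in> I \<Longrightarrow> smooth_on S (f i)) \<Longrightarrow> smooth_on S (\<lambda>x. \<Prod>i\<in>I. f i x)"
  by (induction I rule: infinite_finite_induct) (auto intro: smooth_on_const smooth_on_mult)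

lemma smooth_on_differentiable: "smooth_on S f \<Longrightarrow> x \<in> S \<Longrightarrow> f differentiable at x"
  unfolding smooth_on_def by (metis C_k_on.simps(2))

lemma smooth_on_frechet_derivative:
  "smooth_on S f \<Longrightarrow> i \<in> Basis \<Longrightarrow> smooth_on S (\<lambda>x. frechet_derivative f (at x) i)"
  unfolding smooth_on_def by (metis C_k_on.simps(2))

lemma smooth_on_inner: 
  assumes "open S" shows "smooth_on S (\<lambda>x. x \<bullet> a)"
proof -
  have "C_k_on k S (\<lambda>x. x \<bullet> a)" for k
  proof (cases k)
    case (Suc m)
    show ?thesis unfolding Suc
      by (rule C_k_on_Suc_intro[where f' = "\<lambda>_ h. h \<bullet> a"])
         (use assms in \<open>auto intro!: derivative_eq_intros C_k_on_const\<close>)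
  qed (auto intro: continuous_intros)
  then show ?thesis by (simp add: smooth_on_def)
qed

text \<open>The derivative is written as a product of a coordinate and two functions of the same form: the class of such
products is closed under differentiation, which gives smoothness by induction.\<close>

lemma has_derivative_inverse_norm_power:
  fixes y :: "'a::real_inner"
  assumes "y \<noteq> 0"
  shows "((\<lambda>y. inverse (norm y ^ m)) has_derivative
     (\<lambda>h. - real m * (h \<bullet> y) * inverse (norm y ^ m) * inverse (norm y ^ 2))) (at y)"
proof -
  have "((\<lambda>y. inverse (norm y ^ m)) has_derivative
     (\<lambda>h. - (inverse (norm y ^ m) * (of_nat m * (h \<bullet> sgn y) * norm y ^ (m - 1)) * inverse (norm y ^ m)))) (at y)"
    using assms by (auto intro!: derivative_eq_intros has_derivative_norm)
  moreover have "- (inverse (norm y ^ m) * (of_nat m * (h \<bullet> sgn y) * norm y ^ (m - 1)) * inverse (norm y ^ m))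
     = - real m * (h \<bullet> y) * inverse (norm y ^ m) * inverse (norm y ^ 2)" for h
    using assms by (cases m) (auto simp: sgn_div_norm divide_simps power2_eq_square algebra_simps)
  ultimately show ?thesis by (simp only:)
qed

lemma smooth_on_inverse_norm_power:
  "smooth_on (- {0::'a::euclidean_space}) (\<lambda>y. inverse (norm y ^ m))"
proof -
  have o: "open (- {0::'a})" by auto
  have "C_k_on k (- {0::'a}) (\<lambda>y. inverse (norm y ^ m))" for k
  proof (induction k arbitrary: m)
    case 0
    show ?case by (auto intro!: continuous_intros)
  next
    case (Suc k)
    have *: "C_k_on k (- {0}) (\<lambda>x. i \<bullet> x)" for i :: 'a
      using smooth_on_inner[OF o, of i] by (simp add: smooth_on_def inner_commute)
    show ?case
      by (rule C_k_on_Suc_intro[OF o has_derivative_inverse_norm_power])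
         (auto intro!: C_k_on_mult[OF o] C_k_on_const[OF o] Suc * simp only: Compl_iff singleton_iff)
  qed
  then show ?thesis by (simp add: smooth_on_def)
qed

lemma frechet_derivative_eq_sum:
  fixes f :: "'a::euclidean_space \<Rightarrow> real"
  assumes "f differentiable at x"
  shows "frechet_derivative f (at x) h = (\<Sum>i\<in>Basis. (h \<bullet> i) * frechet_derivative f (at x) i)"
proof -
  interpret linear "frechet_derivative f (at x)"
    by (rule linear_frechet_derivative[OF assms])
  have "frechet_derivative f (at x) h = frechet_derivative f (at x) (\<Sum>i\<in>Basis. (h \<bullet> i) *\<^sub>R i)"
    by (simp add: euclidean_representation)
  then show ?thesis by (simp add: sum scale)
qed

text \<open>By the chain rule, a partial derivative of \<open>\<phi> \<circ> h\<close> is a sum of products of a derivative of a coordinate of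
\<open>h\<close> and a function \<open>\<phi>' \<circ> h\<close> with \<open>\<phi>'\<close> again smooth; so the induction on the order has to run over all
\<open>\<phi>\<close>.\<close>

lemma smooth_on_compose:
  fixes \<phi> :: "'b::euclidean_space \<Rightarrow> real" and h :: "'a::euclidean_space \<Rightarrow> 'b"
  assumes "open S" and \<phi>: "smooth \<phi>" and h: "\<And>j. j \<in> Basis \<Longrightarrow> smooth_on S (\<lambda>x. h x \<bullet> j)"
  shows "smooth_on S (\<lambda>x. \<phi> (h x))"
proof -
  have dh: "(h has_derivative (\<lambda>v. \<Sum>j\<in>Basis. frechet_derivative (\<lambda>x. h x \<bullet> j) (at x) v *\<^sub>R j)) (at x)"
    if "x \<in> S" for x
  proof -
    have "((\<lambda>x. \<Sum>j\<in>Basis. (h x \<bullet> j) *\<^sub>R j) has_derivative (\<lambda>v. \<Sum>j\<in>Basis. frechet_derivative (\<lambda>x. h x \<bullet> j) (at x) v *\<^sub>R j)) (at x)"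
      using smooth_on_differentiable[OF h that]
      by (intro has_derivative_sum has_derivative_scaleR_left) (auto simp: frechet_derivative_works[symmetric])
    then show ?thesis by (simp add: euclidean_representation)
  qed
  have "C_k_on k S (\<lambda>x. \<phi> (h x))" for k
    using \<phi>
  proof (induction k arbitrary: \<phi>)
    case 0
    have "continuous_on S h"
      using dh by (meson continuous_at_imp_continuous_on has_derivative_continuous)
    moreover have "continuous_on UNIV \<phi>"
      using 0 unfolding smooth_def by (metis C_k_on.simps(1))
    ultimately show ?case
      using continuous_on_compose2[of UNIV \<phi> S h] by auto
  next
    case (Suc k)
    have d: "((\<lambda>x. \<phi> (h x)) has_derivative (\<lambda>v. frechet_derivative \<phi> (at (h x))
        (\<Sum>j\<in>Basis. frechet_derivative (\<lambda>x. h x \<bullet> j) (at x) v *\<^sub>R j))) (at x)" if "x \<in> S" for x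
    proof -
      have "(\<phi> has_derivative frechet_derivative \<phi> (at (h x))) (at (h x))"
        using smooth_on_differentiable[of UNIV \<phi>] Suc.prems
        by (auto simp: smooth_iff_smooth_on frechet_derivative_works[symmetric])
      then show ?thesis using has_derivative_compose[OF dh[OF that]] by blast
    qed
    show ?case
    proof (rule C_k_on_Suc_intro[OF \<open>open S\<close> d])
      fix i :: 'a assume i: "i \<in> Basis"
      have eq: "frechet_derivative \<phi> (at (h x)) (\<Sum>j\<in>Basis. frechet_derivative (\<lambda>x. h x \<bullet> j) (at x) i *\<^sub>R j)
         = (\<Sum>j\<in>Basis. frechet_derivative (\<lambda>x. h x \<bullet> j) (at x) i * frechet_derivative \<phi> (at (h x)) j)" for x
        using smooth_on_differentiable[of UNIV \<phi> "h x"] Suc.prems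
        by (subst frechet_derivative_eq_sum) (auto simp: smooth_iff_smooth_on)
      have sumC: "(\<And>j. j \<in> J \<Longrightarrow> C_k_on k S (f j)) \<Longrightarrow> C_k_on k S (\<lambda>x. \<Sum>j\<in>J. f j x)" for J :: "'b set" and f
        by (induction J rule: infinite_finite_induct) (auto intro: C_k_on_const C_k_on_add \<open>open S\<close>)
      show "C_k_on k S (\<lambda>x. frechet_derivative \<phi> (at (h x)) (\<Sum>j\<in>Basis. frechet_derivative (\<lambda>x. h x \<bullet> j) (at x) i *\<^sub>R j))"
        unfolding eq
      proof (rule sumC, rule C_k_on_mult[OF \<open>open S\<close>])
        fix j :: 'b assume j: "j \<in> Basis"
        show "C_k_on k S (\<lambda>x. frechet_derivative (\<lambda>x. h x \<bullet> j) (at x) i)"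
          using smooth_on_frechet_derivative[OF h[OF j] i] by (simp add: smooth_on_def)
        show "C_k_on k S (\<lambda>x. frechet_derivative \<phi> (at (h x)) j)"
          using smooth_on_frechet_derivative[of UNIV \<phi> j] Suc.prems j
          by (intro Suc.IH) (simp add: smooth_iff_smooth_on)
      qed
    qed
  qed
  then show ?thesis by (simp add: smooth_on_def)
qed

lemma smooth_has_derivative:
  assumes "smooth f"
  shows "(f has_derivative (\<lambda>h. grad f x \<bullet> h)) (at x)"
proof -
  have d: "f differentiable at x"
    using assms smooth_on_differentiable[of UNIV] by (simp add: smooth_iff_smooth_on)
  have "frechet_derivative f (at x) = (\<lambda>h. grad f x \<bullet> h)"
  proof
    fix h
    show "frechet_derivative f (at x) h = grad f x \<bullet> h"
      by (subst frechet_derivative_eq_sum[OF d])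
         (simp add: grad_def inner_sum_right inner_commute[of _ h] mult.commute)
  qed
  then show ?thesis using d by (metis frechet_derivative_works)
qed

lemma grad_eqI:
  assumes "(f has_derivative (\<lambda>h. g \<bullet> h)) (at x)"
  shows "grad f x = g"
proof -
  have "frechet_derivative f (at x) = (\<lambda>h. g \<bullet> h)"
    using assms frechet_derivative_at by metis
  then show ?thesis by (simp add: grad_def euclidean_representation)
qed

lemma smooth_continuous: "smooth f \<Longrightarrow> continuous_on UNIV f"
  unfolding smooth_def by (metis C_k_on.simps(1))

lemma smooth_grad_continuous: "smooth f \<Longrightarrow> continuous_on UNIV (grad f)"
  using smooth_on_frechet_derivative[of UNIV f] unfolding grad_def smooth_iff_smooth_on
  by (intro continuous_intros) (metis C_k_on.simps(1) smooth_on_def)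

lemma smooth_continuous_on: "smooth f \<Longrightarrow> continuous_on S f"
  by (rule continuous_on_subset[OF smooth_continuous subset_UNIV])

lemma smooth_grad_continuous_on: "smooth f \<Longrightarrow> continuous_on S (grad f)"
  by (rule continuous_on_subset[OF smooth_grad_continuous subset_UNIV])

lemma smooth_borel:
  assumes "smooth f"
  shows "f \<in> borel_measurable borel" "grad f \<in> borel_measurable borel"
  by (intro borel_measurable_continuous_onI smooth_continuous smooth_grad_continuous assms)+

lemma smooth_diff: "smooth f \<Longrightarrow> smooth g \<Longrightarrow> smooth (\<lambda>x. f x - g x)"
  by (simp add: smooth_iff_smooth_on smooth_on_diff)

lemma smooth_mult: "smooth f \<Longrightarrow> smooth g \<Longrightarrow> smooth (\<lambda>x. f x * g x)"
  by (simp add: smooth_iff_smooth_on smooth_on_mult)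

lemma grad_diff: "smooth f \<Longrightarrow> smooth g \<Longrightarrow> grad (\<lambda>x. f x - g x) x = grad f x - grad g x"
  by (intro grad_eqI) (auto intro!: derivative_eq_intros smooth_has_derivative simp: inner_diff_left)

lemma grad_mult: "smooth f \<Longrightarrow> smooth g \<Longrightarrow> grad (\<lambda>x. f x * g x) x = f x *\<^sub>R grad g x + g x *\<^sub>R grad f x"
  by (intro grad_eqI) (auto intro!: derivative_eq_intros smooth_has_derivative simp: inner_add_left)

section \<open>Convergence in the square mean\<close>

text \<open>An extended nonnegative value, so that no integrability has to be known beforehand.\<close>

abbreviation L2sq :: "'a measure \<Rightarrow> ('a \<Rightarrow> 'b::real_normed_vector) \<Rightarrow> ennreal" where
  "L2sq M f \<equiv> \<integral>\<^sup>+x. ennreal ((norm (f x))\<^sup>2) \<partial>M"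

lemma norm_add_sq_le:
  fixes a b :: "'b::real_normed_vector"
  shows "(norm (a + b))\<^sup>2 \<le> 2 * (norm a)\<^sup>2 + 2 * (norm b)\<^sup>2"
proof -
  have "(norm (a + b))\<^sup>2 \<le> (norm a + norm b)\<^sup>2"
    by (simp add: norm_triangle_ineq power_mono)
  also have "\<dots> \<le> 2 * (norm a)\<^sup>2 + 2 * (norm b)\<^sup>2"
    using zero_le_power2[of "norm a - norm b"] by (simp add: power2_eq_square algebra_simps)
  finally show ?thesis .
qed

lemma nn_integral_norm_add_sq_le:
  fixes f g :: "'a \<Rightarrow> 'b::{real_normed_vector, second_countable_topology}"
  assumes [measurable]: "f \<in> borel_measurable M" "g \<in> borel_measurable M"
  shows "L2sq M (\<lambda>x. f x + g x)
    \<le> 2 * L2sq M f + 2 * L2sq M g"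
proof -
  have "L2sq M (\<lambda>x. f x + g x)
      \<le> (\<integral>\<^sup>+x. 2 * ennreal ((norm (f x))\<^sup>2) + 2 * ennreal ((norm (g x))\<^sup>2) \<partial>M)"
  proof (rule nn_integral_mono)
    fix x
    have "ennreal ((norm (f x + g x))\<^sup>2) \<le> ennreal (2 * (norm (f x))\<^sup>2 + 2 * (norm (g x))\<^sup>2)"
      by (intro ennreal_leI norm_add_sq_le)
    then show "ennreal ((norm (f x + g x))\<^sup>2) \<le> 2 * ennreal ((norm (f x))\<^sup>2) + 2 * ennreal ((norm (g x))\<^sup>2)"
      by (simp add: ennreal_plus ennreal_mult)
  qed
  then show ?thesis
    by (simp add: nn_integral_add nn_integral_cmult)
qed

lemma ennreal_tendsto_0_le:
  fixes f g :: "nat \<Rightarrow> ennreal"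
  assumes "g \<longlonglongrightarrow> 0" "\<And>n. f n \<le> g n"
  shows "f \<longlonglongrightarrow> 0"
  using assms by (intro tendsto_sandwich[of "\<lambda>_. 0" f sequentially g]) auto

lemma ennreal_tendsto_0_cmult:
  fixes g :: "nat \<Rightarrow> ennreal"
  assumes "g \<longlonglongrightarrow> 0" "c < top"
  shows "(\<lambda>n. c * g n) \<longlonglongrightarrow> 0"
  using ennreal_tendsto_cmult[OF assms(2,1)] by simp

lemma L2_converges_add:
  fixes f f' :: "nat \<Rightarrow> 'a \<Rightarrow> 'b::{real_normed_vector, second_countable_topology}"
  assumes "L2_converges M f g" "L2_converges M f' g'"
  shows "L2_converges M (\<lambda>n x. f n x + f' n x) (\<lambda>x. g x + g' x)"
proof -
  have [measurable]: "f n \<in> borel_measurable M" "f' n \<in> borel_measurable M"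
      "g \<in> borel_measurable M" "g' \<in> borel_measurable M" for n
    using assms by (auto simp: L2_converges_def)
  have "(\<lambda>n. 2 * L2sq M (\<lambda>x. f n x - g x) + 2 * L2sq M (\<lambda>x. f' n x - g' x)) \<longlonglongrightarrow> 0"
    using tendsto_add[OF ennreal_tendsto_0_cmult[where c = 2] ennreal_tendsto_0_cmult[where c = 2]] assms
    by (simp add: L2_converges_def)
  moreover have "L2sq M (\<lambda>x. f n x + f' n x - (g x + g' x))
     \<le> 2 * L2sq M (\<lambda>x. f n x - g x) + 2 * L2sq M (\<lambda>x. f' n x - g' x)" for n
    using nn_integral_norm_add_sq_le[of "\<lambda>x. f n x - g x" M "\<lambda>x. f' n x - g' x"]
    by (simp add: algebra_simps)
  ultimately have "(\<lambda>n. L2sq M (\<lambda>x. f n x + f' n x - (g x + g' x))) \<longlonglongrightarrow> 0"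
    by (rule ennreal_tendsto_0_le)
  then show ?thesis
    by (auto simp: L2_converges_def)
qed

text \<open>The pointwise maps \<open>T x\<close> that occur are products with bounded fields.\<close>

lemma L2_converges_lipschitz:
  fixes f :: "nat \<Rightarrow> 'a \<Rightarrow> 'b::{real_normed_vector, second_countable_topology}"
    and T :: "'a \<Rightarrow> 'b \<Rightarrow> 'c::{real_normed_vector, second_countable_topology}"
  assumes "L2_converges M f g"
    and "\<And>n. (\<lambda>x. T x (f n x)) \<in> borel_measurable M" "(\<lambda>x. T x (g x)) \<in> borel_measurable M"
    and T: "\<And>x a b. x \<in> space M \<Longrightarrow> norm (T x a - T x b) \<le> C * norm (a - b)"
  shows "L2_converges M (\<lambda>n x. T x (f n x)) (\<lambda>x. T x (g x))"
proof -
  have [measurable]: "f n \<in> borel_measurable M" "g \<in> borel_measurable M" for n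
    using assms(1) by (auto simp: L2_converges_def)
  have "L2sq M (\<lambda>x. T x (f n x) - T x (g x))
     \<le> ennreal (C\<^sup>2) * L2sq M (\<lambda>x. f n x - g x)" for n
  proof -
    have "L2sq M (\<lambda>x. T x (f n x) - T x (g x))
      \<le> (\<integral>\<^sup>+x. ennreal (C\<^sup>2) * ennreal ((norm (f n x - g x))\<^sup>2) \<partial>M)"
    proof (rule nn_integral_mono)
      fix x assume "x \<in> space M"
      then have "(norm (T x (f n x) - T x (g x)))\<^sup>2 \<le> (C * norm (f n x - g x))\<^sup>2"
        by (intro power_mono T) auto
      then show "ennreal ((norm (T x (f n x) - T x (g x)))\<^sup>2) \<le> ennreal (C\<^sup>2) * ennreal ((norm (f n x - g x))\<^sup>2)"
        by (simp add: ennreal_mult[symmetric] power_mult_distrib)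
    qed
    then show ?thesis by (simp add: nn_integral_cmult)
  qed
  moreover have "(\<lambda>n. ennreal (C\<^sup>2) * L2sq M (\<lambda>x. f n x - g x)) \<longlonglongrightarrow> 0"
    using assms(1) by (intro ennreal_tendsto_0_cmult) (auto simp: L2_converges_def)
  ultimately have "(\<lambda>n. L2sq M (\<lambda>x. T x (f n x) - T x (g x))) \<longlonglongrightarrow> 0"
    by (rule ennreal_tendsto_0_le[rotated])
  then show ?thesis
    using assms(2,3) by (simp add: L2_converges_def)
qed

lemma L2_converges_const: "g \<in> borel_measurable M \<Longrightarrow> L2_converges M (\<lambda>n. g) g"
  by (simp add: L2_converges_def)

lemma L2_converges_AE:
  assumes "L2_converges M f g" "g' \<in> borel_measurable M" "AE x in M. g x = g' x"
  shows "L2_converges M f g'"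
proof -
  have "L2sq M (\<lambda>x. f n x - g' x) = L2sq M (\<lambda>x. f n x - g x)" for n
    by (rule nn_integral_cong_AE) (use assms(3) in auto)
  then show ?thesis using assms(1,2) by (simp add: L2_converges_def)
qed

lemma square_integrable_iff:
  fixes f :: "'a \<Rightarrow> 'b::{real_normed_vector, second_countable_topology}"
  assumes "f \<in> borel_measurable M"
  shows "integrable M (\<lambda>x. (norm (f x))\<^sup>2) \<longleftrightarrow> L2sq M f < \<infinity>"
  using assms by (subst integrable_iff_bounded) auto

text \<open>The difference of the squared norms is estimated by Young's inequality with a free parameter \<open>\<delta>\<close>: the weight of
\<open>|f - g|\<^sup>2\<close> blows up as \<open>\<delta>\<close> decreases, but that term tends to zero for fixed \<open>\<delta>\<close>.\<close>

lemma L2_converges_norm: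
  fixes f :: "nat \<Rightarrow> 'a \<Rightarrow> 'b::{real_normed_vector, second_countable_topology}"
  assumes L: "L2_converges M f g" and f: "\<And>n. integrable M (\<lambda>x. (norm (f n x))\<^sup>2)"
  shows "integrable M (\<lambda>x. (norm (g x))\<^sup>2)"
    and "(\<lambda>n. \<integral>x. (norm (f n x))\<^sup>2 \<partial>M) \<longlonglongrightarrow> (\<integral>x. (norm (g x))\<^sup>2 \<partial>M)"
proof -
  have [measurable]: "f n \<in> borel_measurable M" "g \<in> borel_measurable M" for n
    using L by (auto simp: L2_converges_def)
  define E where "E n = L2sq M (\<lambda>x. f n x - g x)" for n
  have E0: "E \<longlonglongrightarrow> 0"
    using L unfolding L2_converges_def E_def by auto
  then have "eventually (\<lambda>n. E n < 1) sequentially"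
    by (intro order_tendstoD) auto
  then obtain n0 where n0: "E n < 1" if "n \<ge> n0" for n
    by (auto simp: eventually_sequentially)
  have sqf: "L2sq M (f n) < \<infinity>" for n
    using f[of n] by (simp add: square_integrable_iff)
  have "L2sq M g \<le> 2 * L2sq M (\<lambda>x. g x - f n0 x)
      + 2 * L2sq M (\<lambda>x. f n0 x)"
    using nn_integral_norm_add_sq_le[of "\<lambda>x. g x - f n0 x" M "\<lambda>x. f n0 x"] by simp
  also have "\<dots> < \<infinity>"
    using n0[of n0] sqf[of n0] by (auto simp: E_def norm_minus_commute ennreal_mult_less_top intro: less_trans)
  finally show g: "integrable M (\<lambda>x. (norm (g x))\<^sup>2)"
    by (simp add: square_integrable_iff)
  define e where "e n = (\<integral>x. (norm (f n x - g x))\<^sup>2 \<partial>M)" for n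
  have d: "integrable M (\<lambda>x. (norm (f n x - g x))\<^sup>2)" for n
  proof (rule Bochner_Integration.integrable_bound)
    show "integrable M (\<lambda>x. 2 * (norm (f n x))\<^sup>2 + 2 * (norm (g x))\<^sup>2)"
      using f g by auto
    show "AE x in M. norm ((norm (f n x - g x))\<^sup>2) \<le> norm (2 * (norm (f n x))\<^sup>2 + 2 * (norm (g x))\<^sup>2)"
      using norm_add_sq_le[of "f n _" "- g _"] by (auto intro!: AE_I2)
  qed measurable
  have "E = (\<lambda>n. ennreal (e n))"
    unfolding E_def e_def by (rule ext, rule nn_integral_eq_integral[OF d]) auto
  then have "(\<lambda>n. ennreal (e n)) \<longlonglongrightarrow> ennreal 0"
    using E0 by simp
  then have e0: "e \<longlonglongrightarrow> 0"
    by (subst (asm) tendsto_ennreal_iff) (auto simp: e_def)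
  define G where "G = (\<integral>x. (norm (g x))\<^sup>2 \<partial>M)"
  have G0: "G \<ge> 0" by (simp add: G_def)
  have bound: "\<bar>(\<integral>x. (norm (f n x))\<^sup>2 \<partial>M) - G\<bar> \<le> (1 + 1 / \<delta>) * e n + \<delta> * G" if "\<delta> > 0" for \<delta> n
  proof -
    \<comment> \<open>Young's inequality for the mixed term of \<open>|a|\<^sup>2 - |b|\<^sup>2\<close>.\<close>
    have pw: "\<bar>(norm a)\<^sup>2 - (norm b)\<^sup>2\<bar> \<le> (1 + 1 / \<delta>) * (norm (a - b))\<^sup>2 + \<delta> * (norm b)\<^sup>2" for a b :: 'b
    proof -
      let ?t = "norm (a - b)"
      have t: "\<bar>norm a - norm b\<bar> \<le> ?t" by (simp add: norm_triangle_ineq3)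
      have "(norm a)\<^sup>2 - (norm b)\<^sup>2 = (norm a - norm b) * (norm a - norm b + 2 * norm b)"
        by (simp add: power2_eq_square algebra_simps)
      then have "\<bar>(norm a)\<^sup>2 - (norm b)\<^sup>2\<bar> = \<bar>norm a - norm b\<bar> * \<bar>norm a - norm b + 2 * norm b\<bar>"
        by (simp only: abs_mult)
      also have "\<dots> \<le> ?t * (?t + 2 * norm b)"
        using t by (intro mult_mono) auto
      also have "\<dots> = ?t\<^sup>2 + 2 * ?t * norm b"
        by (simp add: power2_eq_square algebra_simps)
      also have "2 * ?t * norm b \<le> ?t\<^sup>2 / \<delta> + \<delta> * (norm b)\<^sup>2"
      proof -
        have "0 \<le> (?t - \<delta> * norm b)\<^sup>2 / \<delta>" using that by simp
        also have "\<dots> = ?t\<^sup>2 / \<delta> + \<delta> * (norm b)\<^sup>2 - 2 * ?t * norm b"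
          using that by (simp add: power2_eq_square field_simps)
        finally show ?thesis by simp
      qed
      finally show ?thesis by (simp add: algebra_simps)
    qed
    have "\<bar>(\<integral>x. (norm (f n x))\<^sup>2 \<partial>M) - G\<bar> = \<bar>\<integral>x. (norm (f n x))\<^sup>2 - (norm (g x))\<^sup>2 \<partial>M\<bar>"
      unfolding G_def using f g by simp
    also have "\<dots> \<le> (\<integral>x. \<bar>(norm (f n x))\<^sup>2 - (norm (g x))\<^sup>2\<bar> \<partial>M)"
      by (rule integral_abs_bound)
    also have "\<dots> \<le> (\<integral>x. (1 + 1 / \<delta>) * (norm (f n x - g x))\<^sup>2 + \<delta> * (norm (g x))\<^sup>2 \<partial>M)"
      using f g d pw by (intro integral_mono) auto
    also have "\<dots> = (1 + 1 / \<delta>) * e n + \<delta> * G"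
      unfolding e_def G_def using f g d by simp
    finally show ?thesis .
  qed
  show "(\<lambda>n. \<integral>x. (norm (f n x))\<^sup>2 \<partial>M) \<longlonglongrightarrow> (\<integral>x. (norm (g x))\<^sup>2 \<partial>M)"
    unfolding G_def[symmetric]
  proof (rule LIMSEQ_I)
    fix r :: real assume r: "r > 0"
    \<comment> \<open>This choice gives \<open>\<delta> G \<le> r / 2\<close>, also when \<open>G = 0\<close>.\<close>
    define \<delta> where "\<delta> = r / (2 * (G + 1))"
    have \<delta>: "\<delta> > 0" and \<delta>G: "\<delta> * G \<le> r / 2"
      using r G0 by (auto simp: \<delta>_def field_simps)
    have "(\<lambda>n. (1 + 1 / \<delta>) * e n) \<longlonglongrightarrow> 0"
      using tendsto_mult_right_zero[OF e0] by auto
    then have "eventually (\<lambda>n. (1 + 1 / \<delta>) * e n < r / 2) sequentially"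
      using r by (intro order_tendstoD) auto
    then obtain m where m: "(1 + 1 / \<delta>) * e n < r / 2" if "n \<ge> m" for n
      by (auto simp: eventually_sequentially)
    show "\<exists>m. \<forall>n\<ge>m. norm ((\<integral>x. (norm (f n x))\<^sup>2 \<partial>M) - G) < r"
    proof (intro exI allI impI)
      fix n assume "n \<ge> m"
      from bound[OF \<delta>, of n] m[OF this] \<delta>G
      show "norm ((\<integral>x. (norm (f n x))\<^sup>2 \<partial>M) - G) < r"
        unfolding real_norm_def by linarith
    qed
  qed
qed

lemma square_integrable_inner:
  fixes f g :: "'a \<Rightarrow> 'b::{real_inner, second_countable_topology}"
  assumes [measurable]: "f \<in> borel_measurable M" "g \<in> borel_measurable M"
    and f: "integrable M (\<lambda>x. (norm (f x))\<^sup>2)" and g: "integrable M (\<lambda>x. (norm (g x))\<^sup>2)"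
  shows "integrable M (\<lambda>x. f x \<bullet> g x)"
proof (rule Bochner_Integration.integrable_bound)
  show "integrable M (\<lambda>x. (norm (f x))\<^sup>2 + (norm (g x))\<^sup>2)"
    using f g by auto
  have "\<bar>a \<bullet> b\<bar> \<le> (norm a)\<^sup>2 + (norm b)\<^sup>2" for a b :: 'b
    using Cauchy_Schwarz_ineq2[of a b] zero_le_power2[of "norm a - norm b"]
      mult_nonneg_nonneg[OF norm_ge_zero norm_ge_zero, of a b]
    unfolding power2_diff by linarith
  then show "AE x in M. norm (f x \<bullet> g x) \<le> norm ((norm (f x))\<^sup>2 + (norm (g x))\<^sup>2)"
    by (auto intro!: AE_I2)
qed measurable

lemma square_integrable_add:
  fixes f g :: "'a \<Rightarrow> 'b::{real_normed_vector, second_countable_topology}"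
  assumes [measurable]: "f \<in> borel_measurable M" "g \<in> borel_measurable M"
    and f: "integrable M (\<lambda>x. (norm (f x))\<^sup>2)" and g: "integrable M (\<lambda>x. (norm (g x))\<^sup>2)"
  shows "integrable M (\<lambda>x. (norm (f x + g x))\<^sup>2)"
proof (rule Bochner_Integration.integrable_bound)
  show "integrable M (\<lambda>x. 2 * (norm (f x))\<^sup>2 + 2 * (norm (g x))\<^sup>2)"
    using f g by auto
  show "AE x in M. norm ((norm (f x + g x))\<^sup>2) \<le> norm (2 * (norm (f x))\<^sup>2 + 2 * (norm (g x))\<^sup>2)"
    using norm_add_sq_le[of "f _" "g _"] by (auto intro!: AE_I2)
qed measurable

text \<open>By polarisation, from the convergence of norms.\<close>

lemma L2_converges_inner:
  fixes f f' :: "nat \<Rightarrow> 'a \<Rightarrow> 'b::{real_inner, second_countable_topology}"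
  assumes L: "L2_converges M f g" "L2_converges M f' g'"
    and f: "\<And>n. integrable M (\<lambda>x. (norm (f n x))\<^sup>2)" and f': "\<And>n. integrable M (\<lambda>x. (norm (f' n x))\<^sup>2)"
  shows "(\<lambda>n. \<integral>x. f n x \<bullet> f' n x \<partial>M) \<longlonglongrightarrow> (\<integral>x. g x \<bullet> g' x \<partial>M)"
proof -
  have [measurable]: "f n \<in> borel_measurable M" "f' n \<in> borel_measurable M"
      "g \<in> borel_measurable M" "g' \<in> borel_measurable M" for n
    using L by (auto simp: L2_converges_def)
  note g = L2_converges_norm[OF L(1) f] and g' = L2_converges_norm[OF L(2) f']
  have polar: "(\<integral>x. (norm (p x + q x))\<^sup>2 \<partial>M) = (\<integral>x. (norm (p x))\<^sup>2 \<partial>M) + 2 * (\<integral>x. p x \<bullet> q x \<partial>M) + (\<integral>x. (norm (q x))\<^sup>2 \<partial>M)"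
    if [measurable]: "p \<in> borel_measurable M" "q \<in> borel_measurable M"
      and "integrable M (\<lambda>x. (norm (p x))\<^sup>2)" "integrable M (\<lambda>x. (norm (q x))\<^sup>2)" for p q :: "'a \<Rightarrow> 'b"
  proof -
    have "(norm (p x + q x))\<^sup>2 = (norm (p x))\<^sup>2 + 2 * (p x \<bullet> q x) + (norm (q x))\<^sup>2" for x
      by (simp add: power2_norm_eq_inner inner_add inner_commute)
    then show ?thesis
      using that square_integrable_inner[OF that] by simp
  qed
  have "(\<lambda>n. \<integral>x. (norm (f n x + f' n x))\<^sup>2 \<partial>M) \<longlonglongrightarrow> (\<integral>x. (norm (g x + g' x))\<^sup>2 \<partial>M)"
    by (rule L2_converges_norm(2)[OF L2_converges_add[OF L]], rule square_integrable_add) (use f f' in auto)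
  then have "(\<lambda>n. ((\<integral>x. (norm (f n x))\<^sup>2 \<partial>M) + 2 * (\<integral>x. f n x \<bullet> f' n x \<partial>M) + (\<integral>x. (norm (f' n x))\<^sup>2 \<partial>M)))
    \<longlonglongrightarrow> ((\<integral>x. (norm (g x))\<^sup>2 \<partial>M) + 2 * (\<integral>x. g x \<bullet> g' x \<partial>M) + (\<integral>x. (norm (g' x))\<^sup>2 \<partial>M))"
    by (simp only: polar f f' g(1) g'(1) \<open>\<And>n. f n \<in> borel_measurable M\<close> \<open>\<And>n. f' n \<in> borel_measurable M\<close>
        \<open>g \<in> borel_measurable M\<close> \<open>g' \<in> borel_measurable M\<close>)
  from tendsto_diff[OF tendsto_diff[OF this g(2)] g'(2)]
  show ?thesis using tendsto_mult_left[of "\<lambda>n. 2 * (\<integral>x. f n x \<bullet> f' n x \<partial>M)" _ _ "1/2"] by simp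
qed

lemma L2_converges_restrict:
  assumes "L2_converges (lebesgue_on A) f g" "B \<subseteq> A" "A \<in> sets lebesgue" "B \<in> sets lebesgue"
  shows "L2_converges (lebesgue_on B) f g"
proof -
  have m: "h \<in> borel_measurable (lebesgue_on A) \<Longrightarrow> h \<in> borel_measurable (lebesgue_on B)" for h :: "_ \<Rightarrow> 'b::{real_normed_vector, second_countable_topology}"
    using measurable_restrict_mono[OF _ assms(2)] by blast
  have "L2sq (lebesgue_on B) (\<lambda>x. f n x - g x) \<le> L2sq (lebesgue_on A) (\<lambda>x. f n x - g x)" for n
    using assms(2-4) by (auto simp: nn_integral_restrict_space split: split_indicator intro!: nn_integral_mono)
  moreover have "(\<lambda>n. L2sq (lebesgue_on A) (\<lambda>x. f n x - g x)) \<longlonglongrightarrow> 0"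
    using assms(1) by (simp only: L2_converges_def)
  ultimately have "(\<lambda>n. L2sq (lebesgue_on B) (\<lambda>x. f n x - g x)) \<longlonglongrightarrow> 0"
    by (rule ennreal_tendsto_0_le[rotated])
  then show ?thesis
    using assms(1) m by (simp only: L2_converges_def simp_thms)
qed

text \<open>Riesz and Fischer. A subsequence is chosen along which the squared distances \<open>d\<close> of neighbours are summable with
weights \<open>2^k\<close>. Integrating the weighted sum shows that it is finite almost everywhere, and then
\<open>2 d \<le> 2^k d\<^sup>2 + 2^(-k)\<close> makes the distances themselves summable, without an appeal to Minkowski's
inequality. Fatou's lemma identifies the pointwise limit as the limit in the square mean.\<close>

lemma L2_complete:
  fixes f :: "nat \<Rightarrow> 'a \<Rightarrow> 'b::{banach, second_countable_topology}"
  assumes [measurable]: "\<And>n. f n \<in> borel_measurable M"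
    and Cauchy: "\<And>e::real. e > 0 \<Longrightarrow> \<exists>N. \<forall>m\<ge>N. \<forall>n\<ge>N. L2sq M (\<lambda>x. f m x - f n x) \<le> ennreal e"
  shows "\<exists>g. L2_converges M f g"
proof -
  have "\<exists>N. \<forall>m\<ge>N. \<forall>n\<ge>N. L2sq M (\<lambda>x. f m x - f n x) \<le> ennreal ((1/4)^k)" for k :: nat
    by (rule Cauchy) simp
  then obtain N where N: "\<And>k m n. m \<ge> N k \<Longrightarrow> n \<ge> N k \<Longrightarrow> L2sq M (\<lambda>x. f m x - f n x) \<le> ennreal ((1/4)^k)"
    by metis
  \<comment> \<open>The maximum serves all earlier thresholds at once, so that \<open>r k\<close> may be compared with any fixed index.\<close>
  define r where "r k = Max (N ` {..k})" for k
  have r: "N j \<le> r k" if "j \<le> k" for j k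
    unfolding r_def using that by (intro Max_ge) auto
  define d where "d k x = norm (f (r (Suc k)) x - f (r k) x)" for k x
  have [measurable]: "d k \<in> borel_measurable M" for k
    unfolding d_def by measurable
  have "(\<integral>\<^sup>+x. (\<Sum>k. ennreal (2^k * (d k x)\<^sup>2)) \<partial>M) = (\<Sum>k. \<integral>\<^sup>+x. ennreal (2^k * (d k x)\<^sup>2) \<partial>M)"
    by (rule nn_integral_suminf) measurable
  also have "\<dots> \<le> (\<Sum>k. ennreal ((1/2)^k))"
  proof (rule suminf_le)
    fix k
    have "(\<integral>\<^sup>+x. ennreal (2^k * (d k x)\<^sup>2) \<partial>M) = ennreal (2^k) * (\<integral>\<^sup>+x. ennreal ((d k x)\<^sup>2) \<partial>M)"
      by (simp add: ennreal_mult nn_integral_cmult)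
    also have "\<dots> \<le> ennreal (2^k) * ennreal ((1/4)^k)"
      unfolding d_def by (intro mult_left_mono N r) auto
    also have "\<dots> = ennreal ((1/2)^k)"
      by (simp add: ennreal_mult[symmetric] flip: power_mult_distrib)
    finally show "(\<integral>\<^sup>+x. ennreal (2^k * (d k x)\<^sup>2) \<partial>M) \<le> ennreal ((1/2)^k)" .
  qed auto
  also have "\<dots> = ennreal (\<Sum>k. (1/2)^k)"
    by (rule suminf_ennreal2) (auto simp: summable_geometric)
  finally have "(\<integral>\<^sup>+x. (\<Sum>k. ennreal (2^k * (d k x)\<^sup>2)) \<partial>M) \<noteq> \<infinity>"
    by (auto simp: top_unique)
  then have "AE x in M. (\<Sum>k. ennreal (2^k * (d k x)\<^sup>2)) \<noteq> \<infinity>"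
    by (intro nn_integral_noteq_infinite) auto
  then have conv: "AE x in M. convergent (\<lambda>k. f (r k) x)"
  proof eventually_elim
    fix x assume "(\<Sum>k. ennreal (2^k * (d k x)\<^sup>2)) \<noteq> \<infinity>"
    then have "summable (\<lambda>k. 2^k * (d k x)\<^sup>2)"
      by (intro summable_suminf_not_top) auto
    then have s: "summable (\<lambda>k. 2^k * (d k x)\<^sup>2 + (1/2)^k)"
      by (intro summable_add) (auto simp: summable_geometric)
    have "summable (\<lambda>k. d k x)"
    proof (rule summable_comparison_test'[OF s])
      fix k :: nat
      have "0 \<le> 2^k * (d k x - (1/2)^k)\<^sup>2" by simp
      also have "\<dots> = 2^k * (d k x)\<^sup>2 + (1/2)^k * (2^k * (1/2)^k) - 2 * d k x * (2^k * (1/2)^k)"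
        by (simp add: power2_diff algebra_simps power2_eq_square)
      also have "2^k * (1/2)^k = (1::real)" by (simp flip: power_mult_distrib)
      finally have "2 * d k x \<le> 2^k * (d k x)\<^sup>2 + (1/2)^k" by simp
      moreover have "0 \<le> d k x" by (simp add: d_def)
      ultimately show "norm (d k x) \<le> 2^k * (d k x)\<^sup>2 + (1/2)^k" by simp
    qed
    then have "summable (\<lambda>k. f (r (Suc k)) x - f (r k) x)"
      unfolding d_def by (rule summable_norm_cancel)
    then have "convergent (\<lambda>n. f (r n) x - f (r 0) x)"
      by (simp add: summable_iff_convergent sum_lessThan_telescope[of "\<lambda>k. f (r k) x"])
    then show "convergent (\<lambda>k. f (r k) x)"
      using convergent_add[OF _ convergent_const[of "f (r 0) x"]] by fastforce
  qed
  define g where "g x = lim (\<lambda>k. f (r k) x)" for x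
  have [measurable]: "g \<in> borel_measurable M"
    unfolding g_def by measurable
  have le: "L2sq M (\<lambda>x. f n x - g x) \<le> ennreal ((1/4)^j)" if n: "n \<ge> N j" for n j
  proof -
    have "L2sq M (\<lambda>x. f n x - g x) = (\<integral>\<^sup>+x. liminf (\<lambda>k. ennreal ((norm (f n x - f (r k) x))\<^sup>2)) \<partial>M)"
      using conv
    proof (intro nn_integral_cong_AE, eventually_elim)
      fix x assume "convergent (\<lambda>k. f (r k) x)"
      then have "(\<lambda>k. f (r k) x) \<longlonglongrightarrow> g x"
        by (simp add: g_def convergent_LIMSEQ_iff)
      then have "(\<lambda>k. ennreal ((norm (f n x - f (r k) x))\<^sup>2)) \<longlonglongrightarrow> ennreal ((norm (f n x - g x))\<^sup>2)"
        by (intro tendsto_intros) auto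
      from lim_imp_Liminf[OF trivial_limit_sequentially this]
      show "ennreal ((norm (f n x - g x))\<^sup>2) = liminf (\<lambda>k. ennreal ((norm (f n x - f (r k) x))\<^sup>2))"
        by (rule sym)
    qed
    also have "\<dots> \<le> liminf (\<lambda>k. L2sq M (\<lambda>x. f n x - f (r k) x))"
      by (rule nn_integral_liminf) measurable
    also have "\<dots> \<le> ennreal ((1/4)^j)"
    proof -
      have "eventually (\<lambda>k. L2sq M (\<lambda>x. f n x - f (r k) x) \<le> ennreal ((1/4)^j)) sequentially"
        using eventually_ge_at_top[of j] by eventually_elim (intro N n r)
      from Liminf_mono[OF this] show ?thesis by (simp add: Liminf_const)
    qed
    finally show ?thesis .
  qed
  have "(\<lambda>n. L2sq M (\<lambda>x. f n x - g x)) \<longlonglongrightarrow> 0"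
  proof (rule order_tendstoI)
    fix a :: ennreal assume a: "0 < a"
    have "(\<lambda>j. ennreal ((1/4)^j)) \<longlonglongrightarrow> ennreal 0"
      by (intro tendsto_ennrealI LIMSEQ_power_zero) auto
    then have "eventually (\<lambda>j. ennreal ((1/4)^j) < a) sequentially"
      using a by (intro order_tendstoD) auto
    then obtain j where "ennreal ((1/4)^j) < a"
      by (auto simp: eventually_sequentially)
    then show "eventually (\<lambda>n. L2sq M (\<lambda>x. f n x - g x) < a) sequentially"
      using le by (auto simp: eventually_sequentially intro!: exI[of _ "N j"] intro: le_less_trans)
  qed auto
  then show ?thesis
    by (auto simp: L2_converges_def intro!: exI[of _ g])
qed

lemma borel_measurable_lebesgue_on:
  "f \<in> borel_measurable borel \<Longrightarrow> f \<in> borel_measurable (lebesgue_on S)"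
  by (intro measurable_restrict_space1 measurable_completion) simp

lemma L2_converges_Cauchy:
  fixes f :: "nat \<Rightarrow> 'a \<Rightarrow> 'b::{real_normed_vector, second_countable_topology}" and e :: real
  assumes "L2_converges M f g" "e > 0"
  shows "\<exists>N. \<forall>m\<ge>N. \<forall>n\<ge>N. L2sq M (\<lambda>x. f m x - f n x) \<le> ennreal e"
proof -
  have [measurable]: "f n \<in> borel_measurable M" "g \<in> borel_measurable M" for n
    using assms by (auto simp: L2_converges_def)
  have "eventually (\<lambda>n. L2sq M (\<lambda>x. f n x - g x) < ennreal (e / 4)) sequentially"
    using assms by (intro order_tendstoD(2)) (auto simp: L2_converges_def)
  then have "\<exists>N. \<forall>n\<ge>N. L2sq M (\<lambda>x. f n x - g x) \<le> ennreal (e / 4)"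
    by (auto simp: eventually_sequentially intro: less_imp_le)
  then obtain N where N: "L2sq M (\<lambda>x. f n x - g x) \<le> ennreal (e / 4)" if "n \<ge> N" for n
    by blast
  show ?thesis
  proof (intro exI allI impI)
    fix m n assume mn: "m \<ge> N" "n \<ge> N"
    have "L2sq M (\<lambda>x. f m x - f n x)
      \<le> 2 * L2sq M (\<lambda>x. f m x - g x) + 2 * L2sq M (\<lambda>x. g x - f n x)"
      using nn_integral_norm_add_sq_le[of "\<lambda>x. f m x - g x" M "\<lambda>x. g x - f n x"] by simp
    also have "\<dots> \<le> 2 * ennreal (e / 4) + 2 * ennreal (e / 4)"
      using N[OF mn(1)] N[OF mn(2)] by (intro add_mono mult_left_mono) (auto simp: norm_minus_commute)
    also have "2 * ennreal (e / 4) = ennreal (2 * (e / 4))"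
      by (subst ennreal_mult) (use assms(2) in auto)
    also have "ennreal (2 * (e / 4)) + ennreal (2 * (e / 4)) = ennreal (2 * (e / 4) + 2 * (e / 4))"
      by (rule ennreal_plus[symmetric]) (use assms(2) in auto)
    finally show "L2sq M (\<lambda>x. f m x - f n x) \<le> ennreal e"
      by simp
  qed
qed

section \<open>Polar coordinates and inversion\<close>

lemma nn_integral_lborel_scale:
  fixes f :: "'a::euclidean_space \<Rightarrow> ennreal"
  assumes [measurable]: "f \<in> borel_measurable borel" and "c \<noteq> 0"
  shows "(\<integral>\<^sup>+x. f x \<partial>lborel) = ennreal (\<bar>c\<bar> ^ DIM('a)) * (\<integral>\<^sup>+x. f (c *\<^sub>R x) \<partial>lborel)"
  by (subst lborel_affine[OF assms(2), of 0])
     (simp add: nn_integral_density nn_integral_distr nn_integral_cmult)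

lemma nn_integral_power_tail:
  fixes a :: real
  assumes "a > 0" "n > 0"
  shows "(\<integral>\<^sup>+s. ennreal (real n * inverse (s ^ (n + 1))) * indicator {a..} s \<partial>lborel) = ennreal (inverse (a ^ n))"
proof -
  have "(\<integral>\<^sup>+s. ennreal (real n * inverse (s ^ (n + 1))) * indicator {a..} s \<partial>lborel) = ennreal (0 - (- inverse (a ^ n)))"
  proof (rule nn_integral_FTC_atLeast)
    fix s assume "a \<le> s"
    then have s: "s > 0" using assms by simp
    have "((\<lambda>s. - inverse (s ^ n)) has_real_derivative (real n * s ^ (n - 1)) * inverse ((s ^ n)^2)) (at s)"
      using s by (auto intro!: derivative_eq_intros simp: power2_eq_square)
    moreover have "(real n * s ^ (n - 1)) * inverse ((s ^ n)^2) = real n * inverse (s ^ (n + 1))"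
      using s assms(2) by (cases n) (auto simp: power2_eq_square field_simps)
    ultimately show "((\<lambda>s. - inverse (s ^ n)) has_real_derivative real n * inverse (s ^ (n + 1))) (at s)"
      by (simp only:)
    show "0 \<le> real n * inverse (s ^ (n + 1))" using s by simp
  next
    have "((\<lambda>s::real. - (inverse s ^ n)) \<longlongrightarrow> - (0 ^ n)) at_top"
      by (intro tendsto_intros tendsto_inverse_0_at_top filterlim_ident)
    then show "((\<lambda>s::real. - inverse (s ^ n)) \<longlongrightarrow> 0) at_top"
      using assms by (simp add: power_inverse zero_power)
  qed measurable
  then show ?thesis by simp
qed

text \<open>Every point \<open>x\<close> of the unit ball is used as a label for the direction \<open>x / |x|\<close>, so that \<open>N\<close> times
  Lebesgue measure on the ball plays the role of surface measure on the unit sphere. Writing the radius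
  as \<open>s |x|\<close> and exchanging the order of integration reduces the formula to the scaling behaviour
  of Lebesgue measure.\<close>

lemma nn_integral_polar:
  fixes f :: "'a::euclidean_space \<Rightarrow> ennreal"
  assumes [measurable]: "f \<in> borel_measurable borel"
  shows "(\<integral>\<^sup>+y. f y \<partial>lborel) =
    (\<integral>\<^sup>+x. (\<integral>\<^sup>+r. ennreal (real DIM('a) * r ^ (DIM('a) - 1)) * indicator {0<..} r * f (r *\<^sub>R sgn x) \<partial>lborel)
       * indicator (ball 0 1) x \<partial>lborel)"
proof -
  let ?N = "DIM('a)"
  let ?g = "\<lambda>(x::'a) r. ennreal (real ?N * r ^ (?N - 1)) * indicator {0<..} r * f (r *\<^sub>R sgn x)"
  let ?h = "\<lambda>(x::'a) s. ennreal (real ?N * norm x ^ ?N * s ^ (?N - 1)) * indicator {0<..} s * f (s *\<^sub>R x)"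
  let ?k = "\<lambda>(y::'a) s. ennreal (norm y ^ ?N) * f y * (ennreal (real ?N * inverse (s ^ (?N + 1))) * indicator {norm y<..} s)"
  have N: "?N > 0" by simp
  have [measurable]: "(\<lambda>x::'a. sgn x) \<in> borel_measurable borel"
    unfolding sgn_div_norm by measurable
  have [measurable]: "ball (0::'a) 1 \<in> sets borel" by simp
  have AE0: "AE x::'a in lborel. x \<noteq> 0"
    using AE_lborel_singleton[of "0::'a"] by simp
  have "(\<integral>\<^sup>+x. (\<integral>\<^sup>+r. ?g x r \<partial>lborel)
       * indicator (ball 0 1) x \<partial>lborel)
    = (\<integral>\<^sup>+x. (\<integral>\<^sup>+s. ?h x s
       * indicator (ball 0 1) x \<partial>lborel) \<partial>(lborel :: 'a measure))"
    using AE0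
  proof (intro nn_integral_cong_AE, eventually_elim)
    fix x :: 'a assume x: "x \<noteq> 0"
    have "(\<integral>\<^sup>+r. ?g x r \<partial>lborel)
      = ennreal \<bar>norm x\<bar> * (\<integral>\<^sup>+s. ennreal (real ?N * (0 + norm x * s) ^ (?N - 1)) * indicator {0<..} (0 + norm x * s)
          * f ((0 + norm x * s) *\<^sub>R sgn x) \<partial>lborel)"
      using x by (intro nn_integral_real_affine) auto
    also have "\<dots> = (\<integral>\<^sup>+s. ?h x s \<partial>lborel)"
    proof (subst nn_integral_cmult[symmetric], measurable, rule nn_integral_cong)
      fix s :: real
      have "(norm x * s) *\<^sub>R sgn x = s *\<^sub>R x"
        using x by (simp add: sgn_div_norm)
      moreover have e2: "norm x * real ?N * (norm x * s) ^ (?N - Suc 0) = real ?N * norm x ^ ?N * s ^ (?N - Suc 0)"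
        using power_Suc[of "norm x" "?N - 1"] N by (simp add: power_mult_distrib)
      ultimately show "ennreal \<bar>norm x\<bar> * (ennreal (real ?N * (0 + norm x * s) ^ (?N - 1)) * indicator {0<..} (0 + norm x * s)
          * f ((0 + norm x * s) *\<^sub>R sgn x)) = ?h x s"
        using x by (auto simp: indicator_def ennreal_mult[symmetric] zero_less_mult_iff mult.assoc[symmetric] e2)
    qed
    finally show "(\<integral>\<^sup>+r. ?g x r \<partial>lborel) * indicator (ball 0 1) x
      = (\<integral>\<^sup>+s. ?h x s * indicator (ball 0 1) x \<partial>lborel)"
      by (subst nn_integral_multc) auto
  qed
  also have "\<dots> = (\<integral>\<^sup>+s. (\<integral>\<^sup>+x. ?h x s
       * indicator (ball 0 1) x \<partial>(lborel :: 'a measure)) \<partial>lborel)"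
    by (rule lborel_pair.Fubini') measurable
  also have "\<dots> = (\<integral>\<^sup>+s. (\<integral>\<^sup>+y. ?k y s \<partial>(lborel :: 'a measure)) \<partial>lborel)"
  proof (rule nn_integral_cong)
    fix s :: real
    show "(\<integral>\<^sup>+x. ?h x s
       * indicator (ball 0 1) x \<partial>(lborel :: 'a measure)) =
       (\<integral>\<^sup>+y. ?k y s \<partial>lborel)"
    proof (cases "s > 0")
      case s: True
      have "(\<integral>\<^sup>+x. ?h x s
          * indicator (ball 0 1) x \<partial>(lborel :: 'a measure))
        = ennreal (\<bar>inverse s\<bar> ^ ?N) * (\<integral>\<^sup>+y. ennreal (real ?N * norm (inverse s *\<^sub>R y) ^ ?N * s ^ (?N - 1)) * indicator {0<..} s
           * f (s *\<^sub>R (inverse s *\<^sub>R y)) * indicator (ball 0 1) (inverse s *\<^sub>R y) \<partial>(lborel :: 'a measure))"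
        using s by (intro nn_integral_lborel_scale) auto
      also have "\<dots> = (\<integral>\<^sup>+y. ?k y s \<partial>lborel)"
      proof (subst nn_integral_cmult[symmetric], measurable, rule nn_integral_cong)
        fix y :: 'a
        have 1: "inverse s ^ ?N * (real ?N * norm (inverse s *\<^sub>R y) ^ ?N * s ^ (?N - 1)) = norm y ^ ?N * (real ?N * inverse (s ^ (?N + 1)))"
          using s power_Suc[of s "?N - 1"] by (simp add: power_mult_distrib field_simps)
        have 2: "indicator (ball 0 1) (inverse s *\<^sub>R y) = (indicator {norm y<..} s :: ennreal)"
          using s by (auto simp: indicator_def field_simps)
        show "ennreal (\<bar>inverse s\<bar> ^ ?N) * (ennreal (real ?N * norm (inverse s *\<^sub>R y) ^ ?N * s ^ (?N - 1)) * indicator {0<..} s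
           * f (s *\<^sub>R (inverse s *\<^sub>R y)) * indicator (ball 0 1) (inverse s *\<^sub>R y)) =
           ?k y s"
        proof -
          have "ennreal (\<bar>inverse s\<bar> ^ ?N) * (ennreal (real ?N * norm (inverse s *\<^sub>R y) ^ ?N * s ^ (?N - 1)) * 1 * F * I)
            = ennreal (inverse s ^ ?N * (real ?N * norm (inverse s *\<^sub>R y) ^ ?N * s ^ (?N - 1))) * F * I" for F I
            using s by (simp add: ennreal_mult mult_ac)
          moreover have "ennreal (norm y ^ ?N) * F * (ennreal (real ?N * inverse (s ^ (?N + 1))) * I)
            = ennreal (norm y ^ ?N * (real ?N * inverse (s ^ (?N + 1)))) * F * I" for F I
            using s by (simp add: ennreal_mult mult_ac)
          ultimately show ?thesis
            unfolding 2 1[symmetric] using s by simp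
        qed
      qed
      finally show ?thesis .
    next
      case False
      then have "indicator {norm y<..} s = (0::ennreal)" for y :: 'a
        using le_less_trans[OF norm_ge_zero, of y s] by (auto simp: indicator_def)
      with False show ?thesis by simp
    qed
  qed
  also have "\<dots> = (\<integral>\<^sup>+y. (\<integral>\<^sup>+s. ?k y s \<partial>lborel) \<partial>lborel)"
    by (rule lborel_pair.Fubini'[symmetric], measurable) (simp only: greaterThan_iff, measurable)
  also have "\<dots> = (\<integral>\<^sup>+y. f y \<partial>lborel)"
    using AE0
  proof (intro nn_integral_cong_AE, eventually_elim)
    fix y :: 'a assume y: "y \<noteq> 0"
    have "(\<integral>\<^sup>+s. ennreal (real ?N * inverse (s ^ (?N + 1))) * indicator {norm y<..} s \<partial>lborel)
      = (\<integral>\<^sup>+s. ennreal (real ?N * inverse (s ^ (?N + 1))) * indicator {norm y..} s \<partial>lborel)"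
      using AE_lborel_singleton[of "norm y"]
      by (intro nn_integral_cong_AE) (auto simp: indicator_def elim!: eventually_mono)
    also have "\<dots> = ennreal (inverse (norm y ^ ?N))"
      using y by (intro nn_integral_power_tail) auto
    finally have "(\<integral>\<^sup>+s. ?k y s \<partial>lborel)
      = ennreal (norm y ^ ?N) * f y * ennreal (inverse (norm y ^ ?N))"
      by (subst nn_integral_cmult) auto
    also have "\<dots> = ennreal (norm y ^ ?N * inverse (norm y ^ ?N)) * f y"
      by (simp add: ennreal_mult mult_ac)
    also have "\<dots> = f y" using y by simp
    finally show "(\<integral>\<^sup>+s. ?k y s \<partial>lborel) = f y" .
  qed
  finally show ?thesis by simp
qed

lemma nn_integral_inverse_interval:
  fixes h :: "real \<Rightarrow> ennreal"
  assumes [measurable]: "h \<in> borel_measurable borel" and ab: "0 < a" "a < b"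
  shows "(\<integral>\<^sup>+r. h r * indicator {inverse b..inverse a} r \<partial>lborel) = (\<integral>\<^sup>+t. h (inverse t) * ennreal (inverse (t\<^sup>2)) * indicator {a..b} t \<partial>lborel)"
proof -
  have "(\<integral>\<^sup>+r. h r * indicator {inverse b..inverse a} r \<partial>lborel)
     = (\<integral>\<^sup>+r. h (- r) * indicator {- inverse a..- inverse b} r \<partial>lborel)"
    by (subst nn_integral_real_affine[where c = "-1" and t = 0])
       (auto intro!: nn_integral_cong simp: indicator_def)
  also have "\<dots> = (\<integral>\<^sup>+t. h (- (- inverse t)) * ennreal (inverse (t\<^sup>2)) * indicator {a..b} t \<partial>lborel)"
    using ab
    by (intro nn_integral_substitution_aux[where f = "\<lambda>r. h (- r)" and g = "\<lambda>t. - inverse t"])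
       (auto intro!: derivative_eq_intros continuous_intros simp: power2_eq_square)
  finally show ?thesis by simp
qed

text \<open>The substitution rule holds on compact intervals away from zero, and these are exhausted symmetrically under
\<open>r \<mapsto> 1/r\<close>.\<close>

lemma nn_integral_inverse:
  fixes h :: "real \<Rightarrow> ennreal"
  assumes [measurable]: "h \<in> borel_measurable borel"
  shows "(\<integral>\<^sup>+r. h r * indicator {0<..} r \<partial>lborel) = (\<integral>\<^sup>+t. h (inverse t) * ennreal (inverse (t\<^sup>2)) * indicator {0<..} t \<partial>lborel)"
proof -
  define a where "a n = inverse (real (n + 2))" for n
  have a: "0 < a n" "a n < inverse (a n)" for n
  proof -
    have "inverse (real (n + 2)) < 1" "1 < real (n + 2)" by (auto simp: field_simps)
    then show "0 < a n" "a n < inverse (a n)" by (auto simp: a_def)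
  qed
  have inc: "a n \<le> a m" if "m \<le> n" for m n
    using that by (auto simp: a_def)
  have ex: "\<exists>m. \<forall>n\<ge>m. r \<in> {a n..inverse (a n)}" if "r > 0" for r
  proof -
    obtain m where m: "max r (inverse r) < real m" using reals_Archimedean2 by blast
    have "r \<in> {a n..inverse (a n)}" if "n \<ge> m" for n
    proof -
      have "inverse r \<le> real (n + 2)" "r \<le> real (n + 2)" using m that by auto
      then show ?thesis using \<open>r > 0\<close> le_imp_inverse_le[of "inverse r" "real (n + 2)"] by (auto simp: a_def)
    qed
    then show ?thesis by blast
  qed
  have lim: "(\<lambda>n. \<integral>\<^sup>+r. k r * indicator {a n..inverse (a n)} r \<partial>lborel) \<longlonglongrightarrow> (\<integral>\<^sup>+r. k r * indicator {0<..} r \<partial>lborel)"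
    if [measurable]: "k \<in> borel_measurable borel" for k :: "real \<Rightarrow> ennreal"
  proof (rule nn_integral_LIMSEQ)
    show "incseq (\<lambda>n r. k r * indicator {a n..inverse (a n)} r)"
    proof (intro monoI le_funI mult_left_mono)
      fix m n :: nat and r assume "m \<le> n"
      have "{a m..inverse (a m)} \<subseteq> {a n..inverse (a n)}"
        unfolding atLeastatMost_subset_iff using inc[OF \<open>m \<le> n\<close>] le_imp_inverse_le[OF inc[OF \<open>m \<le> n\<close>] a(1)] by blast
      then show "indicator {a m..inverse (a m)} r \<le> (indicator {a n..inverse (a n)} r :: ennreal)"
        using subsetD[of _ _ r] by (auto simp: indicator_def simp del: atLeastAtMost_iff atLeastatMost_subset_iff)
    qed auto
    show "(\<lambda>n. k r * indicator {a n..inverse (a n)} r) \<longlonglongrightarrow> k r * indicator {0<..} r" for r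
    proof (cases "r > 0")
      case True
      from ex[OF this] obtain m where "\<forall>n\<ge>m. r \<in> {a n..inverse (a n)}" by blast
      then show ?thesis
        using True by (intro tendsto_eventually) (auto simp: eventually_sequentially indicator_def intro!: exI[of _ m])
    next
      case False
      then have "r \<notin> {a n..inverse (a n)}" for n using a(1)[of n] by auto
      with False show ?thesis by simp
    qed
  qed measurable
  have "(\<integral>\<^sup>+r. h r * indicator {a n..inverse (a n)} r \<partial>lborel)
    = (\<integral>\<^sup>+t. h (inverse t) * ennreal (inverse (t\<^sup>2)) * indicator {a n..inverse (a n)} t \<partial>lborel)" for n
    using nn_integral_inverse_interval[OF assms a(1,2)[of n]] by simp
  then show ?thesis
    using LIMSEQ_unique[OF lim[of h]] lim[of "\<lambda>t. h (inverse t) * ennreal (inverse (t\<^sup>2))"] by simp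
qed

definition inversion :: "'a::real_normed_vector \<Rightarrow> 'a" where
  "inversion y = y /\<^sub>R (norm y)\<^sup>2"

lemma norm_inversion: "norm (inversion y) = inverse (norm y)"
  by (cases "y = 0") (auto simp: inversion_def power2_eq_square)

lemma inversion_inversion [simp]: "inversion (inversion y) = y"
  by (cases "y = 0") (simp_all add: inversion_def[of "inversion y"] norm_inversion, simp_all add: inversion_def power2_eq_square field_simps)

lemma borel_measurable_inversion [measurable]:
  "(inversion :: 'a::euclidean_space \<Rightarrow> 'a) \<in> borel_measurable borel"
  unfolding inversion_def by measurable

text \<open>In polar coordinates the inversion acts on the radius alone, as \<open>r \<mapsto> 1/r\<close>; the Jacobian is that of this
substitution combined with the two radial weights.\<close>

lemma nn_integral_inversion:
  fixes f :: "'a::euclidean_space \<Rightarrow> ennreal"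
  assumes [measurable]: "f \<in> borel_measurable borel"
  shows "(\<integral>\<^sup>+y. f y \<partial>lborel) = (\<integral>\<^sup>+x. ennreal (inverse (norm x ^ (2 * DIM('a)))) * f (inversion x) \<partial>lborel)"
proof -
  let ?N = "DIM('a)"
  have N: "?N > 0" by simp
  have [measurable]: "(\<lambda>x::'a. sgn x) \<in> borel_measurable borel"
    unfolding sgn_div_norm by measurable
  have AE0: "AE x::'a in lborel. x \<noteq> 0"
    using AE_lborel_singleton[of "0::'a"] by simp
  have "(\<integral>\<^sup>+r. ennreal (real ?N * r ^ (?N - 1)) * indicator {0<..} r * f (r *\<^sub>R sgn x) \<partial>lborel)
    = (\<integral>\<^sup>+r. ennreal (real ?N * r ^ (?N - 1)) * indicator {0<..} r *
         (ennreal (inverse (norm (r *\<^sub>R sgn x) ^ (2 * ?N))) * f (inversion (r *\<^sub>R sgn x))) \<partial>lborel)"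
    if x: "x \<noteq> 0" for x :: 'a
  proof -
    have "(\<integral>\<^sup>+r. (ennreal (real ?N * r ^ (?N - 1)) * f (r *\<^sub>R sgn x)) * indicator {0<..} r \<partial>lborel)
      = (\<integral>\<^sup>+t. (ennreal (real ?N * inverse t ^ (?N - 1)) * f (inverse t *\<^sub>R sgn x)) * ennreal (inverse (t\<^sup>2)) * indicator {0<..} t \<partial>lborel)"
      by (rule nn_integral_inverse) measurable
    also have "\<dots> = (\<integral>\<^sup>+r. ennreal (real ?N * r ^ (?N - 1)) * indicator {0<..} r *
         (ennreal (inverse (norm (r *\<^sub>R sgn x) ^ (2 * ?N))) * f (inversion (r *\<^sub>R sgn x))) \<partial>lborel)"
    proof (rule nn_integral_cong)
      fix t :: real
      show "(ennreal (real ?N * inverse t ^ (?N - 1)) * f (inverse t *\<^sub>R sgn x)) * ennreal (inverse (t\<^sup>2)) * indicator {0<..} t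
        = ennreal (real ?N * t ^ (?N - 1)) * indicator {0<..} t *
         (ennreal (inverse (norm (t *\<^sub>R sgn x) ^ (2 * ?N))) * f (inversion (t *\<^sub>R sgn x)))"
      proof (cases "t > 0")
        case t: True
        have n: "norm (t *\<^sub>R sgn x) = t" using t x by (simp add: norm_sgn)
        have i: "inversion (t *\<^sub>R sgn x) = inverse t *\<^sub>R sgn x"
          unfolding inversion_def n using t by (simp add: power2_eq_square)
        obtain k where k: "?N = Suc k" using N by (metis Suc_pred)
        have "real ?N * inverse t ^ (?N - 1) * inverse (t\<^sup>2) = real ?N * t ^ (?N - 1) * inverse (t ^ (2 * ?N))"
          unfolding k using t by (simp add: power2_eq_square field_simps power_mult_distrib flip: power_add) (simp add: mult_2 mult_2_right)
        note e = this
        have 1: "ennreal (real ?N * inverse t ^ (?N - 1)) * F * ennreal (inverse (t\<^sup>2)) = ennreal (real ?N * inverse t ^ (?N - 1) * inverse (t\<^sup>2)) * F" for F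
          using t by (simp add: ennreal_mult mult_ac)
        have 2: "ennreal (real ?N * t ^ (?N - 1)) * (ennreal (inverse (t ^ (2 * ?N))) * F) = ennreal (real ?N * t ^ (?N - 1) * inverse (t ^ (2 * ?N))) * F" for F
          using t by (simp add: ennreal_mult mult_ac)
        show ?thesis
          unfolding n i 1 e using t 2 by simp
      qed simp
    qed
    finally show ?thesis by (simp add: mult_ac)
  qed
  then show ?thesis
    unfolding nn_integral_polar[OF assms]
    by (subst nn_integral_polar[of "\<lambda>x. ennreal (inverse (norm x ^ (2 * DIM('a)))) * f (inversion x)"], measurable)
       (intro nn_integral_cong_AE eventually_mono[OF AE0]; simp)
qed

section \<open>The divergence theorem for radial fields\<close>

lemma borel_measurable_sgn [measurable]: "(sgn :: 'a::euclidean_space \<Rightarrow> 'a) \<in> borel_measurable borel"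
  unfolding sgn_div_norm[abs_def] by measurable

text \<open>The measure form of polar coordinates: it carries the formula over from nonnegative functions to integrable
ones.\<close>

lemma lborel_eq_polar:
  "(lborel :: 'a::euclidean_space measure) =
     distr (density (lborel \<Otimes>\<^sub>M lborel) (\<lambda>(x, r). ennreal (real DIM('a) * r ^ (DIM('a) - 1) * indicator {0<..} r * indicator (ball 0 1) x)))
       borel (\<lambda>(x :: 'a, r). r *\<^sub>R sgn x)"
proof (rule measure_eqI)
  fix A :: "'a set" assume "A \<in> sets lborel"
  then have [measurable]: "A \<in> sets borel" by simp
  have [measurable]: "ball (0::'a) 1 \<in> sets borel" by simp
  let ?N = "DIM('a)"
  let ?D = "\<lambda>(x::'a, r). ennreal (real ?N * r ^ (?N - 1) * indicator {0<..} r * indicator (ball 0 1) x)"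
  have "emeasure (distr (density (lborel \<Otimes>\<^sub>M lborel) ?D) borel (\<lambda>(x :: 'a, r). r *\<^sub>R sgn x)) A
     = (\<integral>\<^sup>+p. indicator A p \<partial>(distr (density (lborel \<Otimes>\<^sub>M lborel) ?D) borel (\<lambda>(x :: 'a, r). r *\<^sub>R sgn x)))"
    by simp
  also have "\<dots> = (\<integral>\<^sup>+p. ?D p * indicator A (case p of (x, r) \<Rightarrow> r *\<^sub>R sgn x) \<partial>(lborel \<Otimes>\<^sub>M lborel))"
    by (subst nn_integral_distr, measurable, rule nn_integral_density) measurable
  also have "\<dots> = (\<integral>\<^sup>+x. \<integral>\<^sup>+r. ?D (x, r) * indicator A (r *\<^sub>R sgn x) \<partial>lborel \<partial>lborel)"
    by (subst lborel.nn_integral_fst[symmetric]) auto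
  also have "\<dots> = (\<integral>\<^sup>+x. (\<integral>\<^sup>+r. ennreal (real DIM('a) * r ^ (DIM('a) - 1)) * indicator {0<..} r * indicator A (r *\<^sub>R sgn x) \<partial>lborel)
       * indicator (ball 0 1) x \<partial>lborel)"
  proof (rule nn_integral_cong)
    fix x :: 'a
    show "(\<integral>\<^sup>+r. ?D (x, r) * indicator A (r *\<^sub>R sgn x) \<partial>lborel) =
      (\<integral>\<^sup>+r. ennreal (real DIM('a) * r ^ (DIM('a) - 1)) * indicator {0<..} r * indicator A (r *\<^sub>R sgn x) \<partial>lborel) * indicator (ball 0 1) x"
      by (subst nn_integral_multc[symmetric], measurable, rule nn_integral_cong)
         (auto simp: indicator_def)
  qed
  also have "\<dots> = emeasure lborel A"
    by (subst nn_integral_polar[symmetric]) auto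
  finally show "emeasure lborel A = emeasure (distr (density (lborel \<Otimes>\<^sub>M lborel) ?D) borel (\<lambda>(x :: 'a, r). r *\<^sub>R sgn x)) A"
    by simp
qed simp

lemma integral_polar:
  fixes f :: "'a::euclidean_space \<Rightarrow> real"
  assumes f: "integrable lborel f"
  defines "g \<equiv> \<lambda>x r. (real DIM('a) * r ^ (DIM('a) - 1) * indicator {0<..} r * indicator (ball 0 1) x) * f (r *\<^sub>R sgn (x::'a))"
  shows "AE x in lborel. integrable lborel (g x)"
    and "(\<integral>y. f y \<partial>lborel) = (\<integral>x. (\<integral>r. g x r \<partial>lborel) \<partial>lborel)"
proof -
  have [measurable]: "f \<in> borel_measurable borel" using f by auto
  have [measurable]: "ball (0::'a) 1 \<in> sets borel" by simp
  let ?N = "DIM('a)"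
  let ?D = "\<lambda>p::'a\<times>real. real ?N * snd p ^ (?N - 1) * indicator {0<..} (snd p) * indicator (ball 0 1) (fst p)"
  let ?T = "\<lambda>p::'a\<times>real. snd p *\<^sub>R sgn (fst p)"
  have D0: "0 \<le> ?D p" for p by (auto simp: indicator_def)
  have eq: "lborel = distr (density (lborel \<Otimes>\<^sub>M lborel) (\<lambda>p. ennreal (?D p))) borel ?T"
    using lborel_eq_polar[where 'a = 'a] by (simp add: case_prod_beta')
  have T: "?T \<in> density (lborel \<Otimes>\<^sub>M lborel) (\<lambda>p. ennreal (?D p)) \<rightarrow>\<^sub>M borel"
    by (subst measurable_density_eq1) measurable
  have "integrable (distr (density (lborel \<Otimes>\<^sub>M lborel) (\<lambda>p. ennreal (?D p))) borel ?T) f"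
    using f eq by simp
  then have "integrable (density (lborel \<Otimes>\<^sub>M lborel) (\<lambda>p. ennreal (?D p))) (\<lambda>p. f (?T p))"
    by (subst (asm) integrable_distr_eq[OF T]) auto
  then have I: "integrable (lborel \<Otimes>\<^sub>M lborel) (\<lambda>p. ?D p * f (?T p))"
    using D0 by (subst (asm) integrable_density) auto
  have "(\<integral>y. f y \<partial>lborel) = (\<integral>y. f y \<partial>distr (density (lborel \<Otimes>\<^sub>M lborel) (\<lambda>p. ennreal (?D p))) borel ?T)"
    using eq by simp
  also have "\<dots> = (\<integral>p. ?D p * f (?T p) \<partial>(lborel \<Otimes>\<^sub>M lborel))"
    using D0 by (subst integral_distr[OF T], simp, subst integral_density) auto
  also have "\<dots> = (\<integral>x. (\<integral>r. g x r \<partial>lborel) \<partial>lborel)"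
    unfolding g_def using lborel_pair.integral_fst'[OF I] by simp
  finally show "(\<integral>y. f y \<partial>lborel) = (\<integral>x. (\<integral>r. g x r \<partial>lborel) \<partial>lborel)" .
  show "AE x in lborel. integrable lborel (g x)"
    unfolding g_def using lborel_pair.AE_integrable_fst'[OF I] by simp
qed

text \<open>In the applications \<open>f\<close> is the divergence of \<open>g(y) y\<close> and \<open>P \<omega> r = r^N g(r \<omega>)\<close>. The statement uses \<open>P\<close> instead of \<open>g\<close> so that \<open>a = 0\<close> is allowed when \<open>g\<close> is singular
at the origin but \<open>P\<close> extends continuously.\<close>

lemma radial_divergence:
  fixes f :: "'a::euclidean_space \<Rightarrow> real" and P :: "'a \<Rightarrow> real \<Rightarrow> real"
  assumes ab: "0 \<le> a" "a \<le> b"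
    and f: "integrable lborel (\<lambda>y. indicator {y. a < norm y \<and> norm y < b} y * f y)"
    and P': "\<And>\<omega> r. norm \<omega> = 1 \<Longrightarrow> a < r \<Longrightarrow> r < b \<Longrightarrow> (P \<omega> has_real_derivative r ^ (DIM('a) - 1) * f (r *\<^sub>R \<omega>)) (at r)"
    and P: "\<And>\<omega>. norm \<omega> = 1 \<Longrightarrow> continuous_on {a..b} (P \<omega>)"
    and m': "\<And>r. (\<lambda>x. P (sgn x) r) \<in> borel_measurable borel"
  shows "(\<integral>y. indicator {y. a < norm y \<and> norm y < b} y * f y \<partial>lborel)
    = real DIM('a) * (\<integral>x. indicator (ball 0 1) x * (P (sgn x) b - P (sgn x) a) \<partial>lborel)"
proof -
  let ?N = "DIM('a)"
  define F where "F y = indicator {y. a < norm y \<and> norm y < b} y * f y" for y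
  define g where "g x r = (real ?N * r ^ (?N - 1) * indicator {0<..} r * indicator (ball 0 1) x) * F (r *\<^sub>R sgn x)" for x :: 'a and r
  have F: "integrable lborel F" using f unfolding F_def .
  have AE0: "AE x::'a in lborel. x \<noteq> 0"
    using AE_lborel_singleton[of "0::'a"] by simp
  have [measurable]: "F \<in> borel_measurable borel" using F by auto
  have [measurable]: "ball (0::'a) 1 \<in> sets borel" by simp
  have inner: "(\<integral>r. g x r \<partial>lborel) = real ?N * (indicator (ball 0 1) x * (P (sgn x) b - P (sgn x) a))"
    if "integrable lborel (g x)" "x \<noteq> 0" for x
  proof -
    have n: "norm (sgn x) = 1" using that by (simp add: norm_sgn)
    have eq: "g x r = (if r \<in> {a..b} then indicator (ball 0 1) x * real ?N * (indicator {a<..<b} r * r ^ (?N - 1) * f (r *\<^sub>R sgn x)) else 0)" for r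
      using ab n by (auto simp: g_def F_def indicator_def)
    have "((\<lambda>r. indicator {a<..<b} r * r ^ (?N - 1) * f (r *\<^sub>R sgn x)) has_integral (P (sgn x) b - P (sgn x) a)) {a..b}"
      using P'[OF n] P[OF n] ab
      by (intro fundamental_theorem_of_calculus_interior) (auto simp: has_real_derivative_iff_has_vector_derivative)
    from has_integral_mult_right[OF this, of "indicator (ball 0 1) x * real ?N"]
    have "(g x has_integral (indicator (ball 0 1) x * real ?N * (P (sgn x) b - P (sgn x) a))) UNIV"
      unfolding eq[abs_def] has_integral_restrict_UNIV .
    with has_integral_integral_lborel[OF that(1)] show ?thesis
      using has_integral_unique by (simp add: mult_ac) blast
  qed
  have "(\<integral>y. F y \<partial>lborel) = (\<integral>x. (\<integral>r. g x r \<partial>lborel) \<partial>lborel)"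
    unfolding g_def by (rule integral_polar(2)[OF F])
  also have "\<dots> = (\<integral>x. real ?N * (indicator (ball 0 1) x * (P (sgn x) b - P (sgn x) a)) \<partial>lborel)"
  proof (rule Bochner_Integration.integral_cong_AE)
    show *: "AE x in lborel. (\<integral>r. g x r \<partial>lborel) = real ?N * (indicator (ball 0 1) x * (P (sgn x) b - P (sgn x) a))"
      using AE0 integral_polar(1)[OF F] unfolding g_def[symmetric] by eventually_elim (rule inner)
    show m: "(\<lambda>x. \<integral>r. g x r \<partial>lborel) \<in> borel_measurable lborel"
      unfolding g_def by measurable
    show "(\<lambda>x. real ?N * (indicator (ball 0 1) x * (P (sgn x) b - P (sgn x) a))) \<in> borel_measurable lborel"
      using m' by measurable
  qed
  also have "\<dots> = real ?N * (\<integral>x. (indicator (ball 0 1) x * (P (sgn x) b - P (sgn x) a)) \<partial>lborel)"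
    by simp
  finally show ?thesis by (simp add: F_def)
qed

text \<open>Scaling the ball of radius \<open>R\<close> to the unit ball brings the integral into the form in which polar coordinates
produce it.\<close>

lemma integral_sphere_measure:
  fixes g :: "'a::euclidean_space \<Rightarrow> real"
  assumes [measurable]: "g \<in> borel_measurable borel" and R: "R > 0"
  shows "(\<integral>y. g y \<partial>sphere_measure R) = real DIM('a) * R ^ (DIM('a) - 1) * (\<integral>x. indicator (ball 0 1) x * g (R *\<^sub>R sgn x) \<partial>lborel)"
proof -
  let ?N = "DIM('a)"
  have N: "?N > 0" by simp
  have [measurable]: "ball (0::'a) R \<in> sets borel" "ball (0::'a) 1 \<in> sets borel" by auto
  have scale: "scale_measure c M = density M (\<lambda>_. c)" for c and M :: "'a measure"
    by (rule measure_eqI) (auto simp: emeasure_density_const)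
  have m: "(\<lambda>x. (R / norm x) *\<^sub>R x) \<in> density (restrict_space lborel (ball 0 R)) (\<lambda>x. ennreal (real ?N / R)) \<rightarrow>\<^sub>M (borel :: 'a measure)"
    by (subst measurable_density_eq1, rule measurable_restrict_space1) measurable
  have "(\<integral>y. g y \<partial>sphere_measure R) = (\<integral>x. g ((R / norm x) *\<^sub>R x) \<partial>density (restrict_space lborel (ball 0 R)) (\<lambda>x. ennreal (real ?N / R)))"
    unfolding sphere_measure_def scale by (rule integral_distr[OF m]) simp
  also have "\<dots> = (\<integral>x. (real ?N / R) *\<^sub>R g ((R / norm x) *\<^sub>R x) \<partial>restrict_space lborel (ball 0 R))"
    using R by (intro integral_density measurable_restrict_space1) auto
  also have "\<dots> = (\<integral>x. indicator (ball 0 R) x *\<^sub>R (real ?N / R) *\<^sub>R g ((R / norm x) *\<^sub>R x) \<partial>lborel)"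
    by (rule integral_restrict_space) simp
  also have "\<dots> = (\<integral>x. (real ?N / R) * (indicator (ball 0 R) x * g (R *\<^sub>R sgn x)) \<partial>lborel)"
    by (simp add: sgn_div_norm divide_inverse mult_ac)
  also have "\<dots> = (real ?N / R) * (\<integral>x. indicator (ball 0 R) x * g (R *\<^sub>R sgn x) \<partial>lborel)"
    by simp
  also have "(\<integral>x. indicator (ball 0 R) x * g (R *\<^sub>R sgn x) \<partial>(lborel::'a measure))
    = (\<integral>x. indicator (ball 0 R) x * g (R *\<^sub>R sgn x) \<partial>density (distr lborel borel (\<lambda>x::'a. 0 + R *\<^sub>R x)) (\<lambda>_. \<bar>R\<bar>^DIM('a)))"
    using lborel_affine[of R "0::'a"] R by simp
  also have "\<dots> = (\<integral>x. R ^ ?N *\<^sub>R (indicator (ball 0 R) x * g (R *\<^sub>R sgn x)) \<partial>distr lborel borel (\<lambda>x::'a. 0 + R *\<^sub>R x))"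
    using R by (subst integral_density) auto
  also have "\<dots> = (\<integral>x. R ^ ?N *\<^sub>R (indicator (ball 0 R) (R *\<^sub>R x) * g (R *\<^sub>R sgn (R *\<^sub>R x))) \<partial>(lborel::'a measure))"
    by (subst integral_distr) auto
  also have "\<dots> = (\<integral>x. R ^ ?N * (indicator (ball 0 1) x * g (R *\<^sub>R sgn x)) \<partial>(lborel::'a measure))"
    using R by (intro Bochner_Integration.integral_cong) (auto simp: indicator_def sgn_scaleR)
  also have "\<dots> = R ^ ?N * (\<integral>x. indicator (ball 0 1) x * g (R *\<^sub>R sgn x) \<partial>(lborel::'a measure))"
    by simp
  finally show ?thesis
    using R power_Suc[of R "?N - 1"] N by (simp add: field_simps)
qed

lemma finite_measure_sphere_measure:
  assumes "R > 0"
  shows "emeasure (sphere_measure R :: 'a::euclidean_space measure) UNIV < \<infinity>"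
proof -
  have m: "(\<lambda>x::'a. (R / norm x) *\<^sub>R x) \<in> (scale_measure (ennreal (real DIM('a) / R)) (restrict_space lborel (ball 0 R))) \<rightarrow>\<^sub>M borel"
    by (subst measurable_cong_sets[OF sets_scale_measure refl], rule measurable_restrict_space1) measurable
  have "emeasure lborel (ball (0::'a) R) < \<infinity>"
    by (rule emeasure_bounded_finite) simp
  then show ?thesis
    unfolding sphere_measure_def using assms
    by (subst emeasure_distr[OF m])
       (auto simp: space_scale_measure space_restrict_space emeasure_restrict_space ennreal_mult_less_top emeasure_lborel_ball_finite)
qed

lemma sets_sphere_measure [measurable_cong]: "sets (sphere_measure R) = sets borel"
  by (simp add: sphere_measure_def)

lemma AE_sphere_measure:
  assumes "R > 0"
  shows "AE y::'a::euclidean_space in sphere_measure R. norm y = R"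
proof -
  have "(\<lambda>x::'a. (R / norm x) *\<^sub>R x) \<in> (scale_measure (ennreal (real DIM('a) / R)) (restrict_space lborel (ball 0 R))) \<rightarrow>\<^sub>M borel"
    by (subst measurable_cong_sets[OF sets_scale_measure refl], rule measurable_restrict_space1) measurable
  moreover have "AE x::'a in restrict_space lborel (ball 0 R). x \<noteq> 0"
    using AE_lborel_singleton[of "0::'a"] by (subst AE_restrict_space_iff) auto
  then have "AE x::'a in scale_measure (ennreal (real DIM('a) / R)) (restrict_space lborel (ball 0 R)). norm ((R / norm x) *\<^sub>R x) = R"
    using assms by (auto simp: AE_iff_null_sets eventually_ae_filter null_sets_def space_scale_measure)
  ultimately show ?thesis
    unfolding sphere_measure_def by (subst AE_distr_iff) auto
qed

lemma integrable_sphere_measure: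
  fixes g :: "'a::euclidean_space \<Rightarrow> real"
  assumes "continuous_on UNIV g" "R > 0"
  shows "integrable (sphere_measure R) g"
proof -
  have [measurable]: "g \<in> borel_measurable borel"
    by (rule borel_measurable_continuous_onI[OF assms(1)])
  interpret finite_measure "sphere_measure R :: 'a measure"
    by (rule finite_measureI) (use finite_measure_sphere_measure[OF assms(2), where 'a = 'a] in \<open>simp add: sphere_measure_def\<close>)
  have "compact (g ` sphere 0 R)"
    using assms(1) by (intro compact_continuous_image) (auto intro: continuous_on_subset)
  then obtain B where "\<forall>y\<in>sphere 0 R. norm (g y) \<le> B"
    using compact_imp_bounded[of "g ` sphere 0 R"] by (auto simp: bounded_iff)
  then have B: "\<bar>g y\<bar> \<le> B" if "norm y = R" for y
    using that by auto
  show ?thesis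
    by (rule integrable_const_bound[of _ B])
       (use AE_sphere_measure[OF assms(2), where 'a = 'a] B in \<open>auto elim!: eventually_mono\<close>)
qed

section \<open>Boundary values on spheres\<close>

abbreviation annulus :: "real \<Rightarrow> 'a::euclidean_space set" where
  "annulus R \<equiv> ball 0 R - cball 0 1"

lemma integrable_annulus:
  fixes f :: "'a::euclidean_space \<Rightarrow> real"
  assumes "continuous_on (- {0}) f"
  shows "integrable (lebesgue_on (annulus R)) f" "integrable lborel (\<lambda>y. indicator (annulus R) y * f y)"
    "(\<integral>y. f y \<partial>lebesgue_on (annulus R)) = (\<integral>y. indicator (annulus R) y * f y \<partial>lborel)"
proof -
  let ?K = "cball 0 R - ball (0::'a) 1"
  have "compact ?K" by (simp add: compact_diff)
  then have "integrable lborel (\<lambda>y. indicator ?K y *\<^sub>R f y)"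
    by (rule borel_integrable_compact) (rule continuous_on_subset[OF assms], auto)
  from integrable_mult_indicator[OF _ this, of "annulus R"]
  have "integrable lborel (\<lambda>y. indicator (annulus R) y *\<^sub>R indicator ?K y *\<^sub>R f y)"
    by simp
  moreover have "(\<lambda>y. indicator (annulus R) y *\<^sub>R indicator ?K y *\<^sub>R f y) = (\<lambda>y. indicator (annulus R) y * f y)"
    by (auto simp: indicator_def fun_eq_iff)
  ultimately show I: "integrable lborel (\<lambda>y. indicator (annulus R) y * f y)" by simp
  then have m: "(\<lambda>y. indicator (annulus R) y * f y) \<in> borel_measurable lborel" by auto
  show "integrable (lebesgue_on (annulus R)) f"
    using I integrable_completion[OF m] by (subst integrable_restrict_space) auto
  show "(\<integral>y. f y \<partial>lebesgue_on (annulus R)) = (\<integral>y. indicator (annulus R) y * f y \<partial>lborel)"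
    using integral_completion[OF m] by (subst integral_restrict_space) auto
qed

text \<open>The divergence of \<open>g(y) y\<close> is \<open>N g + y \<bullet> \<nabla>g\<close>, and on the outer sphere the normal component of the field is
\<open>R g\<close>.\<close>

lemma annulus_flux:
  fixes g :: "'a::euclidean_space \<Rightarrow> real"
  assumes R: "R > 1"
    and g[measurable]: "g \<in> borel_measurable borel"
    and D: "\<And>y. y \<noteq> 0 \<Longrightarrow> (g has_derivative (\<lambda>h. D y \<bullet> h)) (at y)" "continuous_on (- {0}) D"
    and g0: "\<And>y. norm y = 1 \<Longrightarrow> g y = 0"
  shows "(\<integral>y. real DIM('a) * g y + y \<bullet> D y \<partial>lebesgue_on (annulus R)) = R * (\<integral>y. g y \<partial>sphere_measure R)"
proof -
  let ?N = "DIM('a)"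
  define f where "f y = real ?N * g y + y \<bullet> D y" for y
  have gc: "continuous_on (- {0}) g"
    using D(1) by (intro continuous_at_imp_continuous_on) (auto intro: has_derivative_continuous)
  have fc: "continuous_on (- {0}) f"
    unfolding f_def by (intro continuous_intros gc D)
  let ?P = "\<lambda>\<omega> r. r ^ ?N * g (r *\<^sub>R \<omega>)"
  let ?Q = "\<lambda>x. indicator (ball 0 1) x * (?P (sgn x) R - ?P (sgn x) 1)"
  have set: "annulus R = {y::'a. 1 < norm y \<and> norm y < R}" by auto
  note fi = integrable_annulus[OF fc, of R]
  have "(\<integral>y. indicator {y. 1 < norm y \<and> norm y < R} y * f y \<partial>lborel)
    = real ?N * (\<integral>x. ?Q x \<partial>lborel)"
  proof (rule radial_divergence)
    show "integrable lborel (\<lambda>y. indicator {y. 1 < norm y \<and> norm y < R} y * f y)"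
      using fi(2) unfolding set .
    show d: "((\<lambda>r. r ^ ?N * g (r *\<^sub>R \<omega>)) has_real_derivative r ^ (?N - 1) * f (r *\<^sub>R \<omega>)) (at r)"
      if "norm \<omega> = 1" "1 < r" for \<omega> r
    proof -
      have n0: "r *\<^sub>R \<omega> \<noteq> 0" using that by auto
      have "((\<lambda>r. r *\<^sub>R \<omega>) has_derivative (\<lambda>h. h *\<^sub>R \<omega>)) (at r)"
        by (auto intro!: derivative_eq_intros)
      from has_derivative_compose[OF this D(1)[OF n0]]
      have "((\<lambda>r. g (r *\<^sub>R \<omega>)) has_real_derivative D (r *\<^sub>R \<omega>) \<bullet> \<omega>) (at r)"
        by (simp add: has_field_derivative_def mult.commute[of _ "D (r *\<^sub>R \<omega>) \<bullet> \<omega>"])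
      then have "((\<lambda>r. r ^ ?N * g (r *\<^sub>R \<omega>)) has_real_derivative (real ?N * r ^ (?N - 1)) * g (r *\<^sub>R \<omega>) + D (r *\<^sub>R \<omega>) \<bullet> \<omega> * r ^ ?N) (at r)"
        by (intro DERIV_mult) (auto intro!: derivative_eq_intros)
      moreover have "(real ?N * r ^ (?N - 1)) * g (r *\<^sub>R \<omega>) + D (r *\<^sub>R \<omega>) \<bullet> \<omega> * r ^ ?N = r ^ (?N - 1) * f (r *\<^sub>R \<omega>)"
        using power_Suc[of r "?N - 1"] by (simp add: f_def algebra_simps inner_commute)
      ultimately show ?thesis by (simp only:)
    qed
    show "continuous_on {1..R} (\<lambda>r. r ^ ?N * g (r *\<^sub>R \<omega>))" if "norm \<omega> = 1" for \<omega>
      using that by (intro continuous_intros continuous_on_compose2[OF gc]) auto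
    show "(\<lambda>x. r ^ ?N * g (r *\<^sub>R sgn x)) \<in> borel_measurable borel" for r
      by measurable
  qed (use R in auto)
  also have "\<dots> = real ?N * (\<integral>x. R ^ ?N * (indicator (ball 0 1) x * g (R *\<^sub>R sgn x)) \<partial>lborel)"
  proof -
    have AE0: "AE x::'a in lborel. x \<noteq> 0"
      using AE_lborel_singleton[of "0::'a"] by simp
    have "(\<integral>x. ?Q x \<partial>lborel)
      = (\<integral>x. R ^ ?N * (indicator (ball 0 1) x * g (R *\<^sub>R sgn x)) \<partial>lborel)"
    proof (rule Bochner_Integration.integral_cong_AE)
      have [measurable]: "ball (0::'a) 1 \<in> sets borel" by simp
      show "(\<lambda>x. ?Q x) \<in> borel_measurable lborel"
        by measurable
      show "(\<lambda>x. R ^ ?N * (indicator (ball 0 1) x * g (R *\<^sub>R sgn x))) \<in> borel_measurable lborel"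
        by measurable
      show "AE x in lborel. ?Q x
         = R ^ ?N * (indicator (ball 0 1) x * g (R *\<^sub>R sgn x))"
        using AE0 by eventually_elim (simp add: g0 norm_sgn)
    qed
    then show ?thesis by simp
  qed
  also have "\<dots> = R * (\<integral>y. g y \<partial>sphere_measure R)"
    using R power_Suc[of R "?N - 1"] by (subst integral_sphere_measure) auto
  finally show ?thesis
    using fi(3) unfolding set f_def by simp
qed

text \<open>The factor \<open>|y|\<^sup>2 - 1\<close> removes the inner boundary, so nothing needs to be known about \<open>\<psi>\<close> there. This
is what bounds traces of arbitrary smooth functions by their \<open>H\<^sup>1\<close> norm on the annulus.\<close>

lemma sphere_integral_squared:
  fixes \<psi> :: "'a::euclidean_space \<Rightarrow> real"
  assumes R: "R > 1" and s: "smooth \<psi>"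
  shows "R * (R\<^sup>2 - 1) * (\<integral>y. (\<psi> y)\<^sup>2 \<partial>sphere_measure R)
    = (\<integral>y. \<psi> y * ((2 * ((norm y)\<^sup>2 - 1)) * (y \<bullet> grad \<psi> y) + (real DIM('a) * ((norm y)\<^sup>2 - 1) + 2 * (norm y)\<^sup>2) * \<psi> y) \<partial>lebesgue_on (annulus R))"
proof -
  define g where "g y = (\<psi> y)\<^sup>2 * (y \<bullet> y - 1)" for y
  define D where "D y = (2 * \<psi> y * (y \<bullet> y - 1)) *\<^sub>R grad \<psi> y + (2 * (\<psi> y)\<^sup>2) *\<^sub>R y" for y
  note c = smooth_continuous[OF s] smooth_grad_continuous[OF s]
  note c' = continuous_on_subset[OF c(1) subset_UNIV] continuous_on_subset[OF c(2) subset_UNIV]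
  have gc: "continuous_on UNIV g" unfolding g_def by (intro continuous_intros c)
  have "(\<integral>y. real DIM('a) * g y + y \<bullet> D y \<partial>lebesgue_on (annulus R)) = R * (\<integral>y. g y \<partial>sphere_measure R)"
  proof (rule annulus_flux[OF R])
    show "g \<in> borel_measurable borel" by (rule borel_measurable_continuous_onI[OF gc])
    show "(g has_derivative (\<lambda>h. D y \<bullet> h)) (at y)" for y
      unfolding g_def D_def
      by (auto intro!: derivative_eq_intros smooth_has_derivative[OF s] simp: algebra_simps power2_eq_square inner_commute)
    show "continuous_on (- {0}) D" unfolding D_def by (intro continuous_intros c')
    show "g y = 0" if "norm y = 1" for y
      using that by (simp add: g_def dot_square_norm)
  qed
  also have "(\<integral>y. g y \<partial>sphere_measure R) = (\<integral>y. (R\<^sup>2 - 1) * (\<psi> y)\<^sup>2 \<partial>sphere_measure R)"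
  proof (rule Bochner_Integration.integral_cong_AE)
    show "g \<in> borel_measurable (sphere_measure R)" "(\<lambda>y. (R\<^sup>2 - 1) * (\<psi> y)\<^sup>2) \<in> borel_measurable (sphere_measure R)"
      using borel_measurable_continuous_onI[OF gc] smooth_borel(1)[OF s] by measurable
    show "AE y in sphere_measure R. g y = (R\<^sup>2 - 1) * (\<psi> y)\<^sup>2"
      using AE_sphere_measure[of R] R by (auto elim!: eventually_mono simp: g_def dot_square_norm)
  qed
  also have "(\<integral>y. (R\<^sup>2 - 1) * (\<psi> y)\<^sup>2 \<partial>sphere_measure R) = (R\<^sup>2 - 1) * (\<integral>y. (\<psi> y)\<^sup>2 \<partial>sphere_measure R)"
    by simp
  also have "(\<integral>y. real DIM('a) * g y + y \<bullet> D y \<partial>lebesgue_on (annulus R))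
    = (\<integral>y. \<psi> y * ((2 * ((norm y)\<^sup>2 - 1)) * (y \<bullet> grad \<psi> y) + (real DIM('a) * ((norm y)\<^sup>2 - 1) + 2 * (norm y)\<^sup>2) * \<psi> y) \<partial>lebesgue_on (annulus R))"
    by (rule Bochner_Integration.integral_cong[OF refl])
       (simp add: g_def D_def inner_add_right dot_square_norm algebra_simps power2_eq_square)
  finally show ?thesis by (simp only: mult.assoc)
qed

text \<open>The flux of \<open>\<psi>\<^sup>2 y*\<close>. Up to the constant \<open>c\<close>, the left-hand side is the boundary term in the energy and
the right-hand side is the divergence by which \<open>|A \<psi>|\<^sup>2\<close> differs from the Hardy integrand.\<close>

lemma sphere_integral_squared_zero:
  fixes \<psi> :: "'a::euclidean_space \<Rightarrow> real"
  assumes R: "R > 1" and s: "smooth \<psi>" and z: "\<And>y. norm y = 1 \<Longrightarrow> \<psi> y = 0"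
  shows "(1 / R) * (\<integral>y. (\<psi> y)\<^sup>2 \<partial>sphere_measure R)
    = (\<integral>y. \<psi> y * (2 * (inversion y \<bullet> grad \<psi> y) + (real DIM('a) - 2) * (\<psi> y / (norm y)\<^sup>2)) \<partial>lebesgue_on (annulus R))"
proof -
  define g where "g y = (\<psi> y)\<^sup>2 * inverse ((norm y)^2)" for y
  define D where "D y = (2 * \<psi> y * inverse ((norm y)^2)) *\<^sub>R grad \<psi> y - (2 * (\<psi> y)\<^sup>2 * inverse ((norm y)^2) * inverse ((norm y)^2)) *\<^sub>R y" for y
  note c = smooth_continuous[OF s] smooth_grad_continuous[OF s]
  note c' = continuous_on_subset[OF c(1) subset_UNIV] continuous_on_subset[OF c(2) subset_UNIV]
  have [measurable]: "\<psi> \<in> borel_measurable borel" by (rule smooth_borel(1)[OF s])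
  have gm: "g \<in> borel_measurable borel" unfolding g_def by measurable
  have "(\<integral>y. real DIM('a) * g y + y \<bullet> D y \<partial>lebesgue_on (annulus R)) = R * (\<integral>y. g y \<partial>sphere_measure R)"
  proof (rule annulus_flux[OF R gm])
    show "(g has_derivative (\<lambda>h. D y \<bullet> h)) (at y)" if "y \<noteq> 0" for y
      unfolding g_def D_def
      by (rule derivative_eq_intros smooth_has_derivative[OF s] has_derivative_inverse_norm_power that refl)+
         (auto simp: algebra_simps power2_eq_square inner_commute inner_diff_left)
    show "continuous_on (- {0}) D" unfolding D_def by (intro continuous_intros c') auto
    show "g y = 0" if "norm y = 1" for y
      using that z by (simp add: g_def)
  qed
  also have "(\<integral>y. g y \<partial>sphere_measure R) = (\<integral>y. inverse (R^2) * (\<psi> y)\<^sup>2 \<partial>sphere_measure R)"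
  proof (rule Bochner_Integration.integral_cong_AE)
    show "g \<in> borel_measurable (sphere_measure R)" "(\<lambda>y. inverse (R^2) * (\<psi> y)\<^sup>2) \<in> borel_measurable (sphere_measure R)"
      using gm by measurable
    show "AE y in sphere_measure R. g y = inverse (R^2) * (\<psi> y)\<^sup>2"
      using AE_sphere_measure[of R] R by (auto elim!: eventually_mono simp: g_def)
  qed
  also have "R * \<dots> = (1 / R) * (\<integral>y. (\<psi> y)\<^sup>2 \<partial>sphere_measure R)"
    using R by (simp add: field_simps power2_eq_square)
  also have "(\<integral>y. real DIM('a) * g y + y \<bullet> D y \<partial>lebesgue_on (annulus R))
    = (\<integral>y. \<psi> y * (2 * (inversion y \<bullet> grad \<psi> y) + (real DIM('a) - 2) * (\<psi> y / (norm y)\<^sup>2)) \<partial>lebesgue_on (annulus R))"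
  proof (rule Bochner_Integration.integral_cong[OF refl])
    fix y :: 'a assume "y \<in> space (lebesgue_on (annulus R))"
    then have y: "norm y > 0" by (auto simp: space_restrict_space)
    then show "real DIM('a) * g y + y \<bullet> D y = \<psi> y * (2 * (inversion y \<bullet> grad \<psi> y) + (real DIM('a) - 2) * (\<psi> y / (norm y)\<^sup>2))"
      by (simp add: g_def D_def inversion_def inner_diff_right dot_square_norm field_simps power2_eq_square)
  qed
  finally show ?thesis by simp
qed

lemma integrable_annulus_smooth:
  assumes "smooth \<psi>"
  shows "integrable (lebesgue_on (annulus R)) (\<lambda>y. (norm (\<psi> y))\<^sup>2)"
    and "integrable (lebesgue_on (annulus R)) (\<lambda>y. (norm (grad \<psi> y))\<^sup>2)"
  by (rule integrable_annulus, intro continuous_intros smooth_continuous_on smooth_grad_continuous_on assms)+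

text \<open>The divergence of \<open>(|y|\<^sup>2 - 1) \<psi>\<^sup>2 y\<close> is \<open>\<psi>\<close> times this density of \<open>\<psi>\<close> and its gradient. The
density is linear in the pair, and so it is compatible with limits in the square mean.\<close>

definition trace_density :: "('a::euclidean_space \<Rightarrow> real) \<Rightarrow> ('a \<Rightarrow> 'a) \<Rightarrow> 'a \<Rightarrow> real" where
  "trace_density w G y = (2 * ((norm y)\<^sup>2 - 1)) * (y \<bullet> G y) + (real DIM('a) * ((norm y)\<^sup>2 - 1) + 2 * (norm y)\<^sup>2) * w y"

lemma L2_converges_trace_density:
  fixes w :: "'a::euclidean_space \<Rightarrow> real"
  assumes R: "R > 1"
    and L: "L2_converges (lebesgue_on (annulus R)) \<psi> w" "L2_converges (lebesgue_on (annulus R)) D G"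
  shows "L2_converges (lebesgue_on (annulus R)) (\<lambda>n. trace_density (\<psi> n) (D n)) (trace_density w G)"
proof -
  let ?k = "\<lambda>y::'a. 2 * ((norm y)\<^sup>2 - 1)"
  let ?m = "\<lambda>y::'a. real DIM('a) * ((norm y)\<^sup>2 - 1) + 2 * (norm y)\<^sup>2"
  let ?M = "lebesgue_on (annulus R :: 'a set)"
  have [measurable]: "\<psi> n \<in> borel_measurable ?M" "D n \<in> borel_measurable ?M"
      "w \<in> borel_measurable ?M" "G \<in> borel_measurable ?M" for n
    using L by (auto simp: L2_converges_def)
  have [measurable]: "(\<lambda>y. y) \<in> borel_measurable ?M"
    by (rule borel_measurable_lebesgue_on) simp
  have sp: "1 < norm y \<and> norm y < R" if "y \<in> space ?M" for y
    using that by (auto simp: space_restrict_space)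
  have b: "1 \<le> (norm y)\<^sup>2 \<and> (norm y)\<^sup>2 \<le> R\<^sup>2" if "y \<in> space ?M" for y
    using sp[OF that] power_mono[of 1 "norm y" 2] power_mono[of "norm y" R 2] by auto
  have "L2_converges ?M (\<lambda>n y. ?k y * (y \<bullet> D n y)) (\<lambda>y. ?k y * (y \<bullet> G y))"
  proof (rule L2_converges_lipschitz[OF L(2), where T = "\<lambda>y a. ?k y * (y \<bullet> a)" and C = "2 * R\<^sup>2 * R"])
    fix y a b :: 'a assume y: "y \<in> space ?M"
    have "norm (?k y * (y \<bullet> a) - ?k y * (y \<bullet> b)) = ?k y * \<bar>y \<bullet> (a - b)\<bar>"
      using b[OF y] by (simp add: abs_mult inner_diff_right flip: right_diff_distrib)
    also have "\<dots> \<le> (2 * R\<^sup>2) * (R * norm (a - b))"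
    proof (rule mult_mono)
      have "\<bar>y \<bullet> (a - b)\<bar> \<le> norm y * norm (a - b)" by (rule Cauchy_Schwarz_ineq2)
      also have "\<dots> \<le> R * norm (a - b)" using sp[OF y] by (intro mult_right_mono) auto
      finally show "\<bar>y \<bullet> (a - b)\<bar> \<le> R * norm (a - b)" .
    qed (use b[OF y] in auto)
    finally show "norm (?k y * (y \<bullet> a) - ?k y * (y \<bullet> b)) \<le> 2 * R\<^sup>2 * R * norm (a - b)"
      by (simp only: mult.assoc)
  qed measurable
  moreover have "L2_converges ?M (\<lambda>n y. ?m y * \<psi> n y) (\<lambda>y. ?m y * w y)"
  proof (rule L2_converges_lipschitz[OF L(1), where T = "\<lambda>y a. ?m y * a" and C = "real DIM('a) * R\<^sup>2 + 2 * R\<^sup>2"])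
    fix y :: 'a and a b :: real assume y: "y \<in> space ?M"
    have "norm (?m y * a - ?m y * b)
      = ?m y * \<bar>a - b\<bar>"
      using b[OF y] by (simp add: abs_mult flip: right_diff_distrib)
    also have "\<dots> \<le> (real DIM('a) * R\<^sup>2 + 2 * R\<^sup>2) * \<bar>a - b\<bar>"
      using b[OF y] by (intro mult_right_mono add_mono mult_left_mono) auto
    finally show "norm (?m y * a - ?m y * b)
      \<le> (real DIM('a) * R\<^sup>2 + 2 * R\<^sup>2) * norm (a - b)" by simp
  qed measurable
  ultimately show ?thesis
    unfolding trace_density_def by (rule L2_converges_add)
qed

lemma integrable_trace_density_smooth:
  fixes \<psi> :: "'a::euclidean_space \<Rightarrow> real"
  assumes "smooth \<psi>"
  shows "integrable (lebesgue_on (annulus R)) (\<lambda>y. (norm (trace_density \<psi> (grad \<psi>) y))\<^sup>2)"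
  unfolding trace_density_def
  by (rule integrable_annulus, intro continuous_intros smooth_continuous_on smooth_grad_continuous_on assms)

text \<open>The right-hand side does not mention the sequence. Hence the integral of the squared trace is the same for every
sequence that may have been used to define the trace.\<close>

lemma trace_limit:
  fixes w :: "'a::euclidean_space \<Rightarrow> real"
  assumes R: "R > 1" and s: "\<And>n. smooth (\<psi> n)"
    and L: "L2_converges (lebesgue_on (annulus R)) \<psi> w" "L2_converges (lebesgue_on (annulus R)) (\<lambda>n. grad (\<psi> n)) G"
    and g: "L2_converges (sphere_measure R) \<psi> g"
  shows "R * (R\<^sup>2 - 1) * (\<integral>y. (g y)\<^sup>2 \<partial>sphere_measure R) = (\<integral>y. w y * trace_density w G y \<partial>lebesgue_on (annulus R))"
proof -
  have "integrable (sphere_measure R) (\<lambda>y. (norm (\<psi> n y))\<^sup>2)" for n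
    using R by (intro integrable_sphere_measure continuous_intros smooth_continuous[OF s]) auto
  from L2_converges_norm(2)[OF g this]
  have "(\<lambda>n. R * (R\<^sup>2 - 1) * (\<integral>y. (\<psi> n y)\<^sup>2 \<partial>sphere_measure R)) \<longlonglongrightarrow> R * (R\<^sup>2 - 1) * (\<integral>y. (g y)\<^sup>2 \<partial>sphere_measure R)"
    by (intro tendsto_intros) simp
  moreover have "(\<lambda>n. R * (R\<^sup>2 - 1) * (\<integral>y. (\<psi> n y)\<^sup>2 \<partial>sphere_measure R)) \<longlonglongrightarrow> (\<integral>y. w y * trace_density w G y \<partial>lebesgue_on (annulus R))"
    using L2_converges_inner[OF L(1) L2_converges_trace_density[OF R L] integrable_annulus_smooth(1)[OF s] integrable_trace_density_smooth[OF s]]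
    unfolding sphere_integral_squared[OF R s] by (simp add: trace_density_def)
  ultimately show ?thesis by (rule LIMSEQ_unique)
qed

text \<open>By \<open>sphere_integral_squared\<close> for differences \<open>\<eta> = \<psi> m - \<psi> n\<close>, a square integral over the sphere is at most the
sum of the squared norms of \<open>\<eta>\<close> and of its trace density, and both sequences are Cauchy on the annulus.\<close>

lemma trace_exists:
  fixes w :: "'a::euclidean_space \<Rightarrow> real"
  assumes R: "R > 1" and s: "\<And>n. smooth (\<psi> n)"
    and L: "L2_converges (lebesgue_on (annulus R)) \<psi> w" "L2_converges (lebesgue_on (annulus R)) (\<lambda>n. grad (\<psi> n)) G"
  shows "\<exists>g. L2_converges (sphere_measure R) \<psi> g"
proof (rule L2_complete)
  let ?M = "lebesgue_on (annulus R :: 'a set)"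
  show "\<psi> n \<in> borel_measurable (sphere_measure R)" for n
    using smooth_borel(1)[OF s] by (simp add: sphere_measure_def)
  fix e :: real assume e: "e > 0"
  define C where "C = R * (R\<^sup>2 - 1)"
  have C: "C > 0" using R by (simp add: C_def one_less_power)
  define F where "F n = trace_density (\<psi> n) (grad (\<psi> n))" for n
  have LF: "L2_converges ?M F (trace_density w G)"
    unfolding F_def by (rule L2_converges_trace_density[OF R L])
  have Ce: "C * e / 2 > 0" using C e by simp
  obtain N1 where N1: "L2sq ?M (\<lambda>x. \<psi> m x - \<psi> n x) \<le> ennreal (C * e / 2)" if "m \<ge> N1" "n \<ge> N1" for m n
    using L2_converges_Cauchy[OF L(1) Ce] by blast
  obtain N2 where N2: "L2sq ?M (\<lambda>x. F m x - F n x) \<le> ennreal (C * e / 2)" if "m \<ge> N2" "n \<ge> N2" for m n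
    using L2_converges_Cauchy[OF LF Ce] by blast
  show "\<exists>N. \<forall>m\<ge>N. \<forall>n\<ge>N. L2sq (sphere_measure R) (\<lambda>x. \<psi> m x - \<psi> n x) \<le> ennreal e"
  proof (intro exI[of _ "max N1 N2"] allI impI)
    fix m n assume "max N1 N2 \<le> m" "max N1 N2 \<le> n"
    then have mn: "m \<ge> N1" "n \<ge> N1" "m \<ge> N2" "n \<ge> N2" by auto
    define \<eta> where "\<eta> x = \<psi> m x - \<psi> n x" for x
    have s': "smooth \<eta>" unfolding \<eta>_def by (rule smooth_diff[OF s s])
    have F': "trace_density \<eta> (grad \<eta>) x = F m x - F n x" for x
      unfolding F_def trace_density_def \<eta>_def grad_diff[OF s s]
      by (simp add: algebra_simps inner_diff_right)
    have i1: "integrable ?M (\<lambda>x. (norm (\<eta> x))\<^sup>2)"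
      by (rule integrable_annulus_smooth(1)[OF s'])
    have i2: "integrable ?M (\<lambda>x. (norm (F m x - F n x))\<^sup>2)"
      using integrable_trace_density_smooth[OF s'] unfolding F' .
    have "(\<integral>x. (norm (\<eta> x))\<^sup>2 \<partial>?M) \<le> C * e / 2"
      using N1[OF mn(1,2)] nn_integral_eq_integral[OF i1] Ce by (simp add: \<eta>_def)
    moreover have "(\<integral>x. (norm (F m x - F n x))\<^sup>2 \<partial>?M) \<le> C * e / 2"
      using N2[OF mn(3,4)] nn_integral_eq_integral[OF i2] Ce by simp
    moreover have "C * (\<integral>y. (\<eta> y)\<^sup>2 \<partial>sphere_measure R) = (\<integral>x. \<eta> x * (F m x - F n x) \<partial>?M)"
      unfolding C_def sphere_integral_squared[OF R s'] F'[symmetric] trace_density_def ..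
    moreover have "(\<integral>x. \<eta> x * (F m x - F n x) \<partial>?M) \<le> (\<integral>x. (norm (\<eta> x))\<^sup>2 + (norm (F m x - F n x))\<^sup>2 \<partial>?M)"
    proof (rule integral_mono)
      have "continuous_on (- {0}) (\<lambda>x. \<eta> x * trace_density \<eta> (grad \<eta>) x)"
        using continuous_on_subset[OF smooth_continuous[OF s'] subset_UNIV] 
          continuous_on_subset[OF smooth_grad_continuous[OF s'] subset_UNIV]
        unfolding trace_density_def by (intro continuous_intros)
      from integrable_annulus(1)[OF this, of R]
      show "integrable ?M (\<lambda>x. \<eta> x * (F m x - F n x))"
        unfolding F' .
      show "integrable ?M (\<lambda>x. (norm (\<eta> x))\<^sup>2 + (norm (F m x - F n x))\<^sup>2)"
        using i1 i2 by simp
      show "a * b \<le> (norm a)\<^sup>2 + (norm b)\<^sup>2" for a b :: real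
        using zero_le_power2[of "a - b"] zero_le_power2[of a] zero_le_power2[of b]
        unfolding power2_diff real_norm_def power2_abs by linarith
    qed
    moreover have "(\<integral>x. (norm (\<eta> x))\<^sup>2 + (norm (F m x - F n x))\<^sup>2 \<partial>?M)
        = (\<integral>x. (norm (\<eta> x))\<^sup>2 \<partial>?M) + (\<integral>x. (norm (F m x - F n x))\<^sup>2 \<partial>?M)"
      using i1 i2 by (rule Bochner_Integration.integral_add)
    ultimately have "C * (\<integral>y. (\<eta> y)\<^sup>2 \<partial>sphere_measure R) \<le> C * e" by linarith
    then have "(\<integral>y. (\<eta> y)\<^sup>2 \<partial>sphere_measure R) \<le> e" using C by simp
    moreover have "integrable (sphere_measure R) (\<lambda>y. (\<eta> y)\<^sup>2)"
      using R by (intro integrable_sphere_measure continuous_intros smooth_continuous[OF s']) auto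
    ultimately show "L2sq (sphere_measure R) (\<lambda>x. \<psi> m x - \<psi> n x) \<le> ennreal e"
      using nn_integral_eq_integral[of "sphere_measure R" "\<lambda>y. (\<eta> y)\<^sup>2"] e by (simp add: \<eta>_def)
  qed
qed

section \<open>The Kelvin transform of test functions\<close>

text \<open>With \<open>v = |x|^c f\<close> and \<open>c = (N - 2) / 2\<close> this is \<open>|x|^(-c) \<nabla>v\<close>, in a form that is defined for \<open>f\<close> directly
and linear in it.\<close>

definition hardy_grad :: "('a::euclidean_space \<Rightarrow> real) \<Rightarrow> 'a \<Rightarrow> 'a" where
  "hardy_grad f x = grad f x + ((real DIM('a) - 2) / 2 * f x) *\<^sub>R inversion x"

text \<open>In this form the Kelvin transform is visibly its own inverse, so the same function is used in both directions.\<close>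

lemma kelvin_eq:
  fixes f :: "'a::euclidean_space \<Rightarrow> real"
  shows "kelvin f y = inverse (norm y ^ (DIM('a) - 2)) * f (inversion y)"
  by (simp add: kelvin_def norm_inversion power_inverse flip: inversion_def)

lemma test_function_support:
  fixes \<phi> :: "'a::euclidean_space \<Rightarrow> real"
  assumes "\<phi> \<in> test_functions (ball 0 1)"
  obtains \<delta> where "0 < \<delta>" "\<delta> < 1" "\<And>x. norm x \<ge> \<delta> \<Longrightarrow> \<phi> x = 0"
proof -
  let ?S = "closure {x. \<phi> x \<noteq> 0}"
  have S: "compact ?S" "?S \<subseteq> ball 0 1" using assms by (auto simp: test_functions_def)
  have sub: "x \<in> ?S" if "\<phi> x \<noteq> 0" for x
    using closure_subset[of "{x. \<phi> x \<noteq> 0}"] that by auto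
  show thesis
  proof (cases "?S = {}")
    case True
    then show ?thesis using sub that[of "1/2"] by force
  next
    case False
    obtain x0 where x0: "x0 \<in> ?S" "\<And>x. x \<in> ?S \<Longrightarrow> norm x \<le> norm x0"
      using continuous_attains_sup[OF S(1) False, of norm] by (auto intro: continuous_intros)
    define \<delta> where "\<delta> = (norm x0 + 1) / 2"
    have "norm x0 < 1" using x0 S by auto
    then have \<delta>: "0 < \<delta>" "\<delta> < 1" "norm x0 < \<delta>"
      unfolding \<delta>_def by (simp_all add: add_nonneg_pos)
    have "\<phi> x = 0" if "norm x \<ge> \<delta>" for x
      using x0(2)[OF sub, of x] that \<delta> by (cases "\<phi> x = 0") auto
    then show ?thesis using that \<delta> by blast
  qed
qed

lemma test_function_smooth: "\<phi> \<in> test_functions \<Omega> \<Longrightarrow> smooth \<phi>"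
  by (simp add: test_functions_def)

lemma test_function_diff:
  assumes "\<phi> \<in> test_functions \<Omega>" "\<psi> \<in> test_functions \<Omega>"
  shows "(\<lambda>x. \<phi> x - \<psi> x) \<in> test_functions \<Omega>"
proof -
  have sub: "closure {x. \<phi> x - \<psi> x \<noteq> 0} \<subseteq> closure {x. \<phi> x \<noteq> 0} \<union> closure {x. \<psi> x \<noteq> 0}"
    unfolding closure_Un[symmetric] by (rule closure_mono) auto
  have "compact (closure {x. \<phi> x - \<psi> x \<noteq> 0})"
    using compact_Int_closed[of "closure {x. \<phi> x \<noteq> 0} \<union> closure {x. \<psi> x \<noteq> 0}" "closure {x. \<phi> x - \<psi> x \<noteq> 0}"]
      assms unfolding Int_absorb1[OF sub] by (simp add: test_functions_def compact_Un)
  then show ?thesis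
    using assms sub smooth_diff by (auto simp: test_functions_def)
qed

lemma kelvin_eq_0:
  fixes \<phi> :: "'a::euclidean_space \<Rightarrow> real"
  assumes N: "DIM('a) \<ge> 3" and "\<phi> \<in> test_functions (ball 0 1)"
  obtains \<rho> where "\<rho> > 1" "\<And>y. norm y \<le> \<rho> \<Longrightarrow> kelvin \<phi> y = 0"
proof -
  obtain \<delta> where \<delta>: "0 < \<delta>" "\<delta> < 1" "\<And>x. norm x \<ge> \<delta> \<Longrightarrow> \<phi> x = 0"
    using test_function_support[OF assms(2)] by blast
  have "kelvin \<phi> y = 0" if "norm y \<le> inverse \<delta>" for y
  proof (cases "y = 0")
    case True
    then show ?thesis using N by (simp add: kelvin_eq)
  next
    case False
    then have "norm (inversion y) \<ge> \<delta>"
      using le_imp_inverse_le[OF that] by (simp add: norm_inversion)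
    then show ?thesis by (simp add: kelvin_eq \<delta>)
  qed
  moreover have "inverse \<delta> > 1" using \<delta> by (simp add: one_less_inverse)
  ultimately show thesis using that by blast
qed

text \<open>The transform is smooth away from the origin and vanishes near the origin because \<open>\<phi>\<close> vanishes near the unit
sphere and beyond.\<close>

lemma smooth_kelvin:
  fixes \<phi> :: "'a::euclidean_space \<Rightarrow> real"
  assumes N: "DIM('a) \<ge> 3" and \<phi>: "\<phi> \<in> test_functions (ball 0 1)"
  shows "smooth (kelvin \<phi>)"
proof -
  have o: "open (- {0::'a})" by auto
  have inv: "smooth_on (- {0::'a}) (\<lambda>y. inversion y \<bullet> j)" for j :: 'a
    unfolding inversion_def inner_scaleR_left
    by (intro smooth_on_mult o smooth_on_inverse_norm_power smooth_on_inner)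
  have 1: "smooth_on (- {0}) (kelvin \<phi>)"
    unfolding kelvin_eq
    by (rule smooth_on_mult[OF o smooth_on_inverse_norm_power smooth_on_compose[OF o test_function_smooth[OF \<phi>] inv]])
  obtain \<rho> where \<rho>: "\<rho> > 1" "\<And>y. norm y \<le> \<rho> \<Longrightarrow> kelvin \<phi> y = 0"
    using kelvin_eq_0[OF assms] by blast
  have "C_k_on k (ball 0 1) (kelvin \<phi>)" for k
    by (rule C_k_on_cong[OF _ _ C_k_on_const[of _ _ 0]]) (use \<rho> in auto)
  then have "C_k_on k (- {0} \<union> ball 0 1) (kelvin \<phi>)" for k
    using 1 by (intro C_k_on_Un) (auto simp: smooth_on_def)
  moreover have "- {0} \<union> ball 0 1 = (UNIV :: 'a set)" by auto
  ultimately show ?thesis by (simp add: smooth_def)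
qed

lemma kelvin_diff: "kelvin (\<lambda>x. f x - g x) = (\<lambda>y. kelvin f y - kelvin g y)"
  by (auto simp: kelvin_eq algebra_simps)

lemma hardy_grad_diff:
  assumes "smooth f" "smooth g"
  shows "hardy_grad (\<lambda>x. f x - g x) x = hardy_grad f x - hardy_grad g x"
  by (simp only: hardy_grad_def grad_diff[OF assms] right_diff_distrib scaleR_diff_left) simp

text \<open>The derivative of the inversion is \<open>1/|y|\<^sup>2\<close> times a reflection. The reflection carries \<open>A \<phi>\<close> at \<open>y*\<close> to
\<open>A\<close> of the transform, up to powers of \<open>|y|\<close>; the terms with \<open>\<phi>\<close> change sign under it, which matches the
derivative of the factor in front of \<open>\<phi>(y*)\<close>.\<close>

lemma norm_hardy_grad_kelvin:
  fixes \<phi> :: "'a::euclidean_space \<Rightarrow> real"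
  assumes N: "DIM('a) \<ge> 2" and s: "smooth \<phi>" and y: "y \<noteq> 0"
  shows "(norm (hardy_grad (kelvin \<phi>) y))\<^sup>2 = inverse (norm y ^ (2 * DIM('a))) * (norm (hardy_grad \<phi> (inversion y)))\<^sup>2"
proof -
  obtain m where m: "DIM('a) = m + 2" using N by (metis add.commute le_Suc_ex)
  define p where "p = grad \<phi> (inversion y)"
  define t where "t = \<phi> (inversion y)"
  define i where "i = inverse (norm y ^ 2)"
  define q where "q = inverse (norm y ^ m)"
  have yi: "(y \<bullet> y) * i = 1" using y by (simp add: i_def dot_square_norm)
  have dinv: "(inversion has_derivative (\<lambda>h. i *\<^sub>R h - (2 * (h \<bullet> y) * i * i) *\<^sub>R y)) (at y)"
  proof -
    have "((\<lambda>y. inverse (norm y ^ 2) *\<^sub>R y) has_derivative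
       (\<lambda>h. inverse (norm y ^ 2) *\<^sub>R h + (- real 2 * (h \<bullet> y) * inverse (norm y ^ 2) * inverse (norm y ^ 2)) *\<^sub>R y)) (at y)"
      by (intro has_derivative_scaleR has_derivative_inverse_norm_power y has_derivative_ident)
    then show ?thesis unfolding inversion_def[abs_def] i_def by simp
  qed
  \<comment> \<open>The gradient of the transform.\<close>
  define A where "A = (q * i) *\<^sub>R p - (2 * q * i * i * (y \<bullet> p) + m * q * i * t) *\<^sub>R y"
  have "((\<lambda>y. inverse (norm y ^ m) * \<phi> (inversion y)) has_derivative
     (\<lambda>h. q * (p \<bullet> (i *\<^sub>R h - (2 * (h \<bullet> y) * i * i) *\<^sub>R y)) + (- real m * (h \<bullet> y) * q * i) * t)) (at y)"
    unfolding q_def p_def t_def i_def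
    by (intro has_derivative_mult has_derivative_inverse_norm_power y
        has_derivative_compose[OF dinv[unfolded i_def] smooth_has_derivative[OF s]])
  moreover have "q * (p \<bullet> (i *\<^sub>R h - (2 * (h \<bullet> y) * i * i) *\<^sub>R y)) + (- real m * (h \<bullet> y) * q * i) * t = A \<bullet> h" for h
    by (simp add: A_def inner_diff_left inner_diff_right inner_commute algebra_simps)
  ultimately have "(kelvin \<phi> has_derivative (\<lambda>h. A \<bullet> h)) (at y)"
    unfolding kelvin_eq[abs_def] m by simp
  then have "grad (kelvin \<phi>) y = A" by (rule grad_eqI)
  then have "hardy_grad (kelvin \<phi>) y = A + ((m / 2) * (q * t)) *\<^sub>R (i *\<^sub>R y)"
    by (simp add: hardy_grad_def kelvin_eq m q_def t_def inversion_def i_def)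
  also have "\<dots> = (q * i) *\<^sub>R (p - (2 * i * (y \<bullet> p) + m / 2 * t) *\<^sub>R y)"
  proof -
    have "(2 * q * i * i * (y \<bullet> p) + m * q * i * t) *\<^sub>R y
      = ((q * i) * (2 * i * (y \<bullet> p) + m / 2 * t)) *\<^sub>R y + ((m / 2) * (q * t)) *\<^sub>R (i *\<^sub>R y)"
      unfolding scaleR_scaleR scaleR_add_left[symmetric]
      by (rule arg_cong[where f = "\<lambda>c. c *\<^sub>R y"]) (simp add: algebra_simps)
    then show ?thesis
      by (simp add: A_def scaleR_diff_right)
  qed
  finally have 1: "hardy_grad (kelvin \<phi>) y = (q * i) *\<^sub>R (p - (2 * i * (y \<bullet> p) + m / 2 * t) *\<^sub>R y)" .
  have 2: "hardy_grad \<phi> (inversion y) = p + (m / 2 * t) *\<^sub>R y"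
    by (simp add: hardy_grad_def p_def t_def m)
  define s where "s = m / 2 * t"
  define a where "a = y \<bullet> p"
  define Y where "Y = y \<bullet> y"
  have Yi: "Y * i = 1" using yi by (simp add: Y_def)
  have "(norm (p - k *\<^sub>R y))\<^sup>2 = p \<bullet> p - 2 * k * a + k\<^sup>2 * Y" for k
    unfolding power2_norm_eq_inner a_def Y_def
    by (simp add: inner_diff_left inner_diff_right inner_commute algebra_simps power2_eq_square)
  then have "(norm (p - (2 * i * a + s) *\<^sub>R y))\<^sup>2 = p \<bullet> p - 2 * (2 * i * a + s) * a + (2 * i * a + s)\<^sup>2 * Y" .
  also have "\<dots> = p \<bullet> p - 2 * (2 * i * a + s) * a + 4 * i * a * a * (Y * i) + 4 * a * s * (Y * i) + s * s * Y"
    by (simp add: algebra_simps power2_eq_square)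
  also have "\<dots> = p \<bullet> p + 2 * s * a + s * s * Y"
    unfolding Yi by (simp add: algebra_simps)
  also have "\<dots> = (norm (p + s *\<^sub>R y))\<^sup>2"
    by (simp add: power2_norm_eq_inner inner_add_left inner_add_right a_def Y_def inner_commute algebra_simps)
  finally have 3: "(norm (p - (2 * i * a + s) *\<^sub>R y))\<^sup>2 = (norm (p + s *\<^sub>R y))\<^sup>2" .
  have "(q * i)\<^sup>2 = inverse (norm y ^ (2 * DIM('a)))"
    unfolding q_def i_def m by (simp add: power_mult power_add power_mult_distrib mult_2 algebra_simps power2_eq_square flip: power_inverse)
  then show ?thesis
    unfolding 1 2 using 3 by (simp add: power_mult_distrib a_def s_def)
qed

lemma norm_grad_eq_hardy_grad:
  fixes \<phi> :: "'a::euclidean_space \<Rightarrow> real"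
  assumes "x \<noteq> 0"
  defines "c \<equiv> (real DIM('a) - 2) / 2"
  shows "(norm (hardy_grad \<phi> x))\<^sup>2 = (norm (grad \<phi> x))\<^sup>2 - c\<^sup>2 * ((\<phi> x)\<^sup>2 / (norm x)\<^sup>2)
     + c * (\<phi> x * (2 * (inversion x \<bullet> grad \<phi> x) + (real DIM('a) - 2) * (\<phi> x / (norm x)\<^sup>2)))"
proof -
  have "inversion x \<bullet> inversion x = 1 / (norm x)\<^sup>2"
    by (simp add: dot_square_norm norm_inversion inverse_eq_divide power_divide)
  then have "(norm (hardy_grad \<phi> x))\<^sup>2 = (norm (grad \<phi> x))\<^sup>2 + 2 * c * \<phi> x * (inversion x \<bullet> grad \<phi> x) + (c * \<phi> x)\<^sup>2 * (1 / (norm x)\<^sup>2)"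
    unfolding hardy_grad_def c_def[symmetric] power2_norm_eq_inner
    by (simp add: inner_add_left inner_add_right inner_commute power2_eq_square algebra_simps)
  moreover have "real DIM('a) - 2 = 2 * c" by (simp add: c_def)
  ultimately show ?thesis
    by (simp add: algebra_simps power2_eq_square)
qed

lemma null_sets_inversion:
  assumes "A \<in> null_sets (lborel :: 'a::euclidean_space measure)"
  shows "inversion -` A \<in> null_sets (lborel :: 'a measure)"
proof -
  have [measurable]: "A \<in> sets borel" using assms by auto
  have m: "inversion -` A \<in> sets (lborel :: 'a measure)"
    using measurable_sets[OF borel_measurable_inversion, of A] by simp
  have "emeasure lborel (inversion -` A) = (\<integral>\<^sup>+y. indicator A (inversion y) \<partial>lborel)"
    using m by (simp add: nn_integral_indicator[symmetric] indicator_def del: nn_integral_indicator)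
  also have "\<dots> = (\<integral>\<^sup>+x. ennreal (inverse (norm x ^ (2 * DIM('a)))) * indicator A x \<partial>lborel)"
    by (subst nn_integral_inversion) auto
  also have "\<dots> = 0"
    using assms by (subst nn_integral_0_iff_AE) (auto intro!: eventually_mono[OF AE_not_in[OF assms]])
  finally show ?thesis using m by auto
qed

lemma AE_inversion:
  assumes "AE x::'a::euclidean_space in lborel. P x"
  shows "AE y in lborel. P (inversion y)"
proof -
  obtain A where "{x. \<not> P x} \<subseteq> A" "A \<in> null_sets lborel"
    using assms by (auto simp: eventually_ae_filter)
  then show ?thesis
    using null_sets_inversion[of A] by (intro AE_I'[of "inversion -` A"]) auto
qed

text \<open>Inversion preserves null sets by the change of variables formula, so Lebesgue measurability survives composition;
this makes \<open>w\<close> measurable when its Kelvin transform is.\<close>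

lemma measurable_inversion_lebesgue: "(inversion :: 'a::euclidean_space \<Rightarrow> 'a) \<in> lebesgue \<rightarrow>\<^sub>M lebesgue"
proof (rule completion.measurable_completion2)
  show m: "(inversion :: 'a \<Rightarrow> 'a) \<in> lebesgue \<rightarrow>\<^sub>M lborel"
    by (intro measurable_completion) simp
  show "null_sets lborel \<subseteq> null_sets (distr lebesgue lborel (inversion :: 'a \<Rightarrow> 'a))"
  proof
    fix A :: "'a set" assume A: "A \<in> null_sets lborel"
    from null_sets_completionI[OF null_sets_inversion[OF A]]
    show "A \<in> null_sets (distr lebesgue lborel inversion)"
      using A m by (auto simp: null_sets_def emeasure_distr)
  qed
qed

lemma nn_integral_inversion_lebesgue:
  fixes f :: "'a::euclidean_space \<Rightarrow> ennreal"
  assumes "f \<in> borel_measurable lebesgue"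
  shows "(\<integral>\<^sup>+y. f y \<partial>lebesgue) = (\<integral>\<^sup>+x. ennreal (inverse (norm x ^ (2 * DIM('a)))) * f (inversion x) \<partial>lebesgue)"
proof -
  obtain f' where f': "f' \<in> borel_measurable lborel" "AE x in lborel. f x = f' x"
    using completion_ex_borel_measurable[OF assms] by blast
  have "(\<integral>\<^sup>+y. f y \<partial>lebesgue) = (\<integral>\<^sup>+y. f' y \<partial>lborel)"
    unfolding nn_integral_completion by (rule nn_integral_cong_AE[OF f'(2)])
  also have "\<dots> = (\<integral>\<^sup>+x. ennreal (inverse (norm x ^ (2 * DIM('a)))) * f' (inversion x) \<partial>lborel)"
    using f'(1) by (intro nn_integral_inversion) simp
  also have "\<dots> = (\<integral>\<^sup>+x. ennreal (inverse (norm x ^ (2 * DIM('a)))) * f (inversion x) \<partial>lebesgue)"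
    unfolding nn_integral_completion
    by (rule nn_integral_cong_AE) (use AE_inversion[OF f'(2)] in \<open>auto elim!: eventually_mono\<close>)
  finally show ?thesis .
qed

text \<open>On \<open>1/R < |x| < 1\<close> the weight that inversion produces is at most \<open>R^4\<close>; it is unbounded near the origin, which
is why the convergence is local.\<close>

lemma L2_converges_kelvin:
  fixes w :: "'a::euclidean_space \<Rightarrow> real"
  assumes N: "DIM('a) \<ge> 3" and R: "R > 1"
    and L: "L2_converges (lebesgue_on (ball 0 1)) \<phi> (kelvin w)"
    and s: "\<And>n. \<phi> n \<in> test_functions (ball 0 1)"
  shows "w \<in> borel_measurable (lebesgue_on (- cball 0 1))"
    and "L2_converges (lebesgue_on (annulus R)) (\<lambda>n. kelvin (\<phi> n)) w"
proof -
  let ?N = "DIM('a)" and ?u = "\<lambda>x::'a. indicator (ball 0 1) x * kelvin w x"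
  let ?d = "\<lambda>n x. ennreal ((norm (\<phi> n x - kelvin w x))\<^sup>2) * indicator (ball 0 1) x"
  have u[measurable]: "?u \<in> borel_measurable lebesgue"
    using L by (subst (asm) L2_converges_def) (simp add: borel_measurable_restrict_space_iff)
  have w: "w y = inverse (norm y ^ (?N - 2)) * ?u (inversion y)" if "1 < norm y" for y
  proof -
    have "norm (inversion y) < 1" using that by (simp add: norm_inversion inverse_less_1_iff)
    moreover have "y \<noteq> 0" using that by auto
    ultimately show ?thesis
      by (simp add: kelvin_def flip: inversion_def)
  qed
  have uinv: "(\<lambda>y. inverse (norm y ^ (?N - 2)) * ?u (inversion y)) \<in> borel_measurable lebesgue"
    by (rule borel_measurable_times[OF measurable_completion measurable_compose[OF measurable_inversion_lebesgue u]]) simp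
  show wm: "w \<in> borel_measurable (lebesgue_on (- cball 0 1))"
    using measurable_restrict_space1[OF uinv]
    by (rule measurable_cong[THEN iffD1, rotated]) (use w in \<open>auto simp: space_restrict_space\<close>)
  then have wm': "w \<in> borel_measurable (lebesgue_on (annulus R))"
    by (rule measurable_restrict_mono) auto
  have em: "kelvin (\<phi> n) \<in> borel_measurable borel" for n
    by (rule smooth_borel(1)[OF smooth_kelvin[OF N s]])
  have le: "L2sq (lebesgue_on (annulus R)) (\<lambda>y. kelvin (\<phi> n) y - w y)
    \<le> ennreal (R ^ 4) * L2sq (lebesgue_on (ball 0 1)) (\<lambda>x. \<phi> n x - kelvin w x)" for n
  proof -
    have pm[measurable]: "\<phi> n \<in> borel_measurable lebesgue"
      using borel_measurable_continuous_onI[OF smooth_continuous[OF test_function_smooth[OF s]], of n]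
      by (intro measurable_completion) simp
    define F where "F y = ennreal (inverse (norm y ^ (2 * (?N - 2))) * (\<phi> n (inversion y) - ?u (inversion y))\<^sup>2) * indicator (annulus R) y" for y
    have "(\<lambda>y. \<phi> n (inversion y) - ?u (inversion y)) \<in> borel_measurable lebesgue"
      by (intro borel_measurable_diff measurable_compose[OF measurable_inversion_lebesgue] u pm)
    moreover have "annulus R \<in> sets (lebesgue :: 'a measure)" by auto
    moreover have "(\<lambda>y::'a. inverse (norm y ^ (2 * (?N - 2)))) \<in> borel_measurable lebesgue"
      by (intro measurable_completion) simp
    ultimately have Fm: "F \<in> borel_measurable lebesgue"
      unfolding F_def by (intro borel_measurable_times_ennreal borel_measurable_indicator measurable_compose[OF _ measurable_ennreal] borel_measurable_times borel_measurable_power)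
    have "L2sq (lebesgue_on (annulus R)) (\<lambda>y. kelvin (\<phi> n) y - w y) = (\<integral>\<^sup>+y. F y \<partial>lebesgue)"
    proof (subst nn_integral_restrict_space)
      show "annulus R \<inter> space lebesgue \<in> sets (lebesgue :: 'a measure)" by auto
      have "kelvin (\<phi> n) y - w y = inverse (norm y ^ (?N - 2)) * (\<phi> n (inversion y) - ?u (inversion y))" if "y \<in> annulus R" for y
        using that w[of y] by (simp add: kelvin_eq[of "\<phi> n"] algebra_simps)
      then show "(\<integral>\<^sup>+y. ennreal ((norm (kelvin (\<phi> n) y - w y))\<^sup>2) * indicator (annulus R) y \<partial>lebesgue) = (\<integral>\<^sup>+y. F y \<partial>lebesgue)"
        by (intro nn_integral_cong) (auto simp: F_def indicator_def power_mult_distrib power_mult[symmetric] mult.commute simp flip: power_inverse)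
    qed
    also have "\<dots> = (\<integral>\<^sup>+x. ennreal (inverse (norm x ^ (2 * ?N))) * F (inversion x) \<partial>lebesgue)"
      by (rule nn_integral_inversion_lebesgue[OF Fm])
    also have "\<dots> \<le> (\<integral>\<^sup>+x. ennreal (R ^ 4) * (?d n x) \<partial>lebesgue)"
    proof (rule nn_integral_mono)
      fix x :: 'a
      show "ennreal (inverse (norm x ^ (2 * ?N))) * F (inversion x) \<le> ennreal (R ^ 4) * (?d n x)"
      proof (cases "inversion x \<in> annulus R")
        case True
        then have x: "norm x > 0" "norm x < 1" "inverse (norm x) < R"
          by (auto simp: norm_inversion one_less_inverse_iff not_le)
        have "inverse (norm x ^ (2 * ?N)) * inverse (norm (inversion x) ^ (2 * (?N - 2))) = inverse (norm x) ^ 4"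
        proof -
          have "2 * ?N = 4 + 2 * (?N - 2)" using N by simp
          then have "norm x ^ (2 * ?N) = norm x ^ 4 * norm x ^ (2 * (?N - 2))" by (simp only: power_add)
          then show ?thesis using x by (simp add: norm_inversion power_inverse)
        qed
        also have "\<dots> \<le> R ^ 4" using x by (intro power_mono) auto
        finally have "inverse (norm x ^ (2 * ?N)) * inverse (norm (inversion x) ^ (2 * (?N - 2))) * (\<phi> n x - kelvin w x)\<^sup>2 \<le> R ^ 4 * (\<phi> n x - kelvin w x)\<^sup>2"
          by (rule mult_right_mono) simp
        then have "ennreal (inverse (norm x ^ (2 * ?N)) * (inverse (norm (inversion x) ^ (2 * (?N - 2))) * (\<phi> n x - kelvin w x)\<^sup>2)) \<le> ennreal (R ^ 4 * (\<phi> n x - kelvin w x)\<^sup>2)"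
          by (intro ennreal_leI) (simp only: mult.assoc)
        then show ?thesis
          using True x R by (simp add: F_def ennreal_mult)
      qed (simp add: F_def)
    qed
    also have "\<dots> = ennreal (R ^ 4) * (\<integral>\<^sup>+x. ?d n x \<partial>lebesgue)"
    proof (rule nn_integral_cmult)
      have "(\<lambda>x. ennreal ((norm (\<phi> n x - ?u x))\<^sup>2) * indicator (ball 0 1) x) \<in> borel_measurable lebesgue"
        by (intro borel_measurable_times_ennreal borel_measurable_indicator measurable_compose[OF _ measurable_ennreal]
            borel_measurable_power borel_measurable_norm borel_measurable_diff pm u) auto
      moreover have "(\<lambda>x. ennreal ((norm (\<phi> n x - ?u x))\<^sup>2) * indicator (ball 0 1) x) = (\<lambda>x. ?d n x)"
        by (auto simp: indicator_def)
      ultimately show "(\<lambda>x. ?d n x) \<in> borel_measurable lebesgue"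
        by simp
    qed
    also have "\<dots> = ennreal (R ^ 4) * L2sq (lebesgue_on (ball 0 1)) (\<lambda>x. \<phi> n x - kelvin w x)"
      by (subst nn_integral_restrict_space) auto
    finally show ?thesis .
  qed
  have "(\<lambda>n. ennreal (R ^ 4) * L2sq (lebesgue_on (ball 0 1)) (\<lambda>x. \<phi> n x - kelvin w x)) \<longlonglongrightarrow> 0"
    using L by (intro ennreal_tendsto_0_cmult) (auto simp: L2_converges_def)
  from ennreal_tendsto_0_le[OF this le]
  show "L2_converges (lebesgue_on (annulus R)) (\<lambda>n. kelvin (\<phi> n)) w"
    using wm' borel_measurable_lebesgue_on[OF em] by (simp only: L2_converges_def simp_thms)
qed

section \<open>The Hardy norm as an energy in the exterior domain\<close>

text \<open>In polar coordinates \<open>1 / |x|\<^sup>2\<close> against the radial weight is the power \<open>N - 3\<close> of the radius, which is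
bounded on the unit ball for \<open>N \<ge> 3\<close>.\<close>

lemma integrable_inverse_square_bound:
  fixes g :: "'a::euclidean_space \<Rightarrow> real"
  assumes N: "DIM('a) \<ge> 3" and [measurable]: "g \<in> borel_measurable borel"
    and le: "\<And>x. norm x < 1 \<Longrightarrow> x \<noteq> 0 \<Longrightarrow> \<bar>g x\<bar> \<le> C / (norm x)\<^sup>2"
  shows "integrable lborel (\<lambda>x. indicator (ball 0 1) x * g x)"
proof -
  let ?N = "DIM('a)"
  let ?g = "\<lambda>(x::'a) r. ennreal (real ?N * r ^ (?N - 1)) * indicator {0<..} r * (ennreal (1 / (norm (r *\<^sub>R sgn x))\<^sup>2) * indicator (ball 0 1) (r *\<^sub>R sgn x))"
  have [measurable]: "ball (0::'a) 1 \<in> sets borel" by simp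
  have "(\<integral>\<^sup>+x. ennreal (1 / (norm x)\<^sup>2) * indicator (ball 0 1) x \<partial>(lborel :: 'a measure))
    = (\<integral>\<^sup>+x. (\<integral>\<^sup>+r. ?g x r \<partial>lborel)
       * indicator (ball 0 1) x \<partial>(lborel :: 'a measure))"
    by (rule nn_integral_polar) measurable
  also have "\<dots> \<le> (\<integral>\<^sup>+x. ennreal (real ?N) * indicator (ball 0 1) x \<partial>(lborel :: 'a measure))"
  proof (rule nn_integral_mono_AE)
    have AE0: "AE x::'a in lborel. x \<noteq> 0"
      using AE_lborel_singleton[of "0::'a"] by simp
    show "AE x in lborel. (\<integral>\<^sup>+r. ?g x r \<partial>lborel)
       * indicator (ball 0 1) x \<le> ennreal (real ?N) * indicator (ball 0 1) (x::'a)"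
      using AE0
    proof eventually_elim
      fix x :: 'a assume x: "x \<noteq> 0"
      have "(\<integral>\<^sup>+r. ?g x r \<partial>lborel)
        \<le> (\<integral>\<^sup>+r. ennreal (real ?N) * indicator {0..1::real} r \<partial>lborel)"
      proof (rule nn_integral_mono)
        fix r :: real
        show "?g x r
          \<le> ennreal (real ?N) * indicator {0..1} r"
        proof (cases "0 < r \<and> r < 1")
          case True
          obtain k where k: "?N = k + 3" using N by (metis add.commute le_Suc_ex)
          have "r ^ (?N - 1) * (1 / r\<^sup>2) = r ^ (?N - 3)"
            unfolding k using True by (simp add: power_add field_simps power2_eq_square)
          also have "\<dots> \<le> 1" using True by (intro power_le_one) auto
          finally have "real ?N * (r ^ (?N - 1) * (1 / r\<^sup>2)) \<le> real ?N * 1"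
            by (rule mult_left_mono) simp
          then have "ennreal (real ?N * r ^ (?N - 1) * (1 / r\<^sup>2)) \<le> ennreal (real ?N)"
            by (intro ennreal_leI) simp
          moreover have "norm (r *\<^sub>R sgn x) = r" using True x by (simp add: norm_sgn)
          ultimately show ?thesis using True by (simp add: ennreal_mult[symmetric] norm_sgn x)
        next
          case False
          then show ?thesis using x by (auto simp: indicator_def norm_sgn)
        qed
      qed
      also have "\<dots> = ennreal (real ?N)" by (simp add: nn_integral_cmult)
      finally show "(\<integral>\<^sup>+r. ?g x r \<partial>lborel)
       * indicator (ball 0 1) x \<le> ennreal (real ?N) * indicator (ball 0 1) x"
        by (rule mult_right_mono) simp
    qed
  qed
  also have "\<dots> < \<infinity>"
    using emeasure_bounded_finite[of "ball (0::'a) 1"] by (simp add: nn_integral_cmult ennreal_mult_less_top)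
  finally have fin: "(\<integral>\<^sup>+x. ennreal (1 / (norm x)\<^sup>2) * indicator (ball 0 1) x \<partial>(lborel :: 'a measure)) < \<infinity>" .
  have base: "integrable lborel (\<lambda>x::'a. C * (1 / (norm x)\<^sup>2 * indicator (ball 0 1) x))"
  proof (intro integrable_mult_right integrableI_bounded)
    have "(\<integral>\<^sup>+x. ennreal (norm (1 / (norm x)\<^sup>2 * indicator (ball 0 1) x)) \<partial>(lborel :: 'a measure)) =
      (\<integral>\<^sup>+x. ennreal (1 / (norm x)\<^sup>2) * indicator (ball 0 1) x \<partial>(lborel :: 'a measure))"
      by (intro nn_integral_cong) (auto simp: indicator_def)
    with fin show "(\<integral>\<^sup>+x. ennreal (norm (1 / (norm x)\<^sup>2 * indicator (ball 0 1) x)) \<partial>(lborel :: 'a measure)) < \<infinity>"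
      by simp
  qed measurable
  show ?thesis
  proof (rule Bochner_Integration.integrable_bound[OF base])
    show "AE x in lborel. norm (indicator (ball 0 1) x * g x) \<le> norm (C * (1 / (norm x)\<^sup>2 * indicator (ball 0 1) x))"
      using AE_lborel_singleton[of "0::'a"]
    proof eventually_elim
      fix x :: 'a assume "x \<noteq> 0"
      then show "norm (indicator (ball 0 1) x * g x) \<le> norm (C * (1 / (norm x)\<^sup>2 * indicator (ball 0 1) x))"
        using le[of x] by (auto simp: indicator_def intro: order_trans[OF _ divide_right_mono[OF abs_ge_self]])
    qed
  qed measurable
qed

text \<open>Each of the three terms of the expanded \<open>|A \<phi>|\<^sup>2\<close> is integrable on its own, and the divergence term
integrates to zero.\<close>

lemma hardy_norm_eq:
  fixes \<phi> :: "'a::euclidean_space \<Rightarrow> real"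
  assumes N: "DIM('a) \<ge> 3" and \<phi>: "\<phi> \<in> test_functions (ball 0 1)"
  shows "integrable lborel (\<lambda>x. indicator (ball 0 1) x * (norm (hardy_grad \<phi> x))\<^sup>2)"
    and "hardy_norm \<phi> = sqrt (\<integral>x. indicator (ball 0 1) x * (norm (hardy_grad \<phi> x))\<^sup>2 \<partial>lborel)"
proof -
  let ?N = "DIM('a)" and ?B = "ball (0::'a) 1"
  define c where "c = (real ?N - 2) / 2"
  have [measurable]: "?B \<in> sets borel" by simp
  have s: "smooth \<phi>" by (rule test_function_smooth[OF \<phi>])
  have c1[measurable]: "\<phi> \<in> borel_measurable borel" "grad \<phi> \<in> borel_measurable borel"
    using smooth_borel[OF s] .
  have cpt: "compact (\<phi> ` cball 0 1)" "compact (grad \<phi> ` cball 0 1)"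
    by (intro compact_continuous_image smooth_continuous_on smooth_grad_continuous_on s compact_cball)+
  obtain B1 where "\<forall>x\<in>cball 0 1. norm (\<phi> x) \<le> B1"
    using compact_imp_bounded[OF cpt(1)] by (auto simp: bounded_iff)
  moreover obtain B2 where "\<forall>x\<in>cball 0 1. norm (grad \<phi> x) \<le> B2"
    using compact_imp_bounded[OF cpt(2)] by (auto simp: bounded_iff)
  ultimately have B: "\<bar>\<phi> x\<bar> \<le> max B1 B2" "norm (grad \<phi> x) \<le> max B1 B2" if "norm x < 1" for x
    using that by (auto simp: le_max_iff_disj)
  define C where "C = max B1 B2"
  have C: "C \<ge> 0" using B(2)[of 0] norm_ge_zero[of "grad \<phi> 0"] unfolding C_def by (metis norm_zero order_trans zero_less_one)
  note B = B[folded C_def]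
  have n2: "1 \<le> 1 / (norm x)\<^sup>2" "1 / norm x \<le> 1 / (norm x)\<^sup>2" if "norm x < 1" "x \<noteq> 0" for x :: 'a
  proof -
    have "(norm x)\<^sup>2 \<le> norm x" "(norm x)\<^sup>2 \<le> 1" using that by (auto simp: power2_eq_square mult_le_one intro: mult_left_le_one_le)
    then show "1 \<le> 1 / (norm x)\<^sup>2" "1 / norm x \<le> 1 / (norm x)\<^sup>2" using that by (auto simp: field_simps)
  qed
  have i1: "integrable lborel (\<lambda>x. indicator ?B x * (norm (grad \<phi> x))\<^sup>2)"
  proof (rule integrable_inverse_square_bound[OF N])
    fix x :: 'a assume x: "norm x < 1" "x \<noteq> 0"
    have "\<bar>(norm (grad \<phi> x))\<^sup>2\<bar> \<le> C\<^sup>2 * 1" using B(2)[OF x(1)] by (auto intro: power_mono)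
    also have "\<dots> \<le> C\<^sup>2 * (1 / (norm x)\<^sup>2)" using n2[OF x] by (intro mult_left_mono) auto
    finally show "\<bar>(norm (grad \<phi> x))\<^sup>2\<bar> \<le> C\<^sup>2 / (norm x)\<^sup>2" by simp
  qed measurable
  have i2: "integrable lborel (\<lambda>x. indicator ?B x * ((\<phi> x)\<^sup>2 / (norm x)\<^sup>2))"
  proof (rule integrable_inverse_square_bound[OF N])
    fix x :: 'a assume x: "norm x < 1" "x \<noteq> 0"
    have "(\<phi> x)\<^sup>2 \<le> C\<^sup>2" using power_mono[OF B(1)[OF x(1)], of 2] by simp
    then show "\<bar>(\<phi> x)\<^sup>2 / (norm x)\<^sup>2\<bar> \<le> C\<^sup>2 / (norm x)\<^sup>2" by (simp add: divide_right_mono)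
  qed measurable
  define f where "f x = \<phi> x * (2 * (inversion x \<bullet> grad \<phi> x) + (real ?N - 2) * (\<phi> x / (norm x)\<^sup>2))" for x
  have fm[measurable]: "f \<in> borel_measurable borel" unfolding f_def by measurable
  have i3: "integrable lborel (\<lambda>x. indicator ?B x * f x)"
  proof (rule integrable_inverse_square_bound[OF N fm])
    fix x :: 'a assume x: "norm x < 1" "x \<noteq> 0"
    have "\<bar>inversion x \<bullet> grad \<phi> x\<bar> \<le> norm (inversion x) * norm (grad \<phi> x)" by (rule Cauchy_Schwarz_ineq2)
    also have "\<dots> \<le> (1 / (norm x)\<^sup>2) * C"
      using n2[OF x] B(2)[OF x(1)] by (intro mult_mono) (auto simp: norm_inversion inverse_eq_divide)
    finally have a: "\<bar>inversion x \<bullet> grad \<phi> x\<bar> \<le> (1 / (norm x)\<^sup>2) * C" .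
    have b: "\<bar>\<phi> x / (norm x)\<^sup>2\<bar> \<le> (1 / (norm x)\<^sup>2) * C" using B(1)[OF x(1)] by (simp add: divide_right_mono)
    have "\<bar>2 * (inversion x \<bullet> grad \<phi> x) + (real ?N - 2) * (\<phi> x / (norm x)\<^sup>2)\<bar>
       \<le> \<bar>2 * (inversion x \<bullet> grad \<phi> x)\<bar> + \<bar>(real ?N - 2) * (\<phi> x / (norm x)\<^sup>2)\<bar>" by (rule abs_triangle_ineq)
    also have "\<dots> \<le> 2 * ((1 / (norm x)\<^sup>2) * C) + (real ?N - 2) * ((1 / (norm x)\<^sup>2) * C)"
      unfolding abs_mult using a b N by (intro add_mono mult_mono) auto
    also have "2 * K + (real ?N - 2) * K = real ?N * K" for K :: real by (simp add: algebra_simps)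
    finally have "\<bar>f x\<bar> \<le> C * (real ?N * ((1 / (norm x)\<^sup>2) * C))"
      unfolding f_def abs_mult using B(1)[OF x(1)] C by (intro mult_mono) auto
    then show "\<bar>f x\<bar> \<le> (C * (real ?N * C)) / (norm x)\<^sup>2" by simp
  qed
  let ?A = "{y::'a. 0 < norm y \<and> norm y < 1}"
  \<comment> \<open>The boundary terms vanish: at radius 1 by the support of \<open>\<phi>\<close>, at radius 0 because the exponent \<open>N - 2\<close> is positive.\<close>
  have i3': "(\<integral>x. indicator ?B x * f x \<partial>lborel) = 0"
  proof -
    have ann: "(\<lambda>y. indicator ?A y * f y) = (\<lambda>y. indicator ?B y * f y)"
    proof
      fix y :: 'a
      show "indicator ?A y * f y = indicator ?B y * f y"
        by (cases "y = 0") (auto simp: indicator_def f_def inversion_def)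
    qed
    let ?P = "\<lambda>\<omega> r. r ^ (?N - 2) * (\<phi> (r *\<^sub>R \<omega>))\<^sup>2"
    obtain \<delta> where \<delta>: "0 < \<delta>" "\<delta> < 1" "\<And>x. norm x \<ge> \<delta> \<Longrightarrow> \<phi> x = 0"
      using test_function_support[OF \<phi>] by blast
    have "(\<integral>y. indicator ?A y * f y \<partial>lborel) = real ?N * (\<integral>x. indicator ?B x * (?P (sgn x) 1 - ?P (sgn x) 0) \<partial>lborel)"
    proof (rule radial_divergence)
      show "integrable lborel (\<lambda>y. indicator ?A y * f y)" unfolding ann by (rule i3)
      fix \<omega> :: 'a assume \<omega>: "norm \<omega> = 1"
      show "continuous_on {0..1} (?P \<omega>)"
        by (intro continuous_intros continuous_on_compose2[OF smooth_continuous[OF s]]) auto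
      fix r :: real assume r: "0 < r" "r < 1"
      have "((\<lambda>r. r *\<^sub>R \<omega>) has_derivative (\<lambda>h. h *\<^sub>R \<omega>)) (at r)"
        by (auto intro!: derivative_eq_intros)
      from has_derivative_compose[OF this smooth_has_derivative[OF s]]
      have "((\<lambda>r. \<phi> (r *\<^sub>R \<omega>)) has_real_derivative grad \<phi> (r *\<^sub>R \<omega>) \<bullet> \<omega>) (at r)"
        by (simp add: has_field_derivative_def mult.commute[of _ "grad \<phi> (r *\<^sub>R \<omega>) \<bullet> \<omega>"])
      then have "(?P \<omega> has_real_derivative (real (?N - 2) * r ^ (?N - 2 - 1)) * (\<phi> (r *\<^sub>R \<omega>))\<^sup>2 + (2 * \<phi> (r *\<^sub>R \<omega>) * (grad \<phi> (r *\<^sub>R \<omega>) \<bullet> \<omega>)) * r ^ (?N - 2)) (at r)"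
        by (intro DERIV_mult) (auto intro!: derivative_eq_intros)
      moreover have "(real (?N - 2) * r ^ (?N - 2 - 1)) * (\<phi> (r *\<^sub>R \<omega>))\<^sup>2 + (2 * \<phi> (r *\<^sub>R \<omega>) * (grad \<phi> (r *\<^sub>R \<omega>) \<bullet> \<omega>)) * r ^ (?N - 2)
        = r ^ (?N - 1) * f (r *\<^sub>R \<omega>)"
      proof -
        obtain k where k: "?N = k + 3" using N by (metis add.commute le_Suc_ex)
        have n: "norm (r *\<^sub>R \<omega>) = r" using r \<omega> by simp
        have i: "inversion (r *\<^sub>R \<omega>) = (1 / r) *\<^sub>R \<omega>" unfolding inversion_def n using r by (simp add: power2_eq_square field_simps)
        show ?thesis unfolding f_def n i k using r
          by (simp add: power_add field_simps power2_eq_square power3_eq_cube inner_commute)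
      qed
      ultimately show "(?P \<omega> has_real_derivative r ^ (?N - 1) * f (r *\<^sub>R \<omega>)) (at r)" by (simp only:)
    next
      show "(\<lambda>x. ?P (sgn x) r) \<in> borel_measurable borel" for r by measurable
    qed auto
    also have "(\<integral>x. indicator ?B x * (?P (sgn x) 1 - ?P (sgn x) 0) \<partial>lborel) = 0"
    proof -
      have "AE x in lborel. indicator ?B x * (?P (sgn x) 1 - ?P (sgn x) 0) = 0"
        using AE_lborel_singleton[of "0::'a"]
      proof eventually_elim
        fix x :: 'a assume "x \<noteq> 0"
        then have "\<phi> (sgn x) = 0" using \<delta> by (simp add: norm_sgn)
        then show "indicator ?B x * (?P (sgn x) 1 - ?P (sgn x) 0) = 0" using N by simp
      qed
      from integral_eq_zero_AE[OF this] show ?thesis .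
    qed
    finally show ?thesis unfolding ann by simp
  qed
  let ?E = "\<lambda>x. indicator ?B x * (norm (grad \<phi> x))\<^sup>2 - c\<^sup>2 * (indicator ?B x * ((\<phi> x)\<^sup>2 / (norm x)\<^sup>2)) + c * (indicator ?B x * f x)"
  have eq: "AE x in lborel. indicator ?B x * (norm (hardy_grad \<phi> x))\<^sup>2 =
     ?E x"
    using AE_lborel_singleton[of "0::'a"]
  proof eventually_elim
    fix x :: 'a assume "x \<noteq> 0"
    from norm_grad_eq_hardy_grad[OF this, of \<phi>]
    show "indicator ?B x * (norm (hardy_grad \<phi> x))\<^sup>2 =
     ?E x"
      by (simp add: c_def f_def indicator_def)
  qed
  have hm: "(\<lambda>x. indicator ?B x * (norm (hardy_grad \<phi> x))\<^sup>2) \<in> borel_measurable lborel"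
    unfolding hardy_grad_def by measurable
  have rhs: "integrable lborel (\<lambda>x. ?E x)"
    by (intro Bochner_Integration.integrable_add Bochner_Integration.integrable_diff integrable_mult_right i1 i2 i3)
  show "integrable lborel (\<lambda>x. indicator ?B x * (norm (hardy_grad \<phi> x))\<^sup>2)"
    using rhs integrable_cong_AE[OF hm _ eq] by auto
  have "(\<integral>x. indicator ?B x * (norm (hardy_grad \<phi> x))\<^sup>2 \<partial>lborel)
    = (\<integral>x. ?E x \<partial>lborel)"
    by (rule Bochner_Integration.integral_cong_AE[OF hm _ eq]) (use rhs in auto)
  also have "\<dots> = (\<integral>x. indicator ?B x * (norm (grad \<phi> x))\<^sup>2 \<partial>lborel) - c\<^sup>2 * (\<integral>x. indicator ?B x * ((\<phi> x)\<^sup>2 / (norm x)\<^sup>2) \<partial>lborel)"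
  proof -
    have "(\<integral>x. u x - k * v x + c * t x \<partial>lborel) = (\<integral>x. u x \<partial>lborel) - k * (\<integral>x. v x \<partial>lborel) + c * (\<integral>x. t x \<partial>lborel)"
      if "integrable lborel u" "integrable lborel v" "integrable lborel t" for u v t :: "'a \<Rightarrow> real" and k
      using that by simp
    from this[OF i1 i2 i3] show ?thesis unfolding i3' by simp
  qed
  also have "\<dots> = (LINT x:?B|lebesgue. (norm (grad \<phi> x))\<^sup>2) - c\<^sup>2 * (LINT x:?B|lebesgue. (\<phi> x)\<^sup>2 / (norm x)\<^sup>2)"
    unfolding set_lebesgue_integral_def by (subst (1 2) integral_completion) auto
  finally show "hardy_norm \<phi> = sqrt (\<integral>x. indicator ?B x * (norm (hardy_grad \<phi> x))\<^sup>2 \<partial>lborel)"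
    unfolding hardy_norm_def c_def by simp
qed

text \<open>The Jacobian of the inversion cancels the power of \<open>|y|\<close> in \<open>norm_hardy_grad_kelvin\<close>.\<close>

lemma hardy_norm_kelvin:
  fixes \<phi> :: "'a::euclidean_space \<Rightarrow> real"
  assumes N: "DIM('a) \<ge> 3" and \<phi>: "\<phi> \<in> test_functions (ball 0 1)"
  shows "L2sq (lebesgue_on (- cball 0 1)) (\<lambda>y. hardy_grad (kelvin \<phi>) y) = ennreal ((hardy_norm \<phi>)\<^sup>2)"
    and "hardy_grad (kelvin \<phi>) \<in> borel_measurable borel"
proof -
  let ?N = "DIM('a)"
  have hgm: "hardy_grad f \<in> borel_measurable borel" if "smooth f" for f :: "'a \<Rightarrow> real"
  proof -
    have [measurable]: "f \<in> borel_measurable borel" "grad f \<in> borel_measurable borel"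
      using smooth_borel[OF that] .
    show ?thesis unfolding hardy_grad_def by measurable
  qed
  show m[measurable]: "hardy_grad (kelvin \<phi>) \<in> borel_measurable borel"
    by (rule hgm[OF smooth_kelvin[OF assms]])
  note m'[measurable] = hgm[OF test_function_smooth[OF \<phi>]]
  have "L2sq (lebesgue_on (- cball 0 1)) (\<lambda>y. hardy_grad (kelvin \<phi>) y)
    = (\<integral>\<^sup>+y. ennreal ((norm (hardy_grad (kelvin \<phi>) y))\<^sup>2) * indicator (- cball 0 1) y \<partial>lborel)"
    by (subst nn_integral_restrict_space) (auto simp: nn_integral_completion)
  also have "\<dots> = (\<integral>\<^sup>+x. ennreal (inverse (norm x ^ (2 * ?N))) * (ennreal ((norm (hardy_grad (kelvin \<phi>) (inversion x)))\<^sup>2) * indicator (- cball 0 1) (inversion x)) \<partial>lborel)"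
  proof (rule nn_integral_inversion)
    have "- cball (0::'a) 1 \<in> sets borel" by auto
    then show "(\<lambda>y. ennreal ((norm (hardy_grad (kelvin \<phi>) y))\<^sup>2) * indicator (- cball 0 1) y) \<in> borel_measurable borel"
      by measurable
  qed
  also have "\<dots> = (\<integral>\<^sup>+x. ennreal (indicator (ball 0 1) x * (norm (hardy_grad \<phi> x))\<^sup>2) \<partial>lborel)"
  proof (rule nn_integral_cong_AE)
    show "AE x in lborel. ennreal (inverse (norm x ^ (2 * ?N))) * (ennreal ((norm (hardy_grad (kelvin \<phi>) (inversion x)))\<^sup>2) * indicator (- cball 0 1) (inversion x))
      = ennreal (indicator (ball 0 1) x * (norm (hardy_grad \<phi> x))\<^sup>2)"
      using AE_lborel_singleton[of "0::'a"]
    proof eventually_elim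
      fix x :: 'a assume x: "x \<noteq> 0"
      then have i: "inversion x \<noteq> 0" by (simp add: inversion_def)
      have N2: "2 \<le> ?N" using N by simp
      have "inverse (norm x ^ (2 * ?N)) * (norm (hardy_grad (kelvin \<phi>) (inversion x)))\<^sup>2 = (norm (hardy_grad \<phi> x))\<^sup>2"
        unfolding norm_hardy_grad_kelvin[OF N2 test_function_smooth[OF \<phi>] i] using x
        by (simp add: norm_inversion power_inverse)
      from arg_cong[OF this, of ennreal]
      have "ennreal (inverse (norm x ^ (2 * ?N))) * ennreal ((norm (hardy_grad (kelvin \<phi>) (inversion x)))\<^sup>2) = ennreal ((norm (hardy_grad \<phi> x))\<^sup>2)"
        by (simp add: ennreal_mult)
      moreover have "inversion x \<in> - cball 0 1 \<longleftrightarrow> x \<in> ball 0 1"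
        using x by (auto simp: norm_inversion one_less_inverse_iff not_le)
      ultimately show "ennreal (inverse (norm x ^ (2 * ?N))) * (ennreal ((norm (hardy_grad (kelvin \<phi>) (inversion x)))\<^sup>2) * indicator (- cball 0 1) (inversion x))
        = ennreal (indicator (ball 0 1) x * (norm (hardy_grad \<phi> x))\<^sup>2)"
        by (auto simp: indicator_def)
    qed
  qed
  also have "\<dots> = ennreal (\<integral>x. indicator (ball 0 1) x * (norm (hardy_grad \<phi> x))\<^sup>2 \<partial>lborel)"
    by (rule nn_integral_eq_integral[OF hardy_norm_eq(1)[OF assms]]) auto
  also have "\<dots> = ennreal ((hardy_norm \<phi>)\<^sup>2)"
    unfolding hardy_norm_eq(2)[OF assms] by simp
  finally show "L2sq (lebesgue_on (- cball 0 1)) (\<lambda>y. hardy_grad (kelvin \<phi>) y) = ennreal ((hardy_norm \<phi>)\<^sup>2)" .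
qed

section \<open>Weak gradients\<close>

text \<open>The difference quotients of \<open>f\<close> have integral zero by translation invariance and converge to the partial
derivative, dominated by a constant on a fixed ball.\<close>

lemma integral_grad_eq_0:
  fixes f :: "'a::euclidean_space \<Rightarrow> real"
  assumes s: "smooth f" and K: "compact K" and f0: "\<And>x. x \<notin> K \<Longrightarrow> f x = 0" and i: "i \<in> Basis"
  shows "(\<integral>x. grad f x \<bullet> i \<partial>lborel) = 0"
proof -
  obtain r where r: "K \<subseteq> cball 0 r"
    using compact_imp_bounded[OF K] by (auto simp: bounded_iff mem_cball dist_norm subset_eq)
  have fm[measurable]: "f \<in> borel_measurable borel"
    by (rule smooth_borel(1)[OF s])
  have gm[measurable]: "grad f \<in> borel_measurable borel"
    by (rule smooth_borel(2)[OF s])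
  have g0: "grad f x = 0" if "x \<notin> K" for x
  proof (rule grad_eqI)
    have o: "open (- K)" using K by (simp add: compact_imp_closed open_Compl)
    have z: "((\<lambda>_. 0) has_derivative (\<lambda>h. 0 \<bullet> h)) (at x)" by simp
    show "(f has_derivative (\<lambda>h. 0 \<bullet> h)) (at x)"
      by (rule has_derivative_transform_within_open[OF z o]) (use that f0 in auto)
  qed
  have "compact (grad f ` K)"
    by (intro compact_continuous_image smooth_grad_continuous_on s K)
  then obtain B0 where B0: "\<forall>x\<in>K. norm (grad f x) \<le> B0"
    using compact_imp_bounded by (fastforce simp: bounded_iff)
  define B where "B = max 0 B0"
  have B: "norm (grad f x) \<le> B" for x
    using B0 g0[of x] by (cases "x \<in> K") (auto simp: B_def le_max_iff_disj)
  define h where "h n = inverse (real (Suc n))" for n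
  have h: "0 < h n" "h n \<le> 1" for n by (auto simp: h_def field_simps)
  have h0: "h \<longlonglongrightarrow> 0" unfolding h_def by (rule LIMSEQ_inverse_real_of_nat)
  define q where "q n x = (f (x + h n *\<^sub>R i) - f x) / h n" for n x
  have qm[measurable]: "q n \<in> borel_measurable borel" for n unfolding q_def by measurable
  have dom: "integrable lborel (\<lambda>x. indicator (cball 0 (r + 1)) x *\<^sub>R B)"
    by (rule borel_integrable_compact) auto
  have qb: "norm (q n x) \<le> indicator (cball 0 (r + 1)) x *\<^sub>R B" for n x
  proof (cases "x \<in> cball 0 (r + 1)")
    case True
    have "norm (f (x + h n *\<^sub>R i) - f x) \<le> B * norm ((x + h n *\<^sub>R i) - x)"
    proof (rule differentiable_bound[of UNIV f "\<lambda>x h. grad f x \<bullet> h"])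
      show "(f has_derivative (\<bullet>) (grad f x)) (at x within UNIV)" for x
        using smooth_has_derivative[OF s] by simp
      show "onorm ((\<bullet>) (grad f x)) \<le> B" for x
        by (rule onorm_le, unfold real_norm_def)
           (rule order_trans[OF Cauchy_Schwarz_ineq2 mult_right_mono[OF B norm_ge_zero]])
    qed auto
    then have "norm (f (x + h n *\<^sub>R i) - f x) \<le> B * h n" using h[of n] i by simp
    then show ?thesis using True h[of n] by (simp add: q_def field_simps)
  next
    case False
    then have x: "norm x > r + 1" by simp
    have "norm x \<le> norm (x + h n *\<^sub>R i) + norm (h n *\<^sub>R i)"
      using norm_triangle_ineq4[of "x + h n *\<^sub>R i" "h n *\<^sub>R i"] by simp
    also have "norm (h n *\<^sub>R i) \<le> 1" using h[of n] i by simp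
    finally have "norm (x + h n *\<^sub>R i) > r" using x by linarith
    then have "x + h n *\<^sub>R i \<notin> K" using r by (auto simp: subset_eq mem_cball)
    moreover have "x \<notin> K" using r x by (auto simp: subset_eq mem_cball)
    ultimately show ?thesis using False by (simp add: q_def f0)
  qed
  have "(\<lambda>n. \<integral>x. q n x \<partial>lborel) \<longlonglongrightarrow> (\<integral>x. grad f x \<bullet> i \<partial>lborel)"
  proof (rule integral_dominated_convergence[OF _ _ dom])
    show "AE x in lborel. (\<lambda>n. q n x) \<longlonglongrightarrow> grad f x \<bullet> i"
    proof (rule AE_I2)
      fix x
      have "((\<lambda>t. x + t *\<^sub>R i) has_derivative (\<lambda>t. t *\<^sub>R i)) (at 0)"
        by (auto intro!: derivative_eq_intros)
      from has_derivative_compose[OF this smooth_has_derivative[OF s]]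
      have "((\<lambda>t. f (x + t *\<^sub>R i)) has_real_derivative grad f x \<bullet> i) (at 0)"
        by (simp add: has_field_derivative_def mult.commute[of _ "grad f x \<bullet> i"])
      then have "((\<lambda>t. (f (x + t *\<^sub>R i) - f x) / t) \<longlongrightarrow> grad f x \<bullet> i) (at 0)"
        by (simp add: has_field_derivative_iff)
      moreover have "filterlim h (at 0) sequentially"
        using h0 h(1) by (auto simp: filterlim_at less_imp_neq[symmetric] intro!: always_eventually)
      ultimately show "(\<lambda>n. q n x) \<longlonglongrightarrow> grad f x \<bullet> i"
        unfolding q_def by (rule filterlim_compose)
    qed
    show "AE x in lborel. norm (q n x) \<le> indicator (cball 0 (r + 1)) x *\<^sub>R B" for n
      using qb by (intro AE_I2)
  qed measurable
  moreover have "(\<integral>x. q n x \<partial>lborel) = 0" for n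
  proof -
    have fi: "integrable lborel f"
    proof -
      have "integrable lborel (\<lambda>x. indicator K x *\<^sub>R f x)"
        by (intro borel_integrable_compact K smooth_continuous_on s)
      moreover have "(\<lambda>x. indicator K x *\<^sub>R f x) = f" using f0 by (auto simp: indicator_def fun_eq_iff)
      ultimately show ?thesis by simp
    qed
    have d: "lborel = distr lborel borel (\<lambda>x. h n *\<^sub>R i + x)"
      by (simp add: lborel_distr_plus)
    have "integrable (distr lborel borel (\<lambda>x. h n *\<^sub>R i + x)) f" using fi d by simp
    then have i2: "integrable lborel (\<lambda>x. f (x + h n *\<^sub>R i))"
      by (subst (asm) integrable_distr_eq) (auto simp: add.commute)
    have "(\<integral>x. f x \<partial>lborel) = (\<integral>x. f x \<partial>distr lborel borel (\<lambda>x. h n *\<^sub>R i + x))" using d by simp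
    also have "\<dots> = (\<integral>x. f (x + h n *\<^sub>R i) \<partial>lborel)"
      by (subst integral_distr) (auto simp: add.commute)
    finally show ?thesis using fi i2 by (simp add: q_def)
  qed
  ultimately show ?thesis by (simp add: LIMSEQ_const_iff)
qed

text \<open>For \<open>m = 0\<close> this is the standard flat function. The powers of \<open>1/t\<close> are included because derivatives of
members of the family are linear combinations of members, also at \<open>t = 0\<close>.\<close>

definition flat :: "real \<Rightarrow> nat \<Rightarrow> real \<Rightarrow> real" where
  "flat a m t = (if t > 0 then inverse (t ^ m) * exp (- a / t) else 0)"

lemma flat_tendsto_0:
  assumes "a > 0"
  shows "(flat a m \<longlongrightarrow> 0) (at 0)"
proof -
  have "filterlim (\<lambda>t::real. a * inverse t) at_top (at_right 0)"
    using assms by (intro filterlim_tendsto_pos_mult_at_top[OF tendsto_const] filterlim_inverse_at_top_right)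
  then have "((\<lambda>t. (a * inverse t) ^ m / exp (a * inverse t)) \<longlongrightarrow> 0) (at_right 0)"
    by (rule filterlim_compose[OF tendsto_power_div_exp_0])
  then have "((\<lambda>t. inverse (a ^ m) * ((a * inverse t) ^ m / exp (a * inverse t))) \<longlongrightarrow> 0) (at_right 0)"
    by (rule tendsto_mult_right_zero)
  moreover have "eventually (\<lambda>t. inverse (a ^ m) * ((a * inverse t) ^ m / exp (a * inverse t)) = flat a m t) (at_right 0)"
    using assms by (auto simp: eventually_at_right_field flat_def exp_minus power_mult_distrib divide_inverse power_inverse intro!: exI[of _ 1])
  ultimately have "(flat a m \<longlongrightarrow> 0) (at_right 0)"
    by (rule Lim_transform_eventually)
  moreover have "(flat a m \<longlongrightarrow> 0) (at_left 0)"
    by (rule tendsto_eventually) (auto simp: eventually_at_left_field flat_def intro!: exI[of _ "-1"])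
  ultimately show ?thesis by (simp add: filterlim_at_split)
qed

lemma flat_has_derivative:
  assumes a: "a > 0"
  shows "(flat a m has_real_derivative (a * flat a (m + 2) t - real m * flat a (m + 1) t)) (at t)"
proof (cases t "0 :: real" rule: linorder_cases)
  case less
  have "((\<lambda>_. 0) has_real_derivative 0) (at t)" by simp
  moreover have "open {..<0::real}" "t \<in> {..<0}" using less by auto
  moreover have "\<And>s. s \<in> {..<0} \<Longrightarrow> 0 = flat a m s" by (auto simp: flat_def)
  ultimately have "(flat a m has_real_derivative 0) (at t)"
    by (rule has_field_derivative_transform_within_open)
  then show ?thesis using less by (simp add: flat_def)
next
  case equal
  have "((\<lambda>h. flat a (m + 1) h) \<longlongrightarrow> 0) (at 0)" by (rule flat_tendsto_0[OF a])
  moreover have "flat a (m + 1) = (\<lambda>h. (flat a m (0 + h) - flat a m 0) / h)"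
    by (auto simp: flat_def field_simps)
  ultimately have "(flat a m has_real_derivative 0) (at 0)"
    by (simp add: DERIV_def)
  then show ?thesis using equal by (simp add: flat_def)
next
  case greater
  have "((\<lambda>t. inverse (t ^ m) * exp (- a / t)) has_real_derivative (a * flat a (m + 2) t - real m * flat a (m + 1) t)) (at t)"
  proof -
    have "((\<lambda>t. inverse (t ^ m) * exp (- a / t)) has_real_derivative
       (- (inverse (t ^ m) * (real m * t ^ (m - 1)) * inverse (t ^ m))) * exp (- a / t) + (exp (- a / t) * (a / t\<^sup>2)) * inverse (t ^ m)) (at t)"
      using greater by (auto intro!: derivative_eq_intros simp: power2_eq_square)
    moreover have "(- (inverse (t ^ m) * (real m * t ^ (m - 1)) * inverse (t ^ m))) * exp (- a / t) + (exp (- a / t) * (a / t\<^sup>2)) * inverse (t ^ m)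
       = a * flat a (m + 2) t - real m * flat a (m + 1) t"
      using greater by (cases m) (auto simp: flat_def field_simps power2_eq_square)
    ultimately show ?thesis by (simp only:)
  qed
  moreover have "open {0::real<..}" "t \<in> {0<..}" using greater by auto
  moreover have "\<And>s. s \<in> {0<..} \<Longrightarrow> inverse (s ^ m) * exp (- a / s) = flat a m s" by (auto simp: flat_def)
  ultimately show ?thesis by (rule has_field_derivative_transform_within_open)
qed

lemma smooth_flat:
  assumes a: "a > 0"
  shows "smooth (flat a m)"
proof -
  have "C_k_on k UNIV (flat a m)" for k
  proof (induction k arbitrary: m)
    case 0
    have "isCont (flat a m) t" for t
      using flat_has_derivative[OF a] by (rule DERIV_isCont)
    then show ?case by (simp add: continuous_at_imp_continuous_on)
  next
    case (Suc k)
    have d: "(flat a m has_derivative (\<lambda>h. (a * flat a (m + 2) t + (- real m) * flat a (m + 1) t) * h)) (at t)" for t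
      using flat_has_derivative[OF a, of m t] by (simp add: has_field_derivative_def)
    show ?case
      by (rule C_k_on_Suc_intro[OF open_UNIV d])
         (intro C_k_on_mult C_k_on_add C_k_on_const Suc open_UNIV)
  qed
  then show ?thesis by (simp add: smooth_def)
qed

text \<open>As \<open>n\<close> grows these test functions increase to the indicator of the open box; raising \<open>exp (-1/t)\<close> to the power
\<open>1/(n+1)\<close> is the same as scaling its exponent.\<close>

definition bump :: "nat \<Rightarrow> 'a::euclidean_space \<Rightarrow> 'a \<Rightarrow> 'a \<Rightarrow> real" where
  "bump n l u x = (\<Prod>i\<in>Basis. flat (inverse (real (Suc n))) 0 ((x - l) \<bullet> i) * flat (inverse (real (Suc n))) 0 ((u - x) \<bullet> i))"

lemma bump_eq_0: "x \<notin> box l u \<Longrightarrow> bump n l u x = 0"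
  unfolding bump_def by (rule prod_zero) (auto simp: box_def inner_diff_left flat_def)

lemma flat_bounds: "a > 0 \<Longrightarrow> 0 \<le> flat a 0 t \<and> flat a 0 t \<le> 1"
  by (auto simp: flat_def)

lemma bump_bounds: "0 \<le> bump n l u x \<and> bump n l u x \<le> 1"
  unfolding bump_def by (intro conjI prod_nonneg prod_le_1) (auto intro!: mult_le_one simp: flat_bounds)

lemma bump_tendsto:
  "(\<lambda>n. bump n l u x) \<longlonglongrightarrow> indicator (box l u) x"
proof (cases "x \<in> box l u")
  case True
  have 1: "(\<lambda>n. flat (inverse (real (Suc n))) 0 t) \<longlonglongrightarrow> 1" if "t > 0" for t
  proof -
    have "(\<lambda>n. exp (- inverse (real (Suc n)) / t)) \<longlonglongrightarrow> exp (- 0 / t)"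
      using that by (intro tendsto_intros LIMSEQ_inverse_real_of_nat) auto
    then show ?thesis using that by (simp add: flat_def)
  qed
  have "(\<lambda>n. bump n l u x) \<longlonglongrightarrow> (\<Prod>i\<in>(Basis::'a set). 1 * 1)"
    unfolding bump_def using True
    by (intro tendsto_prod tendsto_mult 1) (auto simp: box_def inner_diff_left)
  then show ?thesis using True by simp
qed (simp add: bump_eq_0)

lemma bump_test_function:
  assumes sub: "cbox l u \<subseteq> \<Omega>"
  shows "bump n l u \<in> test_functions \<Omega>"
proof -
  define a where "a = inverse (real (Suc n))"
  have a: "a > 0" by (simp add: a_def)
  have s: "smooth_on UNIV (\<lambda>x. flat a 0 ((x - l) \<bullet> i))" "smooth_on UNIV (\<lambda>x. flat a 0 ((u - x) \<bullet> i))" for i :: 'a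
  proof -
    have 1: "smooth_on UNIV (\<lambda>x. x \<bullet> i - l \<bullet> i)" "smooth_on UNIV (\<lambda>x. u \<bullet> i - x \<bullet> i)"
      by (rule smooth_on_diff[OF open_UNIV smooth_on_inner smooth_on_const] smooth_on_diff[OF open_UNIV smooth_on_const smooth_on_inner]; simp)+
    show "smooth_on UNIV (\<lambda>x. flat a 0 ((x - l) \<bullet> i))" "smooth_on UNIV (\<lambda>x. flat a 0 ((u - x) \<bullet> i))"
      by (rule smooth_on_compose[OF open_UNIV smooth_flat[OF a]]; use 1 in \<open>simp add: inner_diff_left\<close>)+
  qed
  have sm: "smooth (bump n l u)"
    unfolding bump_def[abs_def] smooth_iff_smooth_on a_def[symmetric]
    by (intro smooth_on_prod smooth_on_mult s open_UNIV)
  have "{x. bump n l u x \<noteq> 0} \<subseteq> cbox l u"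
    using bump_eq_0 box_subset_cbox by blast
  then have c: "closure {x. bump n l u x \<noteq> 0} \<subseteq> cbox l u"
    by (intro closure_minimal) auto
  then have "compact (closure {x. bump n l u x \<noteq> 0})"
    using compact_Int_closed[OF compact_cbox closed_closure, of l u "{x. bump n l u x \<noteq> 0}"] by (simp add: Int_absorb1)
  with sm c sub show ?thesis by (auto simp: test_functions_def)
qed

lemma AE_not_negligible: "negligible N \<Longrightarrow> AE x in lebesgue. x \<notin> N"
  unfolding negligible_iff_null_sets by (rule AE_not_in)

lemma weak_gradient_box_integral:
  fixes G :: "'a::euclidean_space \<Rightarrow> 'a"
  assumes G: "\<And>K. compact K \<Longrightarrow> K \<subseteq> \<Omega> \<Longrightarrow> G absolutely_integrable_on K" and sub: "cbox l u \<subseteq> \<Omega>"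
  shows "(\<lambda>n. LINT x:\<Omega>|lebesgue. bump n l u x *\<^sub>R G x) \<longlonglongrightarrow> integral (cbox l u) G"
proof -
  let ?F = "\<lambda>x. indicator (cbox l u) x *\<^sub>R G x"
  have Gi: "G absolutely_integrable_on cbox l u" using G[OF compact_cbox sub] .
  have i: "integrable lebesgue (\<lambda>x. ?F x)"
    using Gi unfolding set_integrable_def .
  note im = borel_measurable_integrable[OF i]
  have bm: "bump n l u \<in> borel_measurable lebesgue" for n
    using smooth_borel(1)[OF test_function_smooth[OF bump_test_function[of l u UNIV n]]]
    by (intro measurable_completion) auto
  have eq: "indicator \<Omega> x *\<^sub>R bump n l u x *\<^sub>R G x = bump n l u x *\<^sub>R (?F x)" for n x
    using sub bump_eq_0[of x l u] box_subset_cbox[of l u] by (cases "x \<in> cbox l u") (auto simp: indicator_def)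
  have "(\<lambda>n. \<integral>x. bump n l u x *\<^sub>R (?F x) \<partial>lebesgue)
    \<longlonglongrightarrow> (\<integral>x. indicator (box l u) x *\<^sub>R (?F x) \<partial>lebesgue)"
  proof (rule integral_dominated_convergence[where w = "\<lambda>x. norm (?F x)"])
    show "(\<lambda>x. indicator (box l u) x *\<^sub>R (?F x)) \<in> borel_measurable lebesgue"
      by (rule borel_measurable_scaleR[OF borel_measurable_indicator im]) simp
    show "(\<lambda>x. bump n l u x *\<^sub>R (?F x)) \<in> borel_measurable lebesgue" for n
      by (rule borel_measurable_scaleR[OF bm im])
    show "integrable lebesgue (\<lambda>x. norm (?F x))" using i by (rule integrable_norm)
    show "AE x in lebesgue. (\<lambda>n. bump n l u x *\<^sub>R (?F x)) \<longlonglongrightarrow> indicator (box l u) x *\<^sub>R (?F x)"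
      by (intro AE_I2 tendsto_scaleR bump_tendsto tendsto_const)
    show "AE x in lebesgue. norm (bump n l u x *\<^sub>R (?F x)) \<le> norm (?F x)" for n
    proof (rule AE_I2)
      fix x
      have "\<bar>bump n l u x\<bar> \<le> 1" using bump_bounds[of n l u x] by simp
      then show "norm (bump n l u x *\<^sub>R (?F x)) \<le> norm (?F x)"
        by (metis mult_left_le_one_le norm_ge_zero norm_scaleR abs_ge_zero)
    qed
  qed
  also have "(\<integral>x. indicator (box l u) x *\<^sub>R (?F x) \<partial>lebesgue) = (\<integral>x. ?F x \<partial>lebesgue)"
  proof (rule Bochner_Integration.integral_cong_AE)
    from AE_not_negligible[OF negligible_frontier_interval]
    show "AE x in lebesgue. indicator (box l u) x *\<^sub>R (?F x) = ?F x"
      by eventually_elim (use box_subset_cbox[of l u] in \<open>auto simp: indicator_def\<close>)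
    show "(\<lambda>x. indicator (box l u) x *\<^sub>R (?F x)) \<in> borel_measurable lebesgue"
      by (rule borel_measurable_scaleR[OF borel_measurable_indicator im]) simp
  qed (rule im)
  also have "\<dots> = integral (cbox l u) G"
    using set_lebesgue_integral_eq_integral(2)[OF Gi] unfolding set_lebesgue_integral_def .
  finally show ?thesis
    unfolding set_lebesgue_integral_def eq .
qed

text \<open>Testing with bump functions shows that both gradients have the same integral over every box inside \<open>\<Omega>\<close>. By
Lebesgue's differentiation theorem for boxes they agree almost everywhere on each box, and countably many
boxes cover \<open>\<Omega>\<close>.\<close>

lemma weak_gradient_unique:
  fixes G G' :: "'a::euclidean_space \<Rightarrow> 'a"
  assumes "open \<Omega>" and G: "is_weak_gradient \<Omega> w G" and G': "is_weak_gradient \<Omega> w G'"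
  shows "AE x in lebesgue. x \<in> \<Omega> \<longrightarrow> G x = G' x"
proof -
  have ai: "G absolutely_integrable_on K" "G' absolutely_integrable_on K" if "compact K" "K \<subseteq> \<Omega>" for K
    using that G G' by (auto simp: is_weak_gradient_def)
  have int_eq: "integral (cbox l u) G = integral (cbox l u) G'" if "cbox l u \<subseteq> \<Omega>" for l u
  proof -
    have "(LINT x:\<Omega>|lebesgue. \<eta> x *\<^sub>R G x) = (LINT x:\<Omega>|lebesgue. \<eta> x *\<^sub>R G' x)" if "\<eta> \<in> test_functions \<Omega>" for \<eta>
      using G G' that by (auto simp: is_weak_gradient_def)
    then have "(LINT x:\<Omega>|lebesgue. bump n l u x *\<^sub>R G x) = (LINT x:\<Omega>|lebesgue. bump n l u x *\<^sub>R G' x)" for n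
      using bump_test_function[OF that] by simp
    with weak_gradient_box_integral[OF ai(1) that] weak_gradient_box_integral[OF ai(2) that] show ?thesis
      by (simp add: LIMSEQ_unique)
  qed
  have local: "AE x in lebesgue. x \<in> box a b \<longrightarrow> G x = G' x" if ab: "cbox a b \<subseteq> \<Omega>" for a b
  proof -
    define f where "f x = (if x \<in> cbox a b then G x - G' x else 0)" for x
    have D: "(\<lambda>x. G x - G' x) absolutely_integrable_on cbox a b"
      using ai[OF compact_cbox ab] by (intro set_integral_diff)
    then have "f integrable_on UNIV"
      unfolding f_def integrable_restrict_UNIV by (rule set_lebesgue_integral_eq_integral(1))
    then have "f integrable_on cbox l u" for l u
      by (rule integrable_on_subcbox) simp
    then obtain N where N: "negligible N" "\<And>x e. x \<notin> N \<Longrightarrow> 0 < e \<Longrightarrow> \<exists>d>0. \<forall>h. 0 < h \<and> h < d \<longrightarrow>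
         norm (integral (cbox x (x + h *\<^sub>R One)) f /\<^sub>R h ^ DIM('a) - f x) < e"
      using integrable_ccontinuous_explicit[of f] by blast
    have "f x = 0" if x: "x \<in> box a b" "x \<notin> N" for x
    proof (rule ccontr)
      assume "f x \<noteq> 0"
      then obtain d where d: "d > 0" "\<And>h. 0 < h \<and> h < d \<Longrightarrow> norm (integral (cbox x (x + h *\<^sub>R One)) f /\<^sub>R h ^ DIM('a) - f x) < norm (f x)"
        using N(2)[OF x(2), of "norm (f x)"] by auto
      obtain e where e: "e > 0" "ball x e \<subseteq> box a b"
        using open_contains_ball[of "box a b"] x(1) open_box by blast
      \<comment> \<open>Small enough for the difference quotient estimate, and for the cube at \<open>x\<close> to stay inside the box.\<close>
      define h where "h = min (d / 2) (e / (2 * (norm (One::'a) + 1)))"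
      have n1: "norm (One::'a) + 1 > 0" by (rule add_nonneg_pos) auto
      have h: "0 < h" "h < d" "h * (norm (One::'a) + 1) < e"
      proof -
        show "0 < h" using d(1) e(1) n1 by (simp add: h_def)
        show "h < d" using d(1) by (simp add: h_def min_less_iff_disj)
        have "h * (norm (One::'a) + 1) \<le> (e / (2 * (norm (One::'a) + 1))) * (norm (One::'a) + 1)"
          using n1 by (intro mult_right_mono) (auto simp: h_def)
        also have "\<dots> = e / 2" using n1 by (simp add: field_simps)
        finally show "h * (norm (One::'a) + 1) < e" using e by simp
      qed
      have "cbox x (x + h *\<^sub>R One) \<subseteq> box a b"
      proof
        fix y assume y: "y \<in> cbox x (x + h *\<^sub>R One)"
        have "norm (y - x) \<le> norm (h *\<^sub>R (One::'a))"
          by (rule norm_le_componentwise) (use y h in \<open>auto simp: mem_box inner_diff_left inner_add_left\<close>)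
        also have "\<dots> < e" using h by (simp add: algebra_simps)
        finally show "y \<in> box a b" using e(2) by (auto simp: dist_norm norm_minus_commute)
      qed
      then have sub: "cbox x (x + h *\<^sub>R One) \<subseteq> cbox a b" using box_subset_cbox by blast
      have "integral (cbox x (x + h *\<^sub>R One)) f = integral (cbox x (x + h *\<^sub>R One)) (\<lambda>x. G x - G' x)"
        using sub by (intro integral_cong) (auto simp: f_def)
      also have "\<dots> = 0"
        using int_eq[of x "x + h *\<^sub>R One"] sub ab ai[OF compact_cbox, of x "x + h *\<^sub>R One"]
        by (subst integral_diff) (auto intro: set_lebesgue_integral_eq_integral(1))
      finally show False using d(2)[of h] h by simp
    qed
    then have "G x = G' x" if "x \<in> box a b" "x \<notin> N" for x
      using that box_subset_cbox[of a b] by (force simp: f_def)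
    moreover note AE_not_negligible[OF N(1)]
    ultimately show ?thesis by (auto elim!: eventually_mono)
  qed
  obtain \<D> where \<D>: "countable \<D>" "\<And>X. X \<in> \<D> \<Longrightarrow> X \<subseteq> \<Omega> \<and> (\<exists>a b. X = cbox a b)" "\<Union>\<D> = \<Omega>"
    using open_countable_Union_open_cbox[OF assms(1)] by (metis Sup_upper)
  have "AE x in lebesgue. \<forall>X\<in>\<D>. x \<in> X \<longrightarrow> G x = G' x"
  proof (subst AE_ball_countable[OF \<D>(1)], intro ballI)
    fix X assume "X \<in> \<D>"
    with \<D>(2) obtain a b where X: "X = cbox a b" "cbox a b \<subseteq> \<Omega>" by blast
    have "AE x in lebesgue. x \<notin> cbox a b - box a b"
      by (rule AE_not_negligible[OF negligible_frontier_interval])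
    with local[OF X(2)] show "AE x in lebesgue. x \<in> X \<longrightarrow> G x = G' x"
      unfolding X(1) by eventually_elim auto
  qed
  then show ?thesis using \<D>(3) by (auto elim!: eventually_mono)
qed

lemma integrable_annulus_of_square:
  fixes f :: "'a::euclidean_space \<Rightarrow> 'b::euclidean_space"
  assumes m: "f \<in> borel_measurable (lebesgue_on (annulus R))" and sq: "integrable (lebesgue_on (annulus R)) (\<lambda>x. (norm (f x))\<^sup>2)"
  shows "integrable (lebesgue_on (annulus R)) f"
proof (rule Bochner_Integration.integrable_bound)
  have c: "integrable (lebesgue_on (annulus R :: 'a set)) (\<lambda>_. 1::real)"
    by (rule integrable_annulus(1)) auto
  show "integrable (lebesgue_on (annulus R)) (\<lambda>x. 1 + (norm (f x))\<^sup>2)"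
    using c sq by (rule Bochner_Integration.integrable_add)
  have "t \<le> 1 + t\<^sup>2" for t :: real
    using zero_le_power2[of "t - 1"] zero_le_power2[of t] unfolding power2_diff power_one mult_1_right by linarith
  then show "AE x in lebesgue_on (annulus R). norm (f x) \<le> norm (1 + (norm (f x))\<^sup>2)"
    by (auto intro!: AE_I2)
qed (rule m)

text \<open>A test function for the exterior domain is supported in some annulus, so integration by parts for smooth
functions passes to the limit by convergence of inner products there.\<close>

lemma is_weak_gradient_limit:
  fixes w :: "'a::euclidean_space \<Rightarrow> real"
  assumes s: "\<And>n. smooth (\<psi> n)"
    and L: "\<And>R. R > 1 \<Longrightarrow> L2_converges (lebesgue_on (annulus R)) \<psi> w"
      "\<And>R. R > 1 \<Longrightarrow> L2_converges (lebesgue_on (annulus R)) (\<lambda>n. grad (\<psi> n)) G"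
  shows "is_weak_gradient (- cball 0 1) w G"
proof -
  let ?\<Omega> = "- cball (0::'a) 1"
  have meas: "w \<in> borel_measurable (lebesgue_on (annulus R))" "G \<in> borel_measurable (lebesgue_on (annulus R))" if "R > 1" for R
    using L[OF that] by (auto simp: L2_converges_def)
  have sq: "integrable (lebesgue_on (annulus R)) (\<lambda>y. (norm (w y))\<^sup>2)" "integrable (lebesgue_on (annulus R)) (\<lambda>y. (norm (G y))\<^sup>2)" if "R > 1" for R
    using L2_converges_norm(1)[OF L(1)[OF that]] L2_converges_norm(1)[OF L(2)[OF that]] integrable_annulus_smooth[OF s] by blast+
  have int: "integrable (lebesgue_on (annulus R)) w" "integrable (lebesgue_on (annulus R)) G" if "R > 1" for R
    using integrable_annulus_of_square[OF meas(1)[OF that] sq(1)[OF that]] integrable_annulus_of_square[OF meas(2)[OF that] sq(2)[OF that]] by blast+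
  have big: "\<exists>R>1. K \<subseteq> annulus R" if K: "compact K" "K \<subseteq> ?\<Omega>" for K
  proof -
    obtain B where B: "\<forall>x\<in>K. norm x \<le> B" using compact_imp_bounded[OF K(1)] by (auto simp: bounded_iff)
    have "K \<subseteq> annulus (max 2 (B + 1))" using B K(2) by (force simp: less_max_iff_disj)
    then show ?thesis by (intro exI[of _ "max 2 (B + 1)"]) auto
  qed
  have ai: "f absolutely_integrable_on K"
    if "compact K" "K \<subseteq> annulus R" "integrable (lebesgue_on (annulus R)) f" for K R and f :: "'a \<Rightarrow> 'b::euclidean_space"
  proof -
    have "set_integrable lebesgue (annulus R) f"
      using that(3) by (subst (asm) integrable_restrict_space) (auto simp: set_integrable_def)
    then show ?thesis
      by (rule set_integrable_subset) (use that(1,2) in \<open>auto simp: compact_imp_closed\<close>)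
  qed
  have ibp: "(LINT x:?\<Omega>|lebesgue. w x *\<^sub>R grad \<eta> x) = - (LINT x:?\<Omega>|lebesgue. \<eta> x *\<^sub>R G x)" if \<eta>: "\<eta> \<in> test_functions ?\<Omega>" for \<eta>
  proof -
    define K where "K = closure {x. \<eta> x \<noteq> 0}"
    have K: "compact K" "K \<subseteq> ?\<Omega>" and s\<eta>: "smooth \<eta>" using \<eta> by (auto simp: K_def test_functions_def)
    have \<eta>0: "\<eta> x = 0" if "x \<notin> K" for x
      using that closure_subset[of "{x. \<eta> x \<noteq> 0}"] by (auto simp: K_def)
    have g\<eta>0: "grad \<eta> x = 0" if "x \<notin> K" for x
    proof (rule grad_eqI)
      have o: "open (- K)" using K by (simp add: compact_imp_closed open_Compl)
      have z: "((\<lambda>_. 0) has_derivative (\<lambda>h. 0 \<bullet> h)) (at x)" by simp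
      show "(\<eta> has_derivative (\<lambda>h. 0 \<bullet> h)) (at x)"
        by (rule has_derivative_transform_within_open[OF z o]) (use that \<eta>0 in auto)
    qed
    obtain R where R: "R > 1" "K \<subseteq> annulus R" using big[OF K] by blast
    let ?M = "lebesgue_on (annulus R :: 'a set)"
    have conv: "(LINT x:?\<Omega>|lebesgue. f x) = (\<integral>x. f x \<partial>?M)" if "\<And>x. x \<notin> K \<Longrightarrow> f x = 0" for f :: "'a \<Rightarrow> 'a"
    proof -
      have eq: "indicator ?\<Omega> x *\<^sub>R f x = indicator (annulus R) x *\<^sub>R f x" for x
        using that[of x] K(2) R(2) by (cases "x \<in> K") (auto simp: indicator_def)
      show ?thesis
        unfolding set_lebesgue_integral_def eq by (rule integral_restrict_space[symmetric]) auto
    qed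
    have cg: "continuous_on A (\<lambda>x. grad \<eta> x \<bullet> i)" "continuous_on A (\<lambda>x. \<eta> x *\<^sub>R i)" for i and A
      by (intro continuous_intros smooth_grad_continuous_on smooth_continuous_on s\<eta>)+
    have m1: "(\<lambda>x. grad \<eta> x \<bullet> i) \<in> borel_measurable ?M" "(\<lambda>x. \<eta> x *\<^sub>R i) \<in> borel_measurable ?M" for i
      by (intro borel_measurable_lebesgue_on borel_measurable_continuous_onI cg)+
    have q1: "integrable ?M (\<lambda>x. (norm (grad \<eta> x \<bullet> i))\<^sup>2)" "integrable ?M (\<lambda>x. (norm (\<eta> x *\<^sub>R i))\<^sup>2)" for i
      by (rule integrable_annulus, intro continuous_intros smooth_grad_continuous_on smooth_continuous_on s\<eta>)+
    have comp: "(\<integral>x. w x * (grad \<eta> x \<bullet> i) \<partial>?M) = - (\<integral>x. G x \<bullet> (\<eta> x *\<^sub>R i) \<partial>?M)" if i: "i \<in> Basis" for i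
    proof -
      have "(\<integral>x. \<psi> n x * (grad \<eta> x \<bullet> i) \<partial>?M) = - (\<integral>x. grad (\<psi> n) x \<bullet> (\<eta> x *\<^sub>R i) \<partial>?M)" for n
      proof -
        let ?g = "\<lambda>x. grad (\<lambda>x. \<psi> n x * \<eta> x) x \<bullet> i"
        have sp: "smooth (\<lambda>x. \<psi> n x * \<eta> x)" by (rule smooth_mult[OF s s\<eta>])
        have "continuous_on (- {0}) (\<lambda>x. ?g x)"
          by (intro continuous_intros smooth_grad_continuous_on sp)
        from integrable_annulus(3)[OF this, of R]
        have "(\<integral>x. ?g x \<partial>?M) = (\<integral>x. ?g x \<partial>lborel)"
        proof (rule trans)
          show "(\<integral>x. indicator (annulus R) x * (?g x) \<partial>lborel) = (\<integral>x. ?g x \<partial>lborel)"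
          proof (rule Bochner_Integration.integral_cong[OF refl])
            fix x show "indicator (annulus R) x * (?g x) = ?g x"
              using R(2) \<eta>0[of x] g\<eta>0[of x] by (cases "x \<in> K") (auto simp: indicator_def grad_mult[OF s s\<eta>])
          qed
        qed
        also have "\<dots> = 0"
          by (rule integral_grad_eq_0[OF sp K(1) _ i]) (simp add: \<eta>0)
        finally have 0: "(\<integral>x. ?g x \<partial>?M) = 0" .
        have "integrable ?M (\<lambda>x. \<psi> n x * (grad \<eta> x \<bullet> i))" "integrable ?M (\<lambda>x. grad (\<psi> n) x \<bullet> (\<eta> x *\<^sub>R i))"
          by (rule integrable_annulus, intro continuous_intros smooth_grad_continuous_on smooth_continuous_on s s\<eta>)+
        then have "(\<integral>x. \<psi> n x * (grad \<eta> x \<bullet> i) + grad (\<psi> n) x \<bullet> (\<eta> x *\<^sub>R i) \<partial>?M)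
          = (\<integral>x. \<psi> n x * (grad \<eta> x \<bullet> i) \<partial>?M) + (\<integral>x. grad (\<psi> n) x \<bullet> (\<eta> x *\<^sub>R i) \<partial>?M)"
          by (rule Bochner_Integration.integral_add)
        moreover have "(\<lambda>x. \<psi> n x * (grad \<eta> x \<bullet> i) + grad (\<psi> n) x \<bullet> (\<eta> x *\<^sub>R i)) = (\<lambda>x. ?g x)"
          by (auto simp: grad_mult[OF s s\<eta>] inner_add_left)
        ultimately show ?thesis using 0 by simp
      qed
      moreover have "(\<lambda>n. \<integral>x. \<psi> n x * (grad \<eta> x \<bullet> i) \<partial>?M) \<longlonglongrightarrow> (\<integral>x. w x * (grad \<eta> x \<bullet> i) \<partial>?M)"
        using L2_converges_inner[OF L(1)[OF R(1)] L2_converges_const[OF m1(1)] integrable_annulus_smooth(1)[OF s] q1(1)] by simp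
      moreover have "(\<lambda>n. - (\<integral>x. grad (\<psi> n) x \<bullet> (\<eta> x *\<^sub>R i) \<partial>?M)) \<longlonglongrightarrow> - (\<integral>x. G x \<bullet> (\<eta> x *\<^sub>R i) \<partial>?M)"
        by (rule tendsto_minus[OF L2_converges_inner[OF L(2)[OF R(1)] L2_converges_const[OF m1(2)] integrable_annulus_smooth(2)[OF s] q1(2)]])
      ultimately show ?thesis by (simp add: LIMSEQ_unique)
    qed
    have "\<eta> \<in> borel_measurable ?M" "grad \<eta> \<in> borel_measurable ?M"
      by (intro borel_measurable_lebesgue_on smooth_borel s\<eta>)+
    note m2 = this
    have Iw: "integrable ?M (\<lambda>x. w x *\<^sub>R grad \<eta> x)"
    proof -
      have "integrable ?M (\<lambda>x. norm (w x) * norm (grad \<eta> x))"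
        using square_integrable_inner[of "\<lambda>x. norm (w x)" ?M "\<lambda>x. norm (grad \<eta> x)"] meas[OF R(1)] m2 sq[OF R(1)] integrable_annulus_smooth[OF s\<eta>] by simp
      then show ?thesis
        by (rule Bochner_Integration.integrable_bound) (use meas[OF R(1)] m2 in auto)
    qed
    have IG: "integrable ?M (\<lambda>x. \<eta> x *\<^sub>R G x)"
    proof -
      have "integrable ?M (\<lambda>x. norm (\<eta> x) * norm (G x))"
        using square_integrable_inner[of "\<lambda>x. norm (\<eta> x)" ?M "\<lambda>x. norm (G x)"] meas[OF R(1)] m2 sq[OF R(1)] integrable_annulus_smooth[OF s\<eta>] by simp
      then show ?thesis
        by (rule Bochner_Integration.integrable_bound) (use meas[OF R(1)] m2 in auto)
    qed
    have "(\<integral>x. w x *\<^sub>R grad \<eta> x \<partial>?M) = - (\<integral>x. \<eta> x *\<^sub>R G x \<partial>?M)"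
    proof (rule euclidean_eqI)
      fix i :: 'a assume "i \<in> Basis"
      from comp[OF this]
      show "(\<integral>x. w x *\<^sub>R grad \<eta> x \<partial>?M) \<bullet> i = (- (\<integral>x. \<eta> x *\<^sub>R G x \<partial>?M)) \<bullet> i"
        using integral_inner_left[of i ?M "\<lambda>x. w x *\<^sub>R grad \<eta> x"] integral_inner_left[of i ?M "\<lambda>x. \<eta> x *\<^sub>R G x"] Iw IG
        by simp
    qed
    then show ?thesis
      by (subst (1 2) conv) (auto simp: \<eta>0 g\<eta>0)
  qed
  show ?thesis
    unfolding is_weak_gradient_def
  proof (intro conjI allI impI ballI)
    fix K :: "'a set" assume "compact K \<and> K \<subseteq> ?\<Omega>"
    then obtain R where R: "R > 1" "compact K" "K \<subseteq> annulus R" using big by blast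
    show "w absolutely_integrable_on K" "G absolutely_integrable_on K"
      by (rule ai[OF R(2,3) int(1)[OF R(1)]], rule ai[OF R(2,3) int(2)[OF R(1)]])
  qed (rule ibp)
qed

section \<open>The energy in annuli\<close>

lemma weighted_inverse_bound:
  assumes "norm y > 1"
  shows "norm (((c::real) * a) *\<^sub>R inversion y - (c * b) *\<^sub>R inversion y) \<le> \<bar>c\<bar> * norm (a - b)"
proof -
  have "(c * a) *\<^sub>R inversion y - (c * b) *\<^sub>R inversion y = (c * (a - b)) *\<^sub>R inversion y"
    by (simp only: right_diff_distrib scaleR_diff_left)
  then have "norm ((c * a) *\<^sub>R inversion y - (c * b) *\<^sub>R inversion y) = \<bar>c\<bar> * norm (a - b) * inverse (norm y)"
    by (simp add: abs_mult norm_inversion)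
  also have "\<dots> \<le> \<bar>c\<bar> * norm (a - b) * 1"
    using assms by (intro mult_left_mono) (auto simp: inverse_le_1_iff)
  finally show ?thesis by simp
qed

text \<open>The Cauchy condition in the Hardy norm gives a limit of \<open>A \<psi>\<close> in \<open>L\<^sup>2\<close>; subtracting the convergent
zeroth-order term shows that \<open>\<nabla>\<psi>\<close> converges on annuli, to a weak gradient of \<open>w\<close>. By uniqueness it is the
chosen representative, and the limit of \<open>A \<psi>\<close> is \<open>Z\<close> whatever the sequence \<open>\<phi>\<close> is.\<close>

lemma H_approx_kelvin:
  fixes w :: "'a::euclidean_space \<Rightarrow> real"
  assumes N: "DIM('a) \<ge> 3" and H: "H_approx \<phi> (kelvin w)"
  defines "Z \<equiv> \<lambda>y. weak_gradient (- cball 0 1) w y + ((real DIM('a) - 2) / 2 * w y) *\<^sub>R inversion y"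
  shows "\<And>R. R > 1 \<Longrightarrow> L2_converges (lebesgue_on (annulus R)) (\<lambda>n. kelvin (\<phi> n)) w"
    and "\<And>R. R > 1 \<Longrightarrow> L2_converges (lebesgue_on (annulus R)) (\<lambda>n. grad (kelvin (\<phi> n))) (weak_gradient (- cball 0 1) w)"
    and "L2_converges (lebesgue_on (- cball 0 1)) (\<lambda>n. hardy_grad (kelvin (\<phi> n))) Z"
    and "integrable (lebesgue_on (- cball 0 1)) (\<lambda>y. (norm (Z y))\<^sup>2)"
    and "(\<lambda>n. (hardy_norm (\<phi> n))\<^sup>2) \<longlonglongrightarrow> (\<integral>y. (norm (Z y))\<^sup>2 \<partial>lebesgue_on (- cball 0 1))"
proof -
  let ?\<Omega> = "- cball (0::'a) 1" and ?c = "(real DIM('a) - 2) / 2"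
  let ?M = "lebesgue_on ?\<Omega>"
  define \<psi> where "\<psi> = (\<lambda>n. kelvin (\<phi> n))"
  have \<psi>n: "kelvin (\<phi> n) = \<psi> n" for n by (simp add: \<psi>_def)
  have t: "\<phi> n \<in> test_functions (ball 0 1)" for n using H by (simp add: H_approx_def)
  have s: "smooth (\<psi> n)" for n unfolding \<psi>_def by (rule smooth_kelvin[OF N t])
  have L: "L2_converges (lebesgue_on (ball 0 1)) \<phi> (kelvin w)" using H by (simp add: H_approx_def)
  have wm: "w \<in> borel_measurable ?M"
    by (rule L2_converges_kelvin(1)[OF N _ L t, of 2]) simp
  show L1: "L2_converges (lebesgue_on (annulus R)) (\<lambda>n. kelvin (\<phi> n)) w" if "R > 1" for R
    by (rule L2_converges_kelvin(2)[OF N that L t])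
  have hm: "hardy_grad (\<psi> n) \<in> borel_measurable ?M" for n
    unfolding \<psi>_def by (intro borel_measurable_lebesgue_on hardy_norm_kelvin(2)[OF N t])
  have inv_m: "inversion \<in> borel_measurable (lebesgue_on S)" for S :: "'a set"
    by (intro borel_measurable_lebesgue_on) simp
  have diff: "L2sq ?M (\<lambda>y. hardy_grad (\<psi> m) y - hardy_grad (\<psi> n) y) = ennreal ((hardy_norm (\<lambda>x. \<phi> m x - \<phi> n x))\<^sup>2)" for m n
    using hardy_norm_kelvin(1)[OF N test_function_diff[OF t t], of m n]
    unfolding kelvin_diff \<psi>n hardy_grad_diff[OF s s] .
  have "\<exists>V. L2_converges ?M (\<lambda>n. hardy_grad (\<psi> n)) V"
  proof (rule L2_complete[OF hm])
    fix e :: real assume e: "e > 0"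
    then have "sqrt e > 0" by simp
    moreover have "\<forall>e>0. \<exists>M. \<forall>m\<ge>M. \<forall>n\<ge>M. hardy_norm (\<lambda>x. \<phi> m x - \<phi> n x) < e"
      using H by (simp add: H_approx_def)
    ultimately obtain M where M: "\<And>m n. m \<ge> M \<Longrightarrow> n \<ge> M \<Longrightarrow> hardy_norm (\<lambda>x. \<phi> m x - \<phi> n x) < sqrt e"
      by blast
    show "\<exists>M. \<forall>m\<ge>M. \<forall>n\<ge>M. L2sq ?M (\<lambda>y. hardy_grad (\<psi> m) y - hardy_grad (\<psi> n) y) \<le> ennreal e"
    proof (intro exI[of _ M] allI impI)
      fix m n assume mn: "M \<le> m" "M \<le> n"
      have "0 \<le> hardy_norm (\<lambda>x. \<phi> m x - \<phi> n x)"
        unfolding hardy_norm_eq(2)[OF N test_function_diff[OF t t]] by simp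
      then have "(hardy_norm (\<lambda>x. \<phi> m x - \<phi> n x))\<^sup>2 \<le> (sqrt e)\<^sup>2"
        using M[OF mn] by (intro power_mono) auto
      then show "L2sq ?M (\<lambda>y. hardy_grad (\<psi> m) y - hardy_grad (\<psi> n) y) \<le> ennreal e"
        unfolding diff using e by (intro ennreal_leI) simp
    qed
  qed
  then obtain V where V: "L2_converges ?M (\<lambda>n. hardy_grad (\<psi> n)) V" by blast
  have Vm: "V \<in> borel_measurable ?M" using V by (simp add: L2_converges_def)
  define G where "G y = V y + ((- ?c) * w y) *\<^sub>R inversion y" for y
  have sub: "annulus R \<subseteq> ?\<Omega>" for R by auto
  have LG: "L2_converges (lebesgue_on (annulus R)) (\<lambda>n. grad (\<psi> n)) G" if R: "R > 1" for R
  proof -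
    have "L2_converges (lebesgue_on (annulus R)) (\<lambda>n. hardy_grad (\<psi> n)) V"
      by (rule L2_converges_restrict[OF V sub]) auto
    moreover have "L2_converges (lebesgue_on (annulus R)) (\<lambda>n y. ((- ?c) * \<psi> n y) *\<^sub>R inversion y) (\<lambda>y. ((- ?c) * w y) *\<^sub>R inversion y)"
    proof (rule L2_converges_lipschitz[where T = "\<lambda>y a. ((- ?c) * a) *\<^sub>R inversion y" and C = "\<bar>- ?c\<bar>"])
      show "L2_converges (lebesgue_on (annulus R)) \<psi> w" using L1[OF R] by (simp add: \<psi>_def)
      then have m: "\<psi> n \<in> borel_measurable (lebesgue_on (annulus R))" "w \<in> borel_measurable (lebesgue_on (annulus R))" for n
        by (auto simp: L2_converges_def)
      show "(\<lambda>y. ((- ?c) * \<psi> n y) *\<^sub>R inversion y) \<in> borel_measurable (lebesgue_on (annulus R))" for n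
        by (intro borel_measurable_scaleR borel_measurable_times borel_measurable_const m inv_m)
      show "(\<lambda>y. ((- ?c) * w y) *\<^sub>R inversion y) \<in> borel_measurable (lebesgue_on (annulus R))"
        by (intro borel_measurable_scaleR borel_measurable_times borel_measurable_const m inv_m)
      show "norm (((- ?c) * a) *\<^sub>R inversion y - ((- ?c) * b) *\<^sub>R inversion y) \<le> \<bar>- ?c\<bar> * norm (a - b)"
        if "y \<in> space (lebesgue_on (annulus R))" for y a b
        using that by (intro weighted_inverse_bound) (auto simp: space_restrict_space)
    qed
    ultimately have "L2_converges (lebesgue_on (annulus R)) (\<lambda>n y. hardy_grad (\<psi> n) y + ((- ?c) * \<psi> n y) *\<^sub>R inversion y) G"
      unfolding G_def by (rule L2_converges_add)
    then show ?thesis by (simp add: hardy_grad_def)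
  qed
  have wg: "is_weak_gradient ?\<Omega> w G"
    by (rule is_weak_gradient_limit[OF s _ LG]) (use L1 in \<open>simp_all add: \<psi>_def\<close>)
  then have wg': "is_weak_gradient ?\<Omega> w (weak_gradient ?\<Omega> w)"
    unfolding weak_gradient_def by (rule someI[of "is_weak_gradient ?\<Omega> w"])
  have AE: "AE y in lebesgue. y \<in> ?\<Omega> \<longrightarrow> G y = weak_gradient ?\<Omega> w y"
    by (rule weak_gradient_unique[OF _ wg wg']) auto
  have AE_M: "AE y in lebesgue_on S. G y = weak_gradient ?\<Omega> w y" if "S \<subseteq> ?\<Omega>" "S \<in> sets lebesgue" for S
    using AE that by (subst AE_restrict_space_iff) (auto elim!: eventually_mono)
  have Gm: "G \<in> borel_measurable ?M"
    unfolding G_def[abs_def]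
    by (intro borel_measurable_add borel_measurable_scaleR borel_measurable_times borel_measurable_const Vm wm inv_m)
  have wgm: "weak_gradient ?\<Omega> w \<in> borel_measurable ?M"
  proof -
    have "(\<lambda>y. indicator ?\<Omega> y *\<^sub>R G y) \<in> borel_measurable lebesgue"
      using Gm by (subst (asm) borel_measurable_restrict_space_iff) auto
    then have "(\<lambda>y. indicator ?\<Omega> y *\<^sub>R weak_gradient ?\<Omega> w y) \<in> borel_measurable lebesgue"
      by (rule borel_measurable_AE) (use AE in \<open>auto elim!: eventually_mono simp: indicator_def\<close>)
    then show ?thesis
      by (subst borel_measurable_restrict_space_iff) auto
  qed
  show "L2_converges (lebesgue_on (annulus R)) (\<lambda>n. grad (kelvin (\<phi> n))) (weak_gradient ?\<Omega> w)" if "R > 1" for R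
  proof (rule L2_converges_AE[OF LG[OF that, unfolded \<psi>_def]])
    show "weak_gradient ?\<Omega> w \<in> borel_measurable (lebesgue_on (annulus R))"
      by (rule measurable_restrict_mono[OF wgm sub])
    show "AE y in lebesgue_on (annulus R). G y = weak_gradient ?\<Omega> w y"
      by (rule AE_M[OF sub]) auto
  qed
  show LZ: "L2_converges ?M (\<lambda>n. hardy_grad (kelvin (\<phi> n))) Z"
  proof (rule L2_converges_AE[OF V[unfolded \<psi>_def]])
    show "Z \<in> borel_measurable ?M"
      unfolding Z_def
      by (intro borel_measurable_add borel_measurable_scaleR borel_measurable_times borel_measurable_const wgm wm inv_m)
    have "AE y in ?M. G y = weak_gradient ?\<Omega> w y" by (rule AE_M) auto
    then show "AE y in ?M. V y = Z y"
      by eventually_elim (auto simp: Z_def G_def algebra_simps)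
  qed
  have I: "integrable ?M (\<lambda>y. (norm (hardy_grad (kelvin (\<phi> n)) y))\<^sup>2)"
    and E: "(\<integral>y. (norm (hardy_grad (kelvin (\<phi> n)) y))\<^sup>2 \<partial>?M) = (hardy_norm (\<phi> n))\<^sup>2" for n
  proof -
    note h = hardy_norm_kelvin(1)[OF N t, of n] 
    show "integrable ?M (\<lambda>y. (norm (hardy_grad (kelvin (\<phi> n)) y))\<^sup>2)"
      using h hm[of n] by (subst square_integrable_iff) (auto simp: \<psi>_def)
    from nn_integral_eq_integral[OF this]
    show "(\<integral>y. (norm (hardy_grad (kelvin (\<phi> n)) y))\<^sup>2 \<partial>?M) = (hardy_norm (\<phi> n))\<^sup>2"
      using h by simp
  qed
  show "integrable ?M (\<lambda>y. (norm (Z y))\<^sup>2)"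
    by (rule L2_converges_norm(1)[OF LZ I])
  show "(\<lambda>n. (hardy_norm (\<phi> n))\<^sup>2) \<longlonglongrightarrow> (\<integral>y. (norm (Z y))\<^sup>2 \<partial>?M)"
    using L2_converges_norm(2)[OF LZ I] unfolding E .
qed

text \<open>With \<open>a\<close>, \<open>b\<close>, \<open>d\<close> the integrals of \<open>|\<nabla>w|\<^sup>2\<close>, \<open>w y* \<bullet> \<nabla>w\<close> and \<open>w\<^sup>2 / |y|\<^sup>2\<close>, both sides equal
\<open>a + 2 c b + c\<^sup>2 d\<close>: the energy contributes \<open>a - c\<^sup>2 d\<close>, and the boundary term contributes
\<open>c (2 b + 2 c d)\<close> as the limit of the flux identity for the approximating functions.\<close>

lemma energy_annulus:
  fixes w :: "'a::euclidean_space \<Rightarrow> real"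
  assumes N: "DIM('a) \<ge> 3" and H: "H_approx \<phi> (kelvin w)" and R: "R > 1"
  defines "Z \<equiv> \<lambda>y. weak_gradient (- cball 0 1) w y + ((real DIM('a) - 2) / 2 * w y) *\<^sub>R inversion y"
  shows "I_energy R w + Lambda_energy R w = (\<integral>y. (norm (Z y))\<^sup>2 \<partial>lebesgue_on (annulus R))"
proof -
  let ?c = "(real DIM('a) - 2) / 2" and ?M = "lebesgue_on (annulus R :: 'a set)"
  define D where "D = weak_gradient (- cball 0 1) w"
  define \<psi> where "\<psi> = (\<lambda>n. kelvin (\<phi> n))"
  have t: "\<phi> n \<in> test_functions (ball 0 1)" for n using H by (simp add: H_approx_def)
  have s: "smooth (\<psi> n)" for n unfolding \<psi>_def by (rule smooth_kelvin[OF N t])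
  have L1: "L2_converges ?M \<psi> w" and L2: "L2_converges ?M (\<lambda>n. grad (\<psi> n)) D"
    using H_approx_kelvin(1,2)[OF N H R] by (simp_all add: \<psi>_def D_def)
  obtain g0 where g0: "L2_converges (sphere_measure R) \<psi> g0"
    using trace_exists[OF R s L1 L2] by blast
  have "is_sphere_trace R w g0"
    unfolding is_sphere_trace_def using s L1 L2 g0 by (auto simp: D_def)
  then have "is_sphere_trace R w (sphere_trace R w)"
    unfolding sphere_trace_def by (rule someI[of "is_sphere_trace R w"])
  \<comment> \<open>The chosen trace comes with a sequence of its own, whose members need not vanish near the inner sphere; its square integral is compared with that of the limit of \<open>\<psi>\<close>.\<close>
  then obtain \<psi>' where \<psi>': "\<And>n. smooth (\<psi>' n)" "L2_converges ?M \<psi>' w" "L2_converges ?M (\<lambda>n. grad (\<psi>' n)) D"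
      "L2_converges (sphere_measure R) \<psi>' (sphere_trace R w)"
    unfolding is_sphere_trace_def D_def by blast
  have "R\<^sup>2 > 1" using R by (simp add: one_less_power)
  then have "R\<^sup>2 - 1 > 0" by linarith
  then have "R * (R\<^sup>2 - 1) > 0" using R by (intro mult_pos_pos) auto
  then have "R * (R\<^sup>2 - 1) \<noteq> 0" by linarith
  moreover have "R * (R\<^sup>2 - 1) * (\<integral>y. (sphere_trace R w y)\<^sup>2 \<partial>sphere_measure R) = R * (R\<^sup>2 - 1) * (\<integral>y. (g0 y)\<^sup>2 \<partial>sphere_measure R)"
    using trace_limit[OF R \<psi>'] trace_limit[OF R s L1 L2 g0] by simp
  ultimately have tr: "(\<integral>y. (sphere_trace R w y)\<^sup>2 \<partial>sphere_measure R) = (\<integral>y. (g0 y)\<^sup>2 \<partial>sphere_measure R)"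
    by (metis mult_left_cancel)
  have wm: "w \<in> borel_measurable ?M" and Dm: "D \<in> borel_measurable ?M"
    using L1 L2 by (auto simp: L2_converges_def)
  have inv_m: "inversion \<in> borel_measurable ?M"
    by (intro borel_measurable_lebesgue_on) simp
  have ab: "norm y > 1" if "y \<in> space ?M" for y
    using that by (auto simp: space_restrict_space)
  have wn: "t\<^sup>2 / (norm y)\<^sup>2 = (norm (t *\<^sub>R inversion y))\<^sup>2" for t and y :: 'a
    by (simp add: norm_inversion power_mult_distrib power_divide inverse_eq_divide)
  have Li: "L2_converges ?M (\<lambda>n y. (1 * \<psi> n y) *\<^sub>R inversion y) (\<lambda>y. (1 * w y) *\<^sub>R inversion y)"
  proof (rule L2_converges_lipschitz[OF L1, where T = "\<lambda>y a. (1 * a) *\<^sub>R inversion y" and C = "\<bar>1\<bar>"])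
    show "(\<lambda>y. (1 * \<psi> n y) *\<^sub>R inversion y) \<in> borel_measurable ?M" for n
      using L1 by (intro borel_measurable_scaleR borel_measurable_times borel_measurable_const inv_m) (auto simp: L2_converges_def)
    show "(\<lambda>y. (1 * w y) *\<^sub>R inversion y) \<in> borel_measurable ?M"
      by (intro borel_measurable_scaleR borel_measurable_times borel_measurable_const inv_m wm)
  qed (intro weighted_inverse_bound ab)
  then have Li: "L2_converges ?M (\<lambda>n y. \<psi> n y *\<^sub>R inversion y) (\<lambda>y. w y *\<^sub>R inversion y)" by simp
  have ci: "continuous_on (- {0}) (inversion :: 'a \<Rightarrow> 'a)"
    unfolding inversion_def[abs_def] by (intro continuous_intros) auto
  have sqi: "integrable ?M (\<lambda>y. (norm (\<psi> n y *\<^sub>R inversion y))\<^sup>2)" for n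
    by (rule integrable_annulus, intro continuous_intros smooth_continuous_on s ci)
  note sq\<psi> = integrable_annulus_smooth[OF s]
  note sqw = L2_converges_norm(1)[OF Li sqi] and sqD = L2_converges_norm(1)[OF L2 sq\<psi>(2)]
  have wim: "(\<lambda>y. w y *\<^sub>R inversion y) \<in> borel_measurable ?M"
    by (intro borel_measurable_scaleR wm inv_m)
  have cross: "integrable ?M (\<lambda>y. (w y *\<^sub>R inversion y) \<bullet> D y)"
    by (rule square_integrable_inner[OF wim Dm sqw sqD])
  define a where "a = (\<integral>y. (norm (D y))\<^sup>2 \<partial>?M)"
  define b where "b = (\<integral>y. (w y *\<^sub>R inversion y) \<bullet> D y \<partial>?M)"
  define d where "d = (\<integral>y. (norm (w y *\<^sub>R inversion y))\<^sup>2 \<partial>?M)"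
  have flux: "(1 / R) * (\<integral>y. (g0 y)\<^sup>2 \<partial>sphere_measure R) = 2 * b + (real DIM('a) - 2) * d"
  proof (rule LIMSEQ_unique)
    have "integrable (sphere_measure R) (\<lambda>y. (norm (\<psi> n y))\<^sup>2)" for n
      using R by (intro integrable_sphere_measure continuous_intros smooth_continuous[OF s]) auto
    from L2_converges_norm(2)[OF g0 this]
    show "(\<lambda>n. (1 / R) * (\<integral>y. (\<psi> n y)\<^sup>2 \<partial>sphere_measure R)) \<longlonglongrightarrow> (1 / R) * (\<integral>y. (g0 y)\<^sup>2 \<partial>sphere_measure R)"
      by (intro tendsto_intros) simp
    have eq: "(1 / R) * (\<integral>y. (\<psi> n y)\<^sup>2 \<partial>sphere_measure R)
      = 2 * (\<integral>y. (\<psi> n y *\<^sub>R inversion y) \<bullet> grad (\<psi> n) y \<partial>?M) + (real DIM('a) - 2) * (\<integral>y. (norm (\<psi> n y *\<^sub>R inversion y))\<^sup>2 \<partial>?M)" for n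
    proof -
      obtain \<rho> where "\<rho> > 1" "\<And>y. norm y \<le> \<rho> \<Longrightarrow> kelvin (\<phi> n) y = 0"
        using kelvin_eq_0[OF N t] by blast
      then have z: "\<psi> n y = 0" if "norm y = 1" for y using that by (simp add: \<psi>_def)
      have cr: "integrable ?M (\<lambda>y. (\<psi> n y *\<^sub>R inversion y) \<bullet> grad (\<psi> n) y)"
        by (rule integrable_annulus, intro continuous_intros smooth_continuous_on smooth_grad_continuous_on s ci)
      have "(1 / R) * (\<integral>y. (\<psi> n y)\<^sup>2 \<partial>sphere_measure R)
        = (\<integral>y. \<psi> n y * (2 * (inversion y \<bullet> grad (\<psi> n) y) + (real DIM('a) - 2) * (\<psi> n y / (norm y)\<^sup>2)) \<partial>?M)"
        by (rule sphere_integral_squared_zero[OF R s z])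
      also have "\<dots> = (\<integral>y. 2 * ((\<psi> n y *\<^sub>R inversion y) \<bullet> grad (\<psi> n) y) + (real DIM('a) - 2) * (norm (\<psi> n y *\<^sub>R inversion y))\<^sup>2 \<partial>?M)"
      proof (rule Bochner_Integration.integral_cong[OF refl])
        fix y
        have "(norm (\<psi> n y *\<^sub>R inversion y))\<^sup>2 = \<psi> n y * (\<psi> n y / (norm y)\<^sup>2)"
          unfolding wn[symmetric] by (simp add: power2_eq_square[of "\<psi> n y"])
        then show "\<psi> n y * (2 * (inversion y \<bullet> grad (\<psi> n) y) + (real DIM('a) - 2) * (\<psi> n y / (norm y)\<^sup>2))
          = 2 * ((\<psi> n y *\<^sub>R inversion y) \<bullet> grad (\<psi> n) y) + (real DIM('a) - 2) * (norm (\<psi> n y *\<^sub>R inversion y))\<^sup>2"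
          by (simp only: inner_scaleR_left) (simp add: algebra_simps)
      qed
      also have "\<dots> = 2 * (\<integral>y. (\<psi> n y *\<^sub>R inversion y) \<bullet> grad (\<psi> n) y \<partial>?M) + (real DIM('a) - 2) * (\<integral>y. (norm (\<psi> n y *\<^sub>R inversion y))\<^sup>2 \<partial>?M)"
      proof -
        have "(\<integral>y. 2 * u y + k * v y \<partial>?M) = 2 * (\<integral>y. u y \<partial>?M) + k * (\<integral>y. v y \<partial>?M)"
          if "integrable ?M u" "integrable ?M v" for u v :: "'a \<Rightarrow> real" and k
          using that by simp
        from this[OF cr sqi] show ?thesis .
      qed
      finally show ?thesis .
    qed
    show "(\<lambda>n. (1 / R) * (\<integral>y. (\<psi> n y)\<^sup>2 \<partial>sphere_measure R)) \<longlonglongrightarrow> 2 * b + (real DIM('a) - 2) * d"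
      unfolding eq b_def d_def
      by (intro tendsto_add tendsto_mult tendsto_const L2_converges_inner[OF Li L2 sqi sq\<psi>(2)] L2_converges_norm(2)[OF Li sqi])
  qed
  have "(\<integral>y. (norm (Z y))\<^sup>2 \<partial>?M) = (\<integral>y. (norm (D y))\<^sup>2 + 2 * ?c * ((w y *\<^sub>R inversion y) \<bullet> D y) + ?c\<^sup>2 * (norm (w y *\<^sub>R inversion y))\<^sup>2 \<partial>?M)"
  proof (rule Bochner_Integration.integral_cong[OF refl])
    fix y
    have "(norm (p + k *\<^sub>R q))\<^sup>2 = (norm p)\<^sup>2 + 2 * k * (q \<bullet> p) + k\<^sup>2 * (norm q)\<^sup>2" for p q :: 'a and k
      unfolding power2_norm_eq_inner by (simp add: inner_add_left inner_add_right inner_commute power2_eq_square algebra_simps)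
    from this[of "D y" ?c "w y *\<^sub>R inversion y"]
    show "(norm (Z y))\<^sup>2 = (norm (D y))\<^sup>2 + 2 * ?c * ((w y *\<^sub>R inversion y) \<bullet> D y) + ?c\<^sup>2 * (norm (w y *\<^sub>R inversion y))\<^sup>2"
      unfolding Z_def D_def by (simp only: scaleR_scaleR)
  qed
  also have "\<dots> = a + 2 * ?c * b + ?c\<^sup>2 * d"
  proof -
    have "(\<integral>y. u y + j * v y + k * x y \<partial>?M) = (\<integral>y. u y \<partial>?M) + j * (\<integral>y. v y \<partial>?M) + k * (\<integral>y. x y \<partial>?M)"
      if "integrable ?M u" "integrable ?M v" "integrable ?M x" for u v x :: "'a \<Rightarrow> real" and j k
      using that by simp
    from this[OF sqD cross sqw] show ?thesis unfolding a_def b_def d_def .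
  qed
  finally have Zeq: "(\<integral>y. (norm (Z y))\<^sup>2 \<partial>?M) = a + 2 * ?c * b + ?c\<^sup>2 * d" .
  \<comment> \<open>The energy integrates over the annulus together with its inner sphere, a null set.\<close>
  have open_ann: "(LINT y:ball 0 R - ball 0 1|lebesgue. f y) = (\<integral>y. f y \<partial>?M)"
    if "integrable ?M f" for f :: "'a \<Rightarrow> real"
  proof -
    have fi: "integrable lebesgue (\<lambda>y. indicator (annulus R) y *\<^sub>R f y)"
      using that by (subst (asm) integrable_restrict_space) auto
    have ae: "AE y in lebesgue. indicator (annulus R) y *\<^sub>R f y = indicator (ball 0 R - ball 0 1) y *\<^sub>R f y"
      using AE_not_negligible[OF negligible_sphere[of "0::'a" 1]]
      by eventually_elim (auto simp: indicator_def)
    have "(\<integral>y. indicator (ball 0 R - ball 0 1) y *\<^sub>R f y \<partial>lebesgue) = (\<integral>y. indicator (annulus R) y *\<^sub>R f y \<partial>lebesgue)"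
    proof (rule Bochner_Integration.integral_cong_AE[symmetric])
      show m: "(\<lambda>y. indicator (annulus R) y *\<^sub>R f y) \<in> borel_measurable lebesgue" using fi by (rule borel_measurable_integrable)
      show "(\<lambda>y. indicator (ball 0 R - ball 0 1) y *\<^sub>R f y) \<in> borel_measurable lebesgue"
        by (rule borel_measurable_AE[OF m ae])
    qed (rule ae)
    also have "\<dots> = (\<integral>y. f y \<partial>?M)" by (rule integral_restrict_space[symmetric]) auto
    finally show ?thesis unfolding set_lebesgue_integral_def .
  qed
  have "I_energy R w = a - ?c\<^sup>2 * d"
    unfolding I_energy_def wn D_def[symmetric] open_ann[OF sqD] open_ann[OF sqw] a_def d_def ..
  moreover have "Lambda_energy R w = ?c * (2 * b + (real DIM('a) - 2) * d)"
    unfolding Lambda_energy_def tr flux[symmetric] by simp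
  ultimately show ?thesis
    unfolding Zeq by (simp add: power2_eq_square algebra_simps add_divide_distrib diff_divide_distrib)
qed

theorem mainTheorem8:
  fixes w :: "'a::euclidean_space \<Rightarrow> real"
  assumes "DIM('a) \<ge> 3"
    and "w \<in> W_space"
  shows "((\<lambda>\<epsilon>. I_energy (1 / \<epsilon>) w + Lambda_energy (1 / \<epsilon>) w) \<longlongrightarrow> (W_norm w)\<^sup>2) (at_right 0)"
proof -
  let ?\<Omega> = "- cball (0::'a) 1"
  let ?M = "lebesgue_on ?\<Omega>"
  define Z where "Z y = weak_gradient ?\<Omega> w y + ((real DIM('a) - 2) / 2 * w y) *\<^sub>R inversion y" for y
  define E where "E = (\<integral>y. (norm (Z y))\<^sup>2 \<partial>?M)"
  obtain \<phi> where \<phi>: "H_approx \<phi> (kelvin w)"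
    using assms(2) by (auto simp: W_space_def H_space_def)
  have lim: "(\<lambda>n. hardy_norm (\<phi> n)) \<longlonglongrightarrow> sqrt E" if "H_approx \<phi> (kelvin w)" for \<phi>
  proof -
    have "(\<lambda>n. sqrt ((hardy_norm (\<phi> n))\<^sup>2)) \<longlonglongrightarrow> sqrt E"
      unfolding E_def Z_def by (intro tendsto_real_sqrt H_approx_kelvin(5)[OF assms(1) that])
    moreover have "0 \<le> hardy_norm (\<phi> n)" for n
      using that by (subst hardy_norm_eq(2)[OF assms(1)]) (auto simp: H_approx_def)
    ultimately show ?thesis by simp
  qed
  have "W_norm w = sqrt E"
    unfolding W_norm_def H_norm_def
  proof (rule the_equality)
    show "\<exists>\<phi>. H_approx \<phi> (kelvin w) \<and> (\<lambda>n. hardy_norm (\<phi> n)) \<longlonglongrightarrow> sqrt E"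
      using \<phi> lim by blast
    show "L = sqrt E" if "\<exists>\<phi>. H_approx \<phi> (kelvin w) \<and> (\<lambda>n. hardy_norm (\<phi> n)) \<longlonglongrightarrow> L" for L
      using that lim LIMSEQ_unique by blast
  qed
  moreover have "E \<ge> 0" by (simp add: E_def)
  ultimately have W: "(W_norm w)\<^sup>2 = E" by simp
  have ZI: "integrable ?M (\<lambda>y. (norm (Z y))\<^sup>2)"
    unfolding Z_def by (rule H_approx_kelvin(4)[OF assms(1) \<phi>])
  then have ZI': "integrable lebesgue (\<lambda>y. indicator ?\<Omega> y *\<^sub>R (norm (Z y))\<^sup>2)"
    by (subst (asm) integrable_restrict_space) auto
  have "((\<lambda>R. \<integral>y. indicator (annulus R) y *\<^sub>R (norm (Z y))\<^sup>2 \<partial>lebesgue) \<longlongrightarrow> (\<integral>y. indicator ?\<Omega> y *\<^sub>R (norm (Z y))\<^sup>2 \<partial>lebesgue)) at_top"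
  proof (rule integral_dominated_convergence_at_top[where w = "\<lambda>y. indicator ?\<Omega> y *\<^sub>R (norm (Z y))\<^sup>2"])
    show "(\<lambda>y. indicator (annulus R) y *\<^sub>R (norm (Z y))\<^sup>2) \<in> borel_measurable lebesgue" for R
    proof -
      have "(\<lambda>y. indicator (annulus R) y *\<^sub>R (indicator ?\<Omega> y *\<^sub>R (norm (Z y))\<^sup>2)) \<in> borel_measurable lebesgue"
        by (rule borel_measurable_scaleR[OF borel_measurable_indicator borel_measurable_integrable[OF ZI']]) auto
      moreover have "(\<lambda>y. indicator (annulus R) y *\<^sub>R (indicator ?\<Omega> y *\<^sub>R (norm (Z y))\<^sup>2)) = (\<lambda>y. indicator (annulus R) y *\<^sub>R (norm (Z y))\<^sup>2)"
        by (auto simp: indicator_def fun_eq_iff)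
      ultimately show ?thesis by simp
    qed
    show "AE y in lebesgue. ((\<lambda>R. indicator (annulus R) y *\<^sub>R (norm (Z y))\<^sup>2) \<longlongrightarrow> indicator ?\<Omega> y *\<^sub>R (norm (Z y))\<^sup>2) at_top"
    proof (rule AE_I2, rule tendsto_eventually)
      fix y
      show "eventually (\<lambda>R. indicator (annulus R) y *\<^sub>R (norm (Z y))\<^sup>2 = indicator ?\<Omega> y *\<^sub>R (norm (Z y))\<^sup>2) at_top"
        using eventually_gt_at_top[of "norm y"] by eventually_elim (auto simp: indicator_def)
    qed
    show "\<forall>\<^sub>F R in at_top. AE y in lebesgue. norm (indicator (annulus R) y *\<^sub>R (norm (Z y))\<^sup>2) \<le> indicator ?\<Omega> y *\<^sub>R (norm (Z y))\<^sup>2"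
      by (intro always_eventually allI AE_I2) (auto simp: indicator_def)
  qed (use ZI' in auto)
  then have "((\<lambda>R. \<integral>y. (norm (Z y))\<^sup>2 \<partial>lebesgue_on (annulus R)) \<longlongrightarrow> E) at_top"
    unfolding E_def by (subst (1 2) integral_restrict_space) auto
  moreover have "eventually (\<lambda>R. (\<integral>y. (norm (Z y))\<^sup>2 \<partial>lebesgue_on (annulus R)) = I_energy R w + Lambda_energy R w) at_top"
    using eventually_gt_at_top[of 1]
    by eventually_elim (unfold Z_def, rule energy_annulus[OF assms(1) \<phi>, symmetric])
  ultimately have top: "((\<lambda>R. I_energy R w + Lambda_energy R w) \<longlongrightarrow> E) at_top"
    by (rule Lim_transform_eventually)
  have "filterlim (\<lambda>\<epsilon>::real. 1 / \<epsilon>) at_top (at_right 0)"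
    using filterlim_inverse_at_top_right by (simp add: inverse_eq_divide)
  from filterlim_compose[OF top this] show ?thesis unfolding W .
qed

end
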